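(* Let $N\ge3$, $p\in(1,p_N)$, and let $\Omega=\mathbb{D}_N$ be a ball in $\mathbb{R}^N$ of unit volume, with radius $R_N$. Then for every $I>0$ there exists a unique solution $(\gamma,\mathrm{v})$ of $(\mathbf{F}_I)$, and for every $\lambda>0$ a unique solution $(\alpha_\lambda,\psi_\lambda)$ of $(\mathbf{P}_\lambda)$. Furthermore (with $I=\lambda^{p/(p-1)}$): the solution is positive (i.e. $\alpha_\lambda>0$) $\iff\gamma>0\iff I<I^*(\mathbb{D}_N,p)\iff\lambda<\lambda^*(\mathbb{D}_N,p)$; the free boundary is nonempty (i.e. $\{\mathrm{v}>0\}\ne\Omega$) $\iff\gamma<0\iff I>I^*(\mathbb{D}_N,p)\iff\lambda>\lambda^*(\mathbb{D}_N,p)$; and $$\alpha_\lambda=c_N\lambda\left(1-\left(\frac{\lambda}{\lambda^*(\mathbb{D}_N,p)}\right)^{\frac{p}{p_N-p}}\right)\quad\forall\lambda>\lambda^*(\mathbb{D}_N,p),\qquad c_N=\frac1{N(N-2)\omega_NR_N^{N-2}}.$$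
   Context: $p_N=\frac N{N-2}$, $[t]_+=\max\{t,0\}$, $\omega_N=|B_1|$. Problem $(\mathbf{F}_I)$: find $(\gamma,\mathrm{v})\in\mathbb{R}\times C^{2,\beta}(\overline\Omega)$ with $-\Delta\mathrm{v}=[\mathrm{v}]_+^p$ in $\Omega$, $\mathrm{v}=\gamma$ on $\partial\Omega$, $\int_\Omega[\mathrm{v}]_+^p=I$. Problem $(\mathbf{P}_\lambda)$: find $(\alpha,\psi)$ with $-\Delta\psi=[\alpha+\lambda\psi]_+^p$ in $\Omega$, $\psi=0$ on $\partial\Omega$, $\int_\Omega[\alpha+\lambda\psi]_+^p=1$; the two are equivalent via $I=\lambda^{p/(p-1)}$, $\gamma=\lambda^{1/(p-1)}\alpha$, $\mathrm{v}=\lambda^{1/(p-1)}(\alpha+\lambda\psi)$. Let $u$ be the unique positive solution of $-\Delta u=u^p$ in $B_1(0)$, $u=0$ on $\partial B_1(0)$, $I_p=\int_{B_1(0)}u^p$, $I^*(\mathbb{D}_N,p)=I_p/R_N^{\frac2{p-1}-N+2}$ and $\lambda^*(\mathbb{D}_N,p)=I^*(\mathbb{D}_N,p)^{\frac{p-1}p}$ (this is the notation used here for this specific number). *)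

theory Defs
  imports "HOL-Analysis.Analysis"
begin

definition pd :: "'n::finite \<Rightarrow> (real^'n \<Rightarrow> real) \<Rightarrow> real^'n \<Rightarrow> real" where
  "pd i f x = frechet_derivative f (at x) (axis i 1)"

definition lap :: "(real^'n::finite \<Rightarrow> real) \<Rightarrow> real^'n \<Rightarrow> real" where
  "lap f x = (\<Sum>i\<in>UNIV. pd i (pd i f) x)"

definition C2_on :: "(real^'n::finite) set \<Rightarrow> (real^'n \<Rightarrow> real) \<Rightarrow> bool" where
  "C2_on S f \<longleftrightarrow> (\<forall>x\<in>S. f differentiable (at x)) \<and>
     (\<forall>i. \<forall>x\<in>S. pd i f differentiable (at x)) \<and>
     (\<forall>i j. continuous_on S (pd j (pd i f)))"

definition holder_on :: "real \<Rightarrow> (real^'n::finite) set \<Rightarrow> (real^'n \<Rightarrow> real) \<Rightarrow> bool" where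
  "holder_on \<beta> S g \<longleftrightarrow> (\<exists>C. \<forall>x\<in>S. \<forall>y\<in>S. \<bar>g x - g y\<bar> \<le> C * norm (x - y) powr \<beta>)"

text \<open>The Hoelder space C^{2,beta}(closure S) for an open set S: C^2 in S, all derivatives of
  order \<le> 1 (uniformly) continuous up to the boundary, second derivatives beta-Hoelder on S
  (hence also uniformly continuous up to the boundary).\<close>
definition C2beta_closure :: "real \<Rightarrow> (real^'n::finite) set \<Rightarrow> (real^'n \<Rightarrow> real) \<Rightarrow> bool" where
  "C2beta_closure \<beta> S f \<longleftrightarrow> C2_on S f \<and> continuous_on (closure S) f \<and>
     uniformly_continuous_on S f \<and>
     (\<forall>i. uniformly_continuous_on S (pd i f)) \<and>
     (\<forall>i j. holder_on \<beta> S (pd j (pd i f)))"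

definition pos_part :: "real \<Rightarrow> real" where
  "pos_part t = max t 0"

definition F_sol :: "real \<Rightarrow> real \<Rightarrow> (real^'n::finite) set \<Rightarrow> real \<Rightarrow> real \<Rightarrow> (real^'n \<Rightarrow> real) \<Rightarrow> bool" where
  "F_sol \<beta> p \<Omega> I \<gamma> v \<longleftrightarrow> C2beta_closure \<beta> \<Omega> v \<and>
     (\<forall>x\<in>\<Omega>. - lap v x = pos_part (v x) powr p) \<and>
     (\<forall>x\<in>frontier \<Omega>. v x = \<gamma>) \<and>
     ((\<lambda>x. pos_part (v x) powr p) has_integral I) \<Omega>"

definition P_sol :: "real \<Rightarrow> real \<Rightarrow> (real^'n::finite) set \<Rightarrow> real \<Rightarrow> real \<Rightarrow> (real^'n \<Rightarrow> real) \<Rightarrow> bool" where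
  "P_sol \<beta> p \<Omega> lam \<alpha> \<psi> \<longleftrightarrow> C2beta_closure \<beta> \<Omega> \<psi> \<and>
     (\<forall>x\<in>\<Omega>. - lap \<psi> x = pos_part (\<alpha> + lam * \<psi> x) powr p) \<and>
     (\<forall>x\<in>frontier \<Omega>. \<psi> x = 0) \<and>
     ((\<lambda>x. pos_part (\<alpha> + lam * \<psi> x) powr p) has_integral 1) \<Omega>"

definition LE_sol :: "real \<Rightarrow> (real^'n::finite \<Rightarrow> real) \<Rightarrow> bool" where
  "LE_sol p u \<longleftrightarrow> C2_on (ball 0 1) u \<and> continuous_on (cball 0 1) u \<and>
     (\<forall>x\<in>ball 0 1. u x > 0 \<and> - lap u x = u x powr p) \<and>
     (\<forall>x\<in>sphere 0 1. u x = 0)"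

definition Ip :: "'n::finite itself \<Rightarrow> real \<Rightarrow> real" where
  "Ip TYPE('n) p = (THE I. \<exists>u::real^'n \<Rightarrow> real. LE_sol p u \<and>
      integral (ball 0 1) (\<lambda>x. u x powr p) = I)"

end

theory Submission
  imports Defs
begin

text \<open>Moving planes show that every nontrivial solution on a ball is radial about the centre. The
  maximum principle used there, and the one showing that a radial solution is determined by its central
  value, need only explicit exponential barriers, no boundary regularity and no Hopf lemma. With \<open>U\<close> the
  solution of the radial initial value problem with \<open>U 0 = 1\<close>, all solutions are therefore the rescalings
  \<open>s powr (2/(p-1)) * U(s r)\<close>. The mass of this function in the ball of radius \<open>R\<close> is
  \<open>s powr \<kappa> * Q(s R)\<close> up to a constant, with \<open>Q\<close> nondecreasing and
  \<open>\<kappa> = 2/(p-1) + 2 - N > 0\<close> in the subcritical range; so it is a strictly increasing bijection of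
  \<open>s \<in> (0,\<infinity>)\<close>, which gives existence and uniqueness. Signs are read off from the unique zero of
  \<open>U\<close>, beyond which \<open>U\<close> is an explicit harmonic function.\<close>

section \<open>Gradients, Hessians and maximum principles\<close>

text \<open>The boundary value \<open>\<gamma>\<close> belongs to the unknowns and may be negative,
  so \<open>v\<close> may change sign and only \<open>v - \<gamma>\<close> is positive. Moving
  planes still apply because they see the nonlinearity \<open>f\<close> only through differences of
  its values: monotonicity of \<open>f\<close> makes a nonnegative reflected difference
  superharmonic, and a Lipschitz bound on the range of \<open>v\<close> controls thin caps. All
  comparisons are made on the Laplacians themselves. Treating the Laplacian as the trace of the
  derivative of the gradient turns its invariance under reflections into cyclicity of the trace. The
  condition p < N/(N-2), in the form m (p - 1) < 2 with m = N - 2, acts twice: it forces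
  \<open>U\<close> to reach zero, and it makes \<open>\<kappa>\<close> positive, so that the mass
  grows with the scale \<open>s\<close>.\<close>

definition lin_trace :: "(real^'n::finite \<Rightarrow> real^'n) \<Rightarrow> real" where
  "lin_trace F = (\<Sum>i\<in>UNIV. F (axis i 1) $ i)"

text \<open>Explicit witnesses let sums, multiples, reflections and barriers be combined by rules
  instead of recomputing partial derivatives.\<close>

definition grad_hess :: "(real^'n::finite) set \<Rightarrow> (real^'n \<Rightarrow> real) \<Rightarrow> (real^'n \<Rightarrow> real^'n) \<Rightarrow>
    (real^'n \<Rightarrow> real^'n \<Rightarrow> real^'n) \<Rightarrow> bool" where
  "grad_hess S f G H \<longleftrightarrow> (\<forall>x\<in>S. (f has_derivative (\<lambda>h. G x \<bullet> h)) (at x) \<and> (G has_derivative H x) (at x))"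

lemma lin_trace_add: "lin_trace (\<lambda>h. F h + G h) = lin_trace F + lin_trace G"
  by (simp add: lin_trace_def sum.distrib)

lemma lin_trace_scale: "lin_trace (\<lambda>h. c *\<^sub>R F h) = c * lin_trace F"
  by (simp add: lin_trace_def sum_distrib_left)

lemma lin_trace_id: "lin_trace (\<lambda>h::real^'n::finite. h) = real CARD('n)"
  by (simp add: lin_trace_def)

lemma lin_trace_rank_one: "lin_trace (\<lambda>h. (a \<bullet> h) *\<^sub>R b) = a \<bullet> b"
proof -
  have "a \<bullet> axis i 1 = a $ i" for i by (simp add: inner_axis)
  then have "lin_trace (\<lambda>h. (a \<bullet> h) *\<^sub>R b) = (\<Sum>i\<in>UNIV. a $ i * b $ i)" by (simp add: lin_trace_def)
  then show ?thesis by (simp add: inner_vec_def)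
qed

text \<open>\<open>R\<close> is an involution and the trace is cyclic, so the two copies of
  \<open>R\<close> meet and cancel. This is what makes the mirror image of a solution a solution of
  the same equation.\<close>

lemma lin_trace_conjugate_reflection:
  fixes e :: "real^'n::finite"
  assumes "norm e = 1" and H: "linear H"
  defines "R \<equiv> \<lambda>h. h - (2 * (e \<bullet> h)) *\<^sub>R e"
  shows "lin_trace (\<lambda>h. R (H (R h))) = lin_trace H"
proof -
  have R: "linear R" unfolding R_def
    by (rule linearI) (auto simp: algebra_simps inner_add_right inner_scaleR_right)
  have ee: "e \<bullet> e = 1" using assms(1) by (simp add: norm_eq_1)
  have RR: "R \<circ> R = id"
    by (rule ext) (simp add: R_def inner_diff_right ee algebra_simps)
  have tm: "lin_trace F = trace (matrix F)" for F :: "real^'n \<Rightarrow> real^'n"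
    by (simp add: lin_trace_def trace_def matrix_def)
  have "lin_trace (\<lambda>h. R (H (R h))) = trace (matrix (R \<circ> (H \<circ> R)))"
    by (simp add: tm o_def)
  also have "\<dots> = trace (matrix R ** matrix (H \<circ> R))"
    by (subst matrix_compose) (auto intro: linear_compose R H)
  also have "\<dots> = trace (matrix (H \<circ> R) ** matrix R)"
    by (rule trace_mul_sym)
  also have "\<dots> = trace (matrix ((H \<circ> R) \<circ> R))"
    by (subst matrix_compose) (auto intro: linear_compose R H)
  also have "(H \<circ> R) \<circ> R = H" using RR by (metis comp_assoc comp_id)
  finally show ?thesis by (simp add: tm)
qed

lemma grad_hess_pd:
  assumes "grad_hess S f G H" "x \<in> S"
  shows "pd i f x = G x $ i"
proof -
  have "(f has_derivative (\<lambda>h. G x \<bullet> h)) (at x)" using assms by (simp add: grad_hess_def)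
  then have "frechet_derivative f (at x) = (\<lambda>h. G x \<bullet> h)" by (metis frechet_derivative_at)
  then show ?thesis by (simp add: pd_def inner_axis)
qed

lemma has_derivative_nth:
  assumes "(G has_derivative H) (at x)"
  shows "((\<lambda>y. G y $ i) has_derivative (\<lambda>h. H h $ i)) (at x)"
  using bounded_linear.has_derivative[OF bounded_linear_vec_nth assms] .

lemma grad_hess_has_derivative_pd:
  assumes D: "grad_hess S f G H" and "open S" "x \<in> S"
  shows "(pd i f has_derivative (\<lambda>h. H x h $ i)) (at x)"
proof -
  have "((\<lambda>y. G y $ i) has_derivative (\<lambda>h. H x h $ i)) (at x)"
    using D \<open>x \<in> S\<close> by (intro has_derivative_nth) (simp add: grad_hess_def)
  then show ?thesis
    by (rule has_derivative_transform_within_open[OF _ \<open>open S\<close> \<open>x \<in> S\<close>]) (simp add: grad_hess_pd[OF D])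
qed

lemma grad_hess_pd_pd:
  assumes "grad_hess S f G H" "open S" "x \<in> S"
  shows "pd j (pd i f) x = H x (axis j 1) $ i"
  using frechet_derivative_at[OF grad_hess_has_derivative_pd[OF assms]] by (metis pd_def)

lemma grad_hess_lap:
  assumes "grad_hess S f G H" "open S" "x \<in> S"
  shows "lap f x = lin_trace (H x)"
  by (simp add: lap_def lin_trace_def grad_hess_pd_pd[OF assms])

lemma C2_on_grad_hess:
  assumes "C2_on S f"
  shows "\<exists>G H. grad_hess S f G H"
proof -
  define G where "G = (\<lambda>x. \<chi> i. pd i f x)"
  define H where "H = (\<lambda>x h. \<chi> i. frechet_derivative (pd i f) (at x) h)"
  have "(f has_derivative (\<lambda>h. G x \<bullet> h)) (at x)" if "x \<in> S" for x
  proof -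
    have D: "(f has_derivative frechet_derivative f (at x)) (at x)"
      using assms that by (simp add: C2_on_def frechet_derivative_works)
    then have lin: "linear (frechet_derivative f (at x))" by (rule has_derivative_linear)
    have "frechet_derivative f (at x) h = G x \<bullet> h" for h
    proof -
      have "frechet_derivative f (at x) h = frechet_derivative f (at x) (\<Sum>i\<in>UNIV. h $ i *\<^sub>R axis i 1)"
        by (simp add: basis_expansion flip: scalar_mult_eq_scaleR)
      also have "\<dots> = (\<Sum>i\<in>UNIV. h $ i * pd i f x)"
        by (simp add: linear_sum[OF lin] linear_scale[OF lin] pd_def)
      finally show ?thesis by (simp add: G_def inner_vec_def mult.commute)
    qed
    then show ?thesis using D by presburger
  qed
  moreover have "(G has_derivative H x) (at x)" if "x \<in> S" for x
  proof -
    have "((\<lambda>y. G y $ i) has_derivative (\<lambda>h. H x h $ i)) (at x)" for i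
      using assms that by (simp add: G_def H_def C2_on_def frechet_derivative_works)
    then have "((\<lambda>y. G y \<bullet> b) has_derivative (\<lambda>h. H x h \<bullet> b)) (at x)" if "b \<in> Basis" for b
      using that by (auto simp: Basis_vec_def inner_axis)
    then show ?thesis using has_derivative_componentwise_within by blast
  qed
  ultimately show ?thesis unfolding grad_hess_def by blast
qed

lemma grad_hess_subset: "grad_hess S f G H \<Longrightarrow> T \<subseteq> S \<Longrightarrow> grad_hess T f G H"
  by (auto simp: grad_hess_def)

lemma grad_hess_const: "grad_hess S (\<lambda>x. c) (\<lambda>x. 0) (\<lambda>x h. 0)"
  by (simp add: grad_hess_def)

lemma grad_hess_add:
  assumes "grad_hess S f G H" "grad_hess S f' G' H'"
  shows "grad_hess S (\<lambda>x. f x + f' x) (\<lambda>x. G x + G' x) (\<lambda>x h. H x h + H' x h)"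
  using assms by (auto simp: grad_hess_def inner_add_left intro!: derivative_intros)

lemma grad_hess_scale:
  assumes "grad_hess S f G H"
  shows "grad_hess S (\<lambda>x. c * f x) (\<lambda>x. c *\<^sub>R G x) (\<lambda>x h. c *\<^sub>R H x h)"
  using assms by (auto simp: grad_hess_def intro!: derivative_intros)

section \<open>Second-order minimum test and maximum principles by barriers\<close>

lemma grad_hess_local_min:
  fixes x :: "real^'n::finite"
  assumes D: "grad_hess S f G H" and S: "open S" "x \<in> S" and min: "\<And>y. y \<in> S \<Longrightarrow> f x \<le> f y"
  shows "0 \<le> lin_trace (H x)"
  unfolding lin_trace_def
proof (rule sum_nonneg)
  fix i :: 'n
  define a :: "real^'n" where "a = axis i 1"
  have na: "norm a = 1" by (simp add: a_def)
  obtain d where d: "d > 0" "ball x d \<subseteq> S" using S open_contains_ball by blast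
  have inS: "x + t *\<^sub>R a \<in> S" if "\<bar>t\<bar> < d" for t
    using d that by (auto simp: subset_iff dist_norm na)
  define g where "g = (\<lambda>t. f (x + t *\<^sub>R a))"
  define g' where "g' = (\<lambda>t. G (x + t *\<^sub>R a) \<bullet> a)"
  have gd: "(g has_real_derivative g' t) (at t)" if "\<bar>t\<bar> < d" for t
  proof -
    have "((\<lambda>t. f (x + t *\<^sub>R a)) has_derivative (\<lambda>h. G (x + t *\<^sub>R a) \<bullet> (h *\<^sub>R a))) (at t)"
      using D inS[OF that] unfolding grad_hess_def
      by (intro has_derivative_compose[where g=f and f="\<lambda>t. x + t *\<^sub>R a"]) (auto intro!: derivative_eq_intros)
    then show ?thesis by (simp add: has_field_derivative_def g_def g'_def mult.commute[of _ "G _ \<bullet> a"])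
  qed
  have g'd: "(g' has_real_derivative (H x a \<bullet> a)) (at 0)"
  proof -
    have lin: "linear (H x)" using D S by (auto simp: grad_hess_def has_derivative_linear)
    have "((\<lambda>t. G (x + t *\<^sub>R a)) has_derivative (\<lambda>h. H x (h *\<^sub>R a))) (at 0)"
      using D inS[of 0] d unfolding grad_hess_def
      by (intro has_derivative_compose[where g=G and f="\<lambda>t. x + t *\<^sub>R a"]) (auto intro!: derivative_eq_intros)
    then have "((\<lambda>t. G (x + t *\<^sub>R a) \<bullet> a) has_derivative (\<lambda>h. H x (h *\<^sub>R a) \<bullet> a)) (at 0)"
      by (rule has_derivative_inner_left)
    then show ?thesis
      by (simp add: has_field_derivative_def g'_def linear_scale[OF lin] mult.commute[of _ "H x a \<bullet> a"])
  qed
  have g0: "g' 0 = 0"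
  proof (rule DERIV_local_min[OF gd])
    show "0 < d" by fact
    show "\<forall>y. \<bar>0 - y\<bar> < d \<longrightarrow> g 0 \<le> g y" using inS min by (simp add: g_def)
  qed (use d in simp)
  \<comment> \<open>A negative derivative of \<open>g'\<close> at 0, where \<open>g'\<close>
    vanishes, makes \<open>g'\<close> negative just to the right of 0; by the mean value theorem
    \<open>g\<close> would then drop below its minimum.\<close>
  have "0 \<le> H x a \<bullet> a"
  proof (rule ccontr)
    assume "\<not> 0 \<le> H x a \<bullet> a"
    then have "H x a \<bullet> a < 0" by simp
    from DERIV_neg_dec_right[OF g'd this] obtain \<epsilon> where e: "\<epsilon> > 0"
      and neg: "\<And>h. 0 < h \<Longrightarrow> h < \<epsilon> \<Longrightarrow> g' h < 0" using g0 by auto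
    define h where "h = min \<epsilon> d / 2"
    have h: "0 < h" "h < \<epsilon>" "h < d" using e d by (auto simp: h_def)
    have "\<exists>z. 0 < z \<and> z < h \<and> g h - g 0 = (h - 0) * g' z"
      using h by (intro MVT2 gd) auto
    then obtain z where z: "0 < z" "z < h" "g h - g 0 = h * g' z" by auto
    have "h * g' z < 0" using neg[of z] z h by (simp add: mult_pos_neg)
    moreover have "g 0 \<le> g h" using inS[of h] h min by (simp add: g_def)
    ultimately show False using z by simp
  qed
  then show "0 \<le> H x (axis i 1) $ i" by (simp add: a_def inner_axis)
qed

text \<open>Contact argument: where \<open>w / g\<close> attains a negative minimum
  \<open>- \<mu>\<close>, the function \<open>w + \<mu> g\<close> touches zero from above, so its
  Laplacian there is nonnegative. Strictness is demanded at contact points only; there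
  \<open>w = - \<mu> g\<close>, which converts a bound on the Laplacian of \<open>w\<close> in terms
  of \<open>w\<close> into one in terms of \<open>\<mu>\<close>.\<close>

lemma max_principle_barrier:
  fixes w g :: "real^'n::finite \<Rightarrow> real"
  assumes S: "open S" "bounded S"
    and w: "continuous_on (closure S) w" "grad_hess S w Gw Hw"
    and g: "continuous_on (closure S) g" "grad_hess S g Gg Hg" "\<And>x. x \<in> closure S \<Longrightarrow> g x > 0"
    and bd: "\<And>x. x \<in> frontier S \<Longrightarrow> w x \<ge> 0"
    and strict: "\<And>x \<mu>. x \<in> S \<Longrightarrow> \<mu> > 0 \<Longrightarrow> w x + \<mu> * g x = 0 \<Longrightarrow> lin_trace (Hw x) + \<mu> * lin_trace (Hg x) < 0"
    and x: "x \<in> closure S"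
  shows "w x \<ge> 0"
proof -
  have "\<exists>z\<in>closure S. \<forall>y\<in>closure S. w z / g z \<le> w y / g y"
  proof (rule continuous_attains_inf)
    show "compact (closure S)" using S by (simp add: compact_closure)
    show "continuous_on (closure S) (\<lambda>x. w x / g x)"
      using g(3) by (intro continuous_intros w g) force
    show "closure S \<noteq> {}" by (metis x empty_iff)
  qed
  then obtain z where z: "z \<in> closure S" and zmin: "\<And>y. y \<in> closure S \<Longrightarrow> w z / g z \<le> w y / g y"
    by blast
  have "w z / g z \<ge> 0"
  proof (rule ccontr)
    assume "\<not> w z / g z \<ge> 0"
    then have neg: "w z / g z < 0" by simp
    then have "w z < 0" using g(3)[OF z] by (simp add: divide_less_0_iff)
    then have "z \<in> S" using bd z S by (metis DiffI frontier_def interior_open not_less)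
    define \<mu> where "\<mu> = - (w z / g z)"
    have \<mu>: "\<mu> > 0" using neg by (simp add: \<mu>_def)
    have 0: "w z + \<mu> * g z = 0" using g(3)[OF z] by (simp add: \<mu>_def)
    have "w y + \<mu> * g y \<ge> 0" if "y \<in> S" for y
    proof -
      have "y \<in> closure S" using that closure_subset by blast
      then show ?thesis using zmin[of y] g(3)[of y] by (simp add: \<mu>_def field_simps)
    qed
    then have "0 \<le> lin_trace (\<lambda>h. Hw z h + \<mu> *\<^sub>R Hg z h)"
      using grad_hess_local_min[OF grad_hess_add[OF w(2) grad_hess_scale[OF g(2), of \<mu>]] S(1) \<open>z \<in> S\<close>] 0 by simp
    then show False using strict[OF \<open>z \<in> S\<close> \<mu> 0] by (simp add: lin_trace_add lin_trace_scale)
  qed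
  then have "0 \<le> w x / g x" using zmin[OF x] by linarith
  then show ?thesis using g(3)[OF x] by (simp add: zero_le_divide_iff)
qed

lemma grad_hess_exp_norm:
  fixes y :: "real^'n::finite"
  shows "grad_hess S (\<lambda>x. exp (k * ((x - y) \<bullet> (x - y)))) (\<lambda>x. (2 * k * exp (k * ((x - y) \<bullet> (x - y)))) *\<^sub>R (x - y))
    (\<lambda>x h. (2 * k * exp (k * ((x - y) \<bullet> (x - y)))) *\<^sub>R (h + (2 * k) *\<^sub>R (((x - y) \<bullet> h) *\<^sub>R (x - y))))"
  unfolding grad_hess_def
  by (auto intro!: derivative_eq_intros ext simp: inner_commute algebra_simps)

lemma lin_trace_exp_norm:
  fixes z :: "real^'n::finite"
  shows "lin_trace (\<lambda>h. a *\<^sub>R (h + b *\<^sub>R ((z \<bullet> h) *\<^sub>R z))) = a * (real CARD('n) + b * (z \<bullet> z))"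
  by (simp only: lin_trace_scale lin_trace_add lin_trace_id lin_trace_rank_one)

lemma grad_hess_exp_inner:
  fixes e :: "real^'n::finite"
  shows "grad_hess S (\<lambda>x. exp (k * (e \<bullet> x) + b)) (\<lambda>x. (k * exp (k * (e \<bullet> x) + b)) *\<^sub>R e)
    (\<lambda>x h. (k\<^sup>2 * exp (k * (e \<bullet> x) + b)) *\<^sub>R ((e \<bullet> h) *\<^sub>R e))"
  unfolding grad_hess_def
  by (auto intro!: derivative_eq_intros ext simp: inner_commute algebra_simps power2_eq_square)

lemma weak_max_principle:
  fixes w :: "real^'n::finite \<Rightarrow> real"
  assumes S: "open S" "bounded S"
    and w: "continuous_on (closure S) w" "grad_hess S w Gw Hw"
    and sup: "\<And>x. x \<in> S \<Longrightarrow> lin_trace (Hw x) \<le> 0"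
    and bd: "\<And>x. x \<in> frontier S \<Longrightarrow> w x \<ge> 0"
    and x: "x \<in> closure S"
  shows "w x \<ge> 0"
proof -
  obtain B where B: "\<And>x. x \<in> closure S \<Longrightarrow> norm x \<le> B"
    using S bounded_closure[of S] by (auto simp: bounded_iff)
  \<comment> \<open>The barrier is at least 1 on the closure, and strictly superharmonic because
    exp(|x|^2) has positive Laplacian. The terms \<open>x - 0\<close> and \<open>1 * _\<close> match
    \<open>grad_hess_exp_norm\<close> literally.\<close>
  define g where "g = (\<lambda>x::real^'n. exp (B\<^sup>2) + 1 + (-1) * exp (1 * ((x - 0) \<bullet> (x - 0))))"
  note Dg = grad_hess_add[OF grad_hess_const[of S "exp (B\<^sup>2) + 1"] grad_hess_scale[OF grad_hess_exp_norm[of S 1 0], of "-1"]]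
  show ?thesis
  proof (rule max_principle_barrier[OF S w _ Dg _ bd _ x])
    show "continuous_on (closure S) (\<lambda>x. exp (B\<^sup>2) + 1 + - 1 * exp (1 * ((x - 0) \<bullet> (x - 0))))"
      by (intro continuous_intros)
    show "0 < exp (B\<^sup>2) + 1 + - 1 * exp (1 * ((x - 0) \<bullet> (x - 0)))" if "x \<in> closure S" for x
    proof -
      have "x \<bullet> x \<le> B\<^sup>2" using B[OF that] by (simp add: dot_square_norm power_mono)
      then have "exp (x \<bullet> x) \<le> exp (B\<^sup>2)" by simp
      then show ?thesis by (simp del: exp_le_cancel_iff)
    qed
  next
    fix x \<mu> assume "x \<in> S" "\<mu> > (0::real)"
    have "2 * exp (x \<bullet> x) * (real CARD('n) + 2 * (x \<bullet> x)) > 0"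
      by (intro mult_pos_pos add_pos_nonneg) auto
    then have "\<mu> * (2 * exp (x \<bullet> x) * (real CARD('n) + 2 * (x \<bullet> x))) > 0"
      using \<open>\<mu> > 0\<close> by (rule mult_pos_pos[rotated])
    then show "lin_trace (Hw x) + \<mu> * lin_trace (\<lambda>h. 0 + - 1 *\<^sub>R (2 * 1 * exp (1 * ((x - 0) \<bullet> (x - 0)))) *\<^sub>R (h + (2 * 1) *\<^sub>R ((x - 0) \<bullet> h) *\<^sub>R (x - 0))) < 0"
      using sup[OF \<open>x \<in> S\<close>]
      by (simp only: lin_trace_add lin_trace_scale[of "- 1"] lin_trace_exp_norm) (simp add: lin_trace_def[of "\<lambda>h. 0"])
  qed
qed

text \<open>Comparison on the annulus between \<open>cball y s\<close>, where \<open>w\<close>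
  exceeds \<open>w y / 2\<close> by continuity, and the sphere of radius \<open>r\<close>. A small
  multiple of a Gaussian, shifted to vanish on the outer sphere, is a lower bound for
  \<open>w\<close>. Radius \<open>2*r\<close> in the hypotheses puts the closed annulus inside the
  domain.\<close>

lemma strong_max_principle_ball:
  fixes w :: "real^'n::finite \<Rightarrow> real"
  assumes D: "grad_hess (ball y (2*r)) w G H"
    and sup: "\<And>x. x \<in> ball y (2*r) \<Longrightarrow> lin_trace (H x) \<le> 0"
    and nonneg: "\<And>x. x \<in> ball y (2*r) \<Longrightarrow> w x \<ge> 0"
    and pos: "w y > 0" and z: "z \<in> ball y r"
  shows "w z > 0"
proof -
  have r: "r > 0" using z by (metis ball_eq_empty empty_iff not_le)
  have cw: "continuous_on (ball y (2*r)) w"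
    using D by (auto simp: grad_hess_def intro!: continuous_at_imp_continuous_on has_derivative_continuous)
  have "isCont w y" using D r by (auto simp: grad_hess_def intro!: has_derivative_continuous)
  then obtain s0 where s0: "s0 > 0" "\<And>x. dist x y < s0 \<Longrightarrow> dist (w x) (w y) < w y / 2"
    using pos unfolding continuous_at_eps_delta by (metis half_gt_zero)
  define s where "s = min s0 r / 2"
  have s: "0 < s" "s < s0" "s < r" using s0 r by (auto simp: s_def)
  have low: "w x > w y / 2" if "dist x y \<le> s" for x
    using s0(2)[of x] that s unfolding dist_real_def by linarith
  show ?thesis
  proof (cases "dist z y \<le> s")
    case True
    then show ?thesis using low[of z] pos by simp
  next
    case False
    define A where "A = ball y r - cball y s"
    have A: "open A" "bounded A" by (auto simp: A_def open_Diff bounded_ball intro: bounded_subset)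
    have clA: "closure A \<subseteq> cball y r - ball y s"
      by (rule closure_minimal) (auto simp: A_def closed_Diff)
    have frA: "dist x y = r \<or> dist x y = s" if "x \<in> frontier A" for x
      using that clA A(1) by (auto simp: frontier_def interior_open A_def dist_commute)
    have sub: "A \<subseteq> ball y (2*r)" "closure A \<subseteq> ball y (2*r)" using clA r by (auto simp: A_def)
    \<comment> \<open>With n the dimension, n + 2 k |x - y|^2 vanishes at distance \<open>s\<close>
      and is nonpositive beyond; as \<open>k < 0\<close>, the Gaussian is subharmonic on the
      annulus.\<close>
    define k where "k = - (real CARD('n) / (2 * s\<^sup>2))"
    have k: "k < 0" "real CARD('n) + 2 * k * s\<^sup>2 = 0" using s by (auto simp: k_def)
    define \<epsilon> where "\<epsilon> = w y / 2"
    have \<epsilon>: "\<epsilon> > 0" using pos by (simp add: \<epsilon>_def)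
    let ?b = "\<lambda>x. exp (k * ((x - y) \<bullet> (x - y)))"
    define u where "u = (\<lambda>x. w x + (\<epsilon> * exp (k * r\<^sup>2) + (-\<epsilon>) * ?b x))"
    note Du = grad_hess_add[OF grad_hess_subset[OF D sub(1)] grad_hess_add[OF grad_hess_const[of A "\<epsilon> * exp (k * r\<^sup>2)"] grad_hess_scale[OF grad_hess_exp_norm[of A k y], of "-\<epsilon>"]]]
    have q: "(x - y) \<bullet> (x - y) = (dist x y)\<^sup>2" for x by (simp add: dist_norm dot_square_norm)
    have "u z \<ge> 0" unfolding u_def
    proof (rule weak_max_principle[OF A _ Du])
      show "continuous_on (closure A) (\<lambda>x. w x + (\<epsilon> * exp (k * r\<^sup>2) + - \<epsilon> * ?b x))"
        using continuous_on_subset[OF cw sub(2)] by (intro continuous_intros)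
      show "z \<in> closure A" using z False closure_subset[of A] by (auto simp: A_def dist_commute)
    next
      fix x assume x: "x \<in> A"
      have "s\<^sup>2 \<le> (dist x y)\<^sup>2" using x s by (intro power_mono) (auto simp: A_def dist_commute)
      then have "real CARD('n) + 2 * k * (dist x y)\<^sup>2 \<le> real CARD('n) + 2 * k * s\<^sup>2"
        using k(1) by (intro add_left_mono mult_left_mono_neg) auto
      then have *: "real CARD('n) + 2 * k * (dist x y)\<^sup>2 \<le> 0" using k by simp
      have "0 \<le> (2 * k * exp (k * (dist x y)\<^sup>2)) * (real CARD('n) + 2 * k * (dist x y)\<^sup>2)"
        using * k(1) by (intro mult_nonpos_nonpos) (auto simp: mult_nonpos_nonneg)
      then have "0 \<le> \<epsilon> * ((2 * k * exp (k * (dist x y)\<^sup>2)) * (real CARD('n) + 2 * k * (dist x y)\<^sup>2))"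
        using \<epsilon> by simp
      moreover have "lin_trace (H x) \<le> 0" using sup x sub by blast
      ultimately show "lin_trace (\<lambda>h. H x h + (0 + - \<epsilon> *\<^sub>R (2 * k * ?b x) *\<^sub>R (h + (2 * k) *\<^sub>R ((x - y) \<bullet> h) *\<^sub>R (x - y)))) \<le> 0"
        by (simp only: lin_trace_add lin_trace_scale[of "- \<epsilon>"] lin_trace_exp_norm q) (simp add: lin_trace_def[of "\<lambda>h. 0"])
    next
      fix x assume x: "x \<in> frontier A"
      show "0 \<le> w x + (\<epsilon> * exp (k * r\<^sup>2) + - \<epsilon> * ?b x)"
      proof (cases "dist x y = r")
        case True
        then show ?thesis using nonneg[of x] r by (simp add: q dist_commute)
      next
        case False
        then have "dist x y = s" using frA[OF x] by auto
        then have "w x > \<epsilon>" using low[of x] by (simp add: \<epsilon>_def)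
        moreover have "?b x \<le> 1" using k(1) by (simp add: mult_nonpos_nonneg)
        then have "\<epsilon> * ?b x \<le> \<epsilon>" using \<epsilon> by (simp add: mult_left_le)
        moreover have "\<epsilon> * exp (k * r\<^sup>2) > 0" using \<epsilon> by simp
        ultimately show ?thesis by linarith
      qed
    qed
    moreover have "exp (k * r\<^sup>2) < ?b z"
    proof -
      have "(dist z y)\<^sup>2 < r\<^sup>2" using z r by (intro power_strict_mono) (auto simp: dist_commute)
      then show ?thesis using k(1) by (simp add: q)
    qed
    then have "\<epsilon> * exp (k * r\<^sup>2) < \<epsilon> * ?b z" using \<epsilon> by simp
    ultimately show ?thesis by (simp add: u_def)
  qed
qed

text \<open>Positivity spreads from a point over a distance controlled by a ball contained in
  \<open>S\<close>. Hence both the positivity set and its complement in \<open>S\<close> are open,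
  and connectedness decides.\<close>

lemma strong_max_principle:
  fixes w :: "real^'n::finite \<Rightarrow> real"
  assumes S: "open S" "connected S" and D: "grad_hess S w G H"
    and sup: "\<And>x. x \<in> S \<Longrightarrow> lin_trace (H x) \<le> 0"
    and nonneg: "\<And>x. x \<in> S \<Longrightarrow> w x \<ge> 0"
    and y: "y \<in> S" "w y > 0" and z: "z \<in> S"
  shows "w z > 0"
proof (rule ccontr)
  assume nz: "\<not> w z > 0"
  define P where "P = {x \<in> S. w x > 0}"
  define Z where "Z = {x \<in> S. \<not> w x > 0}"
  have step: "w b > 0" if "ball a (3*r) \<subseteq> S" "dist a b < r" "w a > 0" for a b r
  proof (rule strong_max_principle_ball)
    have "ball a (2*r) \<subseteq> S" using that by (smt (verit) mem_ball subset_iff zero_le_dist)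
    then show "grad_hess (ball a (2*r)) w G H" "\<And>x. x \<in> ball a (2*r) \<Longrightarrow> lin_trace (H x) \<le> 0"
      "\<And>x. x \<in> ball a (2*r) \<Longrightarrow> w x \<ge> 0"
      using D sup nonneg by (auto intro: grad_hess_subset)
  qed (use that in auto)
  have "open P"
    unfolding open_contains_ball
  proof
    fix a assume a: "a \<in> P"
    obtain r where r: "r > 0" "ball a r \<subseteq> S" using S a by (auto simp: P_def open_contains_ball)
    have "ball a (r/3) \<subseteq> P"
      using step[of a "r/3"] r a by (auto simp: P_def subset_iff)
    then show "\<exists>e>0. ball a e \<subseteq> P" using r by (intro exI[of _ "r/3"]) auto
  qed
  moreover have "open Z"
    unfolding open_contains_ball
  proof
    fix a assume a: "a \<in> Z"
    obtain r where r: "r > 0" "ball a r \<subseteq> S" using S a by (auto simp: Z_def open_contains_ball)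
    have "b \<in> Z" if b: "b \<in> ball a (r/6)" for b
    proof -
      \<comment> \<open>The spreading is used backwards: a positive \<open>b\<close> would make
        \<open>a\<close> positive, since \<open>a\<close> is within r/6 of \<open>b\<close> and the
        ball of radius r/2 about \<open>b\<close> fits into \<open>ball a r\<close>.\<close>
      have "ball b (3 * (r/6)) \<subseteq> S"
      proof
        fix x assume x: "x \<in> ball b (3 * (r/6))"
        have "dist a x \<le> dist a b + dist b x" by (rule dist_triangle)
        then have "dist a x < r" using x b r(1) by auto
        then show "x \<in> S" using r(2) by auto
      qed
      then have "\<not> w b > 0" using step[of b "r/6" a] b a by (auto simp: Z_def dist_commute)
      moreover have "b \<in> S" using b r by auto
      ultimately show ?thesis by (simp add: Z_def)
    qed
    then show "\<exists>e>0. ball a e \<subseteq> Z" using r by (intro exI[of _ "r/6"]) auto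
  qed
  moreover have "P \<inter> Z \<inter> S = {}" "S \<subseteq> P \<union> Z" "P \<inter> S \<noteq> {}" "Z \<inter> S \<noteq> {}"
    using y z nz by (auto simp: P_def Z_def)
  ultimately show False using S(2) unfolding connected_def by blast
qed

section \<open>Moving planes on a ball\<close>

text \<open>For a unit vector \<open>e\<close>, the reflection in the hyperplane where
  \<open>e \<bullet> x = l\<close>.\<close>

definition mirror :: "real^'n::finite \<Rightarrow> real \<Rightarrow> real^'n \<Rightarrow> real^'n" where
  "mirror e l x = x - (2 * (e \<bullet> x - l)) *\<^sub>R e"

lemma norm_mirror:
  assumes "norm e = 1"
  shows "(norm (mirror e l x))\<^sup>2 = (norm x)\<^sup>2 - 4 * l * (e \<bullet> x - l)"
proof -
  have "e \<bullet> e = 1" using assms unfolding norm_eq_1 .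
  have "(norm (mirror e l x))\<^sup>2 = x \<bullet> x - 2 * (2 * (e \<bullet> x - l)) * (e \<bullet> x) + (2 * (e \<bullet> x - l))\<^sup>2 * (e \<bullet> e)"
    unfolding mirror_def power2_norm_eq_inner
    by (simp only: inner_diff_left inner_diff_right inner_scaleR_left inner_scaleR_right)
      (simp add: inner_commute algebra_simps power2_eq_square)
  then show ?thesis
    unfolding \<open>e \<bullet> e = 1\<close> by (simp add: dot_square_norm) (simp add: algebra_simps power2_eq_square)
qed

lemma norm_mirror_le:
  assumes "norm e = 1" "0 \<le> l" "l \<le> e \<bullet> x"
  shows "norm (mirror e l x) \<le> norm x"
proof -
  have "(norm (mirror e l x))\<^sup>2 \<le> (norm x)\<^sup>2" using assms by (simp add: norm_mirror)
  then show ?thesis by (rule power2_le_imp_le) simp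
qed

lemma norm_mirror_less:
  assumes "norm e = 1" "0 < l" "l < e \<bullet> x"
  shows "norm (mirror e l x) < norm x"
proof -
  have "(norm (mirror e l x))\<^sup>2 < (norm x)\<^sup>2" using assms by (simp add: norm_mirror)
  then show ?thesis by (rule power2_less_imp_less) simp
qed

lemma dist_mirror: "norm e = 1 \<Longrightarrow> dist (mirror e l x) (mirror e l' x) = 2 * \<bar>l - l'\<bar>"
  by (simp add: mirror_def dist_norm abs_if flip: scaleR_left_diff_distrib)

lemma continuous_on_mirror: "continuous_on S (mirror e l)"
  unfolding mirror_def by (intro continuous_intros)

text \<open>The linear part \<open>R\<close> of the reflection is self-adjoint, so the gradient is
  reflected and the Hessian conjugated by \<open>R\<close>, as
  \<open>lin_trace_conjugate_reflection\<close> expects.\<close>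

lemma grad_hess_mirror:
  fixes e :: "real^'n::finite"
  assumes e: "norm e = 1" and D: "grad_hess S f G H" and T: "\<And>x. x \<in> T \<Longrightarrow> mirror e l x \<in> S"
  defines "R \<equiv> \<lambda>h. h - (2 * (e \<bullet> h)) *\<^sub>R e"
  shows "grad_hess T (\<lambda>x. f (mirror e l x)) (\<lambda>x. R (G (mirror e l x))) (\<lambda>x h. R (H (mirror e l x) (R h)))"
  unfolding grad_hess_def
proof (intro ballI conjI)
  fix x assume "x \<in> T"
  then have x: "mirror e l x \<in> S" by (rule T)
  have dr: "(mirror e l has_derivative R) (at x)"
    unfolding mirror_def R_def by (auto intro!: derivative_eq_intros ext simp: algebra_simps)
  have dR: "(R has_derivative R) (at y)" for y
    unfolding R_def by (auto intro!: derivative_eq_intros ext simp: algebra_simps)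
  have sym: "G (mirror e l x) \<bullet> R h = R (G (mirror e l x)) \<bullet> h" for h
    by (simp add: R_def inner_diff_left inner_diff_right inner_commute algebra_simps)
  have "((\<lambda>x. f (mirror e l x)) has_derivative (\<lambda>h. G (mirror e l x) \<bullet> R h)) (at x)"
    using D x by (intro has_derivative_compose[OF dr]) (simp add: grad_hess_def)
  then show "((\<lambda>x. f (mirror e l x)) has_derivative (\<lambda>h. R (G (mirror e l x)) \<bullet> h)) (at x)"
    by (simp only: sym)
  have "((\<lambda>x. G (mirror e l x)) has_derivative (\<lambda>h. H (mirror e l x) (R h))) (at x)"
    using D x by (intro has_derivative_compose[OF dr]) (simp add: grad_hess_def)
  from has_derivative_compose[OF this dR]
  show "((\<lambda>x. R (G (mirror e l x))) has_derivative (\<lambda>h. R (H (mirror e l x) (R h)))) (at x)" .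
qed

text \<open>\<open>lip\<close> is stated along the values of \<open>v\<close> because
  \<open>plus_powr p\<close> with p > 1 is Lipschitz only on sets bounded above. \<open>mono\<close>
  serves the strong maximum principle, \<open>lip\<close> the one for narrow regions, and
  \<open>int\<close> gives strict positivity at the tip of a cap.\<close>

locale ball_problem =
  fixes v :: "real^'n::finite \<Rightarrow> real" and G H and f :: "real \<Rightarrow> real" and R \<gamma> L :: real
  assumes R: "R > 0" and L: "L > 0"
    and cont: "continuous_on (cball 0 R) v" and D: "grad_hess (ball 0 R) v G H"
    and eq: "\<And>x. x \<in> ball 0 R \<Longrightarrow> lin_trace (H x) = - f (v x)"
    and mono: "mono f"
    and lip: "\<And>x y. x \<in> cball 0 R \<Longrightarrow> y \<in> cball 0 R \<Longrightarrow> \<bar>f (v x) - f (v y)\<bar> \<le> L * \<bar>v x - v y\<bar>"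
    and bd: "\<And>x. norm x = R \<Longrightarrow> v x = \<gamma>"
    and int: "\<And>x. norm x < R \<Longrightarrow> v x > \<gamma>"
begin

lemma ge_bd: "norm x \<le> R \<Longrightarrow> v x \<ge> \<gamma>"
  using bd[of x] int[of x] by force

definition cap :: "real^'n \<Rightarrow> real \<Rightarrow> (real^'n) set" where
  "cap e l = {x. norm x < R \<and> l < e \<bullet> x}"

text \<open>A closed set standing in for the closure of \<open>cap e l\<close>, which then never has
  to be computed; for \<open>l \<ge> 0\<close> the reflected difference is continuous on all of
  it.\<close>

definition ccap :: "real^'n \<Rightarrow> real \<Rightarrow> (real^'n) set" where
  "ccap e l = {x. norm x \<le> R \<and> l \<le> e \<bullet> x}"

definition reflected_diff :: "real^'n \<Rightarrow> real \<Rightarrow> real^'n \<Rightarrow> real" where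
  "reflected_diff e l x = v (mirror e l x) - v x"

lemma open_cap: "open (cap e l)"
  unfolding cap_def by (intro open_Collect_conj open_Collect_less continuous_intros)

lemma closed_ccap: "closed (ccap e l)"
  unfolding ccap_def by (intro closed_Collect_conj closed_Collect_le continuous_intros)

lemma closure_cap: "closure (cap e l) \<subseteq> ccap e l"
  by (rule closure_minimal[OF _ closed_ccap]) (auto simp: cap_def ccap_def)

lemma bounded_cap: "bounded (cap e l)"
  by (rule bounded_subset[OF bounded_ball[of 0 R]]) (auto simp: cap_def)

lemma connected_cap: "connected (cap e l)"
proof -
  have "cap e l = ball 0 R \<inter> {x. e \<bullet> x > l}" by (auto simp: cap_def)
  then show ?thesis
    by (metis convex_Int convex_ball convex_halfspace_gt convex_connected)
qed

lemma frontier_cap: "x \<in> frontier (cap e l) \<Longrightarrow> x \<in> ccap e l \<and> (norm x = R \<or> e \<bullet> x = l)"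
  using closure_cap[of e l] open_cap[of e l]
  by (fastforce simp: frontier_def interior_open ccap_def cap_def)

lemma mirror_ccap: "norm e = 1 \<Longrightarrow> 0 \<le> l \<Longrightarrow> x \<in> ccap e l \<Longrightarrow> norm (mirror e l x) \<le> R"
  using norm_mirror_le[of e l x] by (auto simp: ccap_def)

lemma cont_reflected_diff:
  assumes "norm e = 1" "0 \<le> l"
  shows "continuous_on (ccap e l) (reflected_diff e l)"
  unfolding reflected_diff_def
proof (intro continuous_on_diff)
  show "continuous_on (ccap e l) v"
    by (rule continuous_on_subset[OF cont]) (auto simp: ccap_def)
  show "continuous_on (ccap e l) (\<lambda>x. v (mirror e l x))"
    by (rule continuous_on_compose2[OF cont continuous_on_mirror]) (use mirror_ccap[OF assms] in auto)
qed

text \<open>By trace invariance \<open>v\<close> and its mirror image solve the same equation. The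
  resulting Laplacian is nonpositive where the difference is nonnegative, by \<open>mono\<close>,
  and is controlled by the difference elsewhere, by \<open>lip\<close>.\<close>

lemma grad_hess_reflected_diff:
  assumes "norm e = 1" "0 \<le> l"
  shows "\<exists>Gw Hw. grad_hess (cap e l) (reflected_diff e l) Gw Hw \<and>
    (\<forall>x\<in>cap e l. lin_trace (Hw x) = f (v x) - f (v (mirror e l x)))"
proof -
  define S where "S = (\<lambda>h. h - (2 * (e \<bullet> h)) *\<^sub>R e)"
  have ins: "mirror e l x \<in> ball 0 R" if "x \<in> cap e l" for x
    using norm_mirror_le[of e l x] that assms by (auto simp: cap_def)
  have D': "grad_hess (cap e l) v G H" by (rule grad_hess_subset[OF D]) (auto simp: cap_def)
  note DD = grad_hess_add[OF grad_hess_mirror[OF assms(1) D ins] grad_hess_scale[OF D', of "-1"]]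
  have "lin_trace (\<lambda>h. S (H (mirror e l x) (S h)) + (- 1) *\<^sub>R H x h) = f (v x) - f (v (mirror e l x))"
    if "x \<in> cap e l" for x
  proof -
    have "linear (H (mirror e l x))" using D ins[OF that] unfolding grad_hess_def by (metis has_derivative_linear)
    then have "lin_trace (\<lambda>h. S (H (mirror e l x) (S h))) = - f (v (mirror e l x))"
      using lin_trace_conjugate_reflection[OF assms(1)] eq[OF ins[OF that]] by (simp add: S_def)
    moreover have "x \<in> ball 0 R" using that by (simp add: cap_def)
    ultimately show ?thesis by (simp only: lin_trace_add lin_trace_scale eq)
  qed
  then show ?thesis using DD unfolding S_def reflected_diff_def by fastforce
qed

text \<open>On the sphere \<open>v\<close> takes its minimum \<open>\<gamma>\<close>; on the plane
  the mirror fixes the point.\<close>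

lemma reflected_diff_frontier:
  assumes "norm e = 1" "0 \<le> l" "x \<in> ccap e l" "norm x = R \<or> e \<bullet> x = l"
  shows "reflected_diff e l x \<ge> 0"
  using assms(4)
proof
  assume "norm x = R"
  then show ?thesis using bd[of x] ge_bd[OF mirror_ccap[OF assms(1-3)]] by (simp add: reflected_diff_def)
qed (simp add: reflected_diff_def mirror_def)

definition good :: "real^'n \<Rightarrow> real \<Rightarrow> bool" where
  "good e l \<longleftrightarrow> (\<forall>x\<in>ccap e l. reflected_diff e l x \<ge> 0)"

text \<open>The maximum principle on narrow regions: negativity of the reflected difference only has to
  be excluded away from the boundary of the cap, because near the two parts of that boundary one
  of the two exponentials in the barrier makes it a strict supersolution.\<close>

lemma narrow:
  assumes e: "norm e = 1" and l: "0 \<le> l"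
    and k: "k > 0" "k * R\<^sup>2 \<ge> 2" "k\<^sup>2 > 4 * L * exp 1" "k\<^sup>2 * R\<^sup>2 > 4 * L * exp 1"
    and core: "\<And>x. norm x < R \<Longrightarrow> l + 1 / k \<le> e \<bullet> x \<Longrightarrow> (norm x)\<^sup>2 \<le> R\<^sup>2 - 1 / k \<Longrightarrow> reflected_diff e l x \<ge> 0"
  shows "good e l"
proof -
  obtain Gw Hw where Dw: "grad_hess (cap e l) (reflected_diff e l) Gw Hw"
    and trw: "\<And>x. x \<in> cap e l \<Longrightarrow> lin_trace (Hw x) = f (v x) - f (v (mirror e l x))"
    using grad_hess_reflected_diff[OF e l] by blast
  let ?E1 = "\<lambda>x::real^'n. exp ((-k) * (e \<bullet> x) + k * l)"
  let ?E2 = "\<lambda>x::real^'n. exp (k * ((x - 0) \<bullet> (x - 0)))"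
  let ?c = "exp (- k * R\<^sup>2)"
  \<comment> \<open>On the closed cap both exponential terms are at most 1, so 2 <= g <= 4. The
    first equals 1 on the plane, the second on the sphere, and both enter with a negative sign so
    that their large positive Laplacians help.\<close>
  define g where "g = (\<lambda>x. 4 + ((-1) * ?E1 x + (-?c) * ?E2 x))"
  note Dg = grad_hess_add[OF grad_hess_const[of "cap e l" 4] grad_hess_add[OF grad_hess_scale[OF grad_hess_exp_inner[of "cap e l" "-k" e "k*l"], of "-1"]
     grad_hess_scale[OF grad_hess_exp_norm[of "cap e l" k 0], of "-?c"]], folded g_def]
  have q: "x \<bullet> x = (norm x)\<^sup>2" for x :: "real^'n" by (simp add: dot_square_norm)
  have E2: "?c * ?E2 x = exp (k * ((norm x)\<^sup>2 - R\<^sup>2))" for x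
    unfolding diff_0_right q by (simp add: algebra_simps flip: exp_add)
  have gpos: "g x > 0" "g x \<le> 4" if "x \<in> ccap e l" for x
  proof -
    have "(-k) * (e \<bullet> x) + k * l \<le> 0" using that k by (simp add: ccap_def)
    then have "?E1 x \<le> 1" by simp
    moreover have "(norm x)\<^sup>2 \<le> R\<^sup>2" using that by (simp add: ccap_def power_mono)
    then have "?c * ?E2 x \<le> 1" unfolding E2 using k by (simp add: mult_nonneg_nonpos)
    ultimately show "g x > 0" unfolding g_def by linarith
    have "?E1 x > 0" "?c * ?E2 x > 0" by simp_all
    then show "g x \<le> 4" unfolding g_def by linarith
  qed
  have "reflected_diff e l x \<ge> 0" if x: "x \<in> cap e l" for x
  proof (rule max_principle_barrier[OF open_cap bounded_cap _ Dw _ Dg])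
    show "continuous_on (closure (cap e l)) (reflected_diff e l)"
      by (rule continuous_on_subset[OF cont_reflected_diff[OF e l] closure_cap])
    show "continuous_on (closure (cap e l)) g"
      unfolding g_def by (intro continuous_intros)
    show "0 < g x" if "x \<in> closure (cap e l)" for x using gpos(1) closure_cap that by blast
    show "0 \<le> reflected_diff e l x" if "x \<in> frontier (cap e l)" for x
      using reflected_diff_frontier[OF e l] frontier_cap[OF that] by blast
    show "x \<in> closure (cap e l)" using x closure_subset by blast
  next
    fix x \<mu> assume x: "x \<in> cap e l" and \<mu>: "\<mu> > (0::real)" and z: "reflected_diff e l x + \<mu> * g x = 0"
    have xc: "x \<in> ccap e l" using x by (auto simp: cap_def ccap_def)
    have "\<mu> * g x > 0" using gpos[OF xc] \<mu> by simp
    then have neg: "reflected_diff e l x < 0" using z by linarith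
    then have thin: "e \<bullet> x < l + 1 / k \<or> (norm x)\<^sup>2 > R\<^sup>2 - 1 / k"
      using core[of x] x by (force simp: cap_def)
    have nx: "x \<in> cball 0 R" "mirror e l x \<in> cball 0 R"
      using xc mirror_ccap[OF e l xc] by (auto simp: ccap_def)
    \<comment> \<open>At a contact point the reflected difference is \<open>- \<mu> * g x\<close>,
      so \<open>lip\<close> and \<open>g \<le> 4\<close> bound its Laplacian by
      \<open>\<mu> * (4 * L)\<close>; this is what the barrier has to beat.\<close>
    have "lin_trace (Hw x) \<le> L * (- reflected_diff e l x)"
      using lip[OF nx] neg by (simp add: trw[OF x] reflected_diff_def)
    also have "- reflected_diff e l x = \<mu> * g x" using z by linarith
    also have "L * (\<mu> * g x) \<le> L * (\<mu> * 4)"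
      using gpos[OF xc] \<mu> L by (intro mult_left_mono) auto
    finally have 1: "lin_trace (Hw x) \<le> \<mu> * (4 * L)" by (simp add: mult_ac)
    define T1 where "T1 = k\<^sup>2 * ?E1 x"
    define T2 where "T2 = 2 * k * (?c * ?E2 x) * (real CARD('n) + 2 * k * (norm x)\<^sup>2)"
    have ee: "e \<bullet> e = 1" using e by (simp add: norm_eq_1)
    let ?Hg = "\<lambda>h. 0 + (- 1 *\<^sub>R ((- k)\<^sup>2 * ?E1 x) *\<^sub>R (e \<bullet> h) *\<^sub>R e +
        - ?c *\<^sub>R (2 * k * ?E2 x) *\<^sub>R (h + (2 * k) *\<^sub>R ((x - 0) \<bullet> h) *\<^sub>R (x - 0)))"
    have trg: "lin_trace ?Hg = - T1 - T2"
      by (simp only: lin_trace_add lin_trace_scale[of "-1"] lin_trace_scale[of "-?c"] lin_trace_exp_norm)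
        (simp only: lin_trace_scale lin_trace_rank_one ee, simp add: T1_def T2_def lin_trace_def[of "\<lambda>h. 0"] q)
    have T1: "T1 \<ge> 0" by (simp add: T1_def)
    have T2: "T2 \<ge> 0" unfolding T2_def using k by (intro mult_nonneg_nonneg add_nonneg_nonneg) auto
    have em: "exp (-1) = 1 / exp (1::real)" by (simp add: exp_minus field_simps)
    \<comment> \<open>In either layer the matching exponential is at least 1/e. Near the sphere
      \<open>k * R\<^sup>2 \<ge> 2\<close> gives
      \<open>2 * k * (norm x)\<^sup>2 \<ge> k * R\<^sup>2\<close>; the last two conditions on
      \<open>k\<close> then make the matching term exceed \<open>4 * L\<close>.\<close>
    have "4 * L < T1 + T2" using thin
    proof
      assume "e \<bullet> x < l + 1 / k"
      then have "k * (e \<bullet> x) < k * (l + 1 / k)" using k by simp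
      then have "(-k) * (e \<bullet> x) + k * l \<ge> -1" using k by (simp add: algebra_simps)
      then have "exp (-1) \<le> ?E1 x" by simp
      then have "k\<^sup>2 * exp (-1) \<le> T1" unfolding T1_def by (intro mult_left_mono) auto
      moreover have "4 * L < k\<^sup>2 * exp (-1)" using k(3) by (simp add: em field_simps)
      ultimately show ?thesis using T2 by linarith
    next
      assume a: "(norm x)\<^sup>2 > R\<^sup>2 - 1 / k"
      then have "k * ((norm x)\<^sup>2 - R\<^sup>2) > k * (- (1 / k))" using k by (intro mult_strict_left_mono) auto
      then have "k * ((norm x)\<^sup>2 - R\<^sup>2) \<ge> -1" using k by simp
      then have E: "exp (-1) \<le> ?c * ?E2 x" unfolding E2 by simp
      have "k * (norm x)\<^sup>2 > k * (R\<^sup>2 - 1 / k)" using a k by (intro mult_strict_left_mono) auto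
      then have "2 * k * (norm x)\<^sup>2 > 2 * k * R\<^sup>2 - 2" using k by (simp add: algebra_simps)
      moreover have "2 * k * R\<^sup>2 - 2 \<ge> k * R\<^sup>2" using k(2) by simp
      ultimately have "k * R\<^sup>2 \<le> real CARD('n) + 2 * k * (norm x)\<^sup>2"
        by (smt (verit) of_nat_0_le_iff)
      then have "2 * k * exp (-1) * (k * R\<^sup>2) \<le> T2"
        unfolding T2_def using E k by (intro mult_mono) auto
      moreover have "2 * k * exp (-1) * (k * R\<^sup>2) = 2 * (k\<^sup>2 * R\<^sup>2) / exp 1"
        by (simp add: em power2_eq_square)
      moreover have "4 * L < k\<^sup>2 * R\<^sup>2 / exp 1" using k(4) by (simp add: field_simps)
      ultimately show ?thesis using T1 L by linarith
    qed
    then have "\<mu> * (4 * L) < \<mu> * (T1 + T2)" using \<mu> by simp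
    then have "lin_trace (Hw x) + \<mu> * (- T1 - T2) < 0" using 1 by (simp add: algebra_simps)
    then show "lin_trace (Hw x) + \<mu> * lin_trace ?Hg < 0" by (simp only: trg)
  qed
  then show ?thesis
    unfolding good_def using reflected_diff_frontier[OF e l] by (force simp: cap_def ccap_def)
qed

lemma ex_narrow_k: "\<exists>k. k > 0 \<and> k * R\<^sup>2 \<ge> 2 \<and> k\<^sup>2 > 4 * L * exp 1 \<and> k\<^sup>2 * R\<^sup>2 > 4 * L * exp 1"
proof -
  define M where "M = 4 * L * exp 1"
  have M: "M > 0" using L by (simp add: M_def)
  define k where "k = 1 + M + 2 / R\<^sup>2 + M / R\<^sup>2"
  have R2: "R\<^sup>2 > 0" using R by simp
  have k1: "k \<ge> 1" "k > M" "k * R\<^sup>2 > M" "k * R\<^sup>2 \<ge> 2"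
    using M R2 by (auto simp: k_def field_simps add_pos_nonneg)
  have "k\<^sup>2 \<ge> k" using k1 by (simp add: power2_eq_square)
  then have "k\<^sup>2 > M" "k\<^sup>2 * R\<^sup>2 \<ge> k * R\<^sup>2" using k1 R2 by (auto intro: mult_right_mono)
  then show ?thesis using k1 unfolding M_def by (intro exI[of _ k]) auto
qed

text \<open>At the tip \<open>R *\<^sub>R e\<close> the solution equals \<open>\<gamma>\<close>
  while its mirror point is interior, so the difference is positive there and, by continuity,
  somewhere in the open cap. Being nonnegative it is superharmonic, and the strong maximum principle
  spreads the positivity.\<close>

lemma good_interior_pos:
  assumes e: "norm e = 1" and l: "0 < l" "l < R" and g: "good e l" and x: "x \<in> cap e l"
  shows "reflected_diff e l x > 0"
proof -
  obtain Gw Hw where Dw: "grad_hess (cap e l) (reflected_diff e l) Gw Hw"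
    and trw: "\<And>x. x \<in> cap e l \<Longrightarrow> lin_trace (Hw x) = f (v x) - f (v (mirror e l x))"
    using grad_hess_reflected_diff[OF e less_imp_le[OF l(1)]] by blast
  have ee: "e \<bullet> e = 1" using e by (simp add: norm_eq_1)
  have nn: "reflected_diff e l x \<ge> 0" if "x \<in> cap e l" for x
    using g that by (auto simp: good_def cap_def ccap_def)
  have "\<exists>y\<in>cap e l. reflected_diff e l y > 0"
  proof -
    have Rc: "R *\<^sub>R e \<in> ccap e l" using l e ee by (simp add: ccap_def)
    have "norm (mirror e l (R *\<^sub>R e)) < R"
      using norm_mirror_less[of e l "R *\<^sub>R e"] l e ee by simp
    then have pos: "reflected_diff e l (R *\<^sub>R e) > 0"
      using int bd[of "R *\<^sub>R e"] R e by (simp add: reflected_diff_def)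
    have "continuous (at (R *\<^sub>R e) within ccap e l) (reflected_diff e l)"
      using cont_reflected_diff[OF e] l Rc by (simp add: continuous_on_eq_continuous_within)
    then obtain d where d: "d > 0" and near: "\<And>y. y \<in> ccap e l \<Longrightarrow> dist y (R *\<^sub>R e) < d \<Longrightarrow>
        dist (reflected_diff e l y) (reflected_diff e l (R *\<^sub>R e)) < reflected_diff e l (R *\<^sub>R e)"
      using pos unfolding continuous_within_eps_delta by metis
    define t where "t = max ((l + R) / 2) (R - d / 2)"
    have t: "l < t" "t < R" "R - t < d" using l d by (auto simp: t_def max_def field_simps)
    have "t *\<^sub>R e \<in> cap e l" using t l e ee by (simp add: cap_def)
    moreover have "dist (t *\<^sub>R e) (R *\<^sub>R e) < d"
      using t e by (simp add: dist_norm flip: scaleR_left_diff_distrib)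
    moreover have "t *\<^sub>R e \<in> ccap e l" using t l e ee by (simp add: ccap_def)
    ultimately show ?thesis using near[of "t *\<^sub>R e"] unfolding dist_real_def
      by (intro bexI[of _ "t *\<^sub>R e"]) linarith+
  qed
  then obtain y where y: "y \<in> cap e l" "reflected_diff e l y > 0" by blast
  show ?thesis
  proof (rule strong_max_principle[OF open_cap connected_cap Dw _ nn y x])
    fix x assume "x \<in> cap e l"
    then show "lin_trace (Hw x) \<le> 0" using nn[of x] mono by (simp add: trw reflected_diff_def monoD)
  qed
qed

text \<open>For a plane slightly inside \<open>l\<close>, the cap splits into a compact core, where
  the difference at \<open>l\<close> has a positive minimum that survives a small shift, and thin
  layers covered by \<open>narrow\<close>. For \<open>l = R\<close> the core is empty, so the same
  lemma also starts the motion.\<close>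

lemma good_left_open:
  assumes e: "norm e = 1" and l: "0 < l" "l \<le> R" and g: "l < R \<Longrightarrow> good e l"
  shows "\<exists>d>0. \<forall>m. 0 \<le> m \<and> l - d < m \<and> m \<le> l \<longrightarrow> good e m"
proof -
  obtain k where k: "k > 0" "k * R\<^sup>2 \<ge> 2" "k\<^sup>2 > 4 * L * exp 1" "k\<^sup>2 * R\<^sup>2 > 4 * L * exp 1"
    using ex_narrow_k by blast
  \<comment> \<open>Half the layer width: when \<open>m > l - 1 / (2 * k)\<close>, a point with
    \<open>m + 1 / k \<le> e \<bullet> x\<close> satisfies
    \<open>l + 1 / (2 * k) \<le> e \<bullet> x\<close>, so one \<open>K\<close> serves all such
    \<open>m\<close>.\<close>
  define K where "K = {x. (norm x)\<^sup>2 \<le> R\<^sup>2 - 1 / k \<and> l + 1 / (2 * k) \<le> e \<bullet> x}"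
  have Ksub: "K \<subseteq> cap e l"
  proof
    fix x assume x: "x \<in> K"
    have "1 / k > 0" "1 / (2 * k) > 0" using k(1) by (auto simp del: zero_less_divide_1_iff intro!: divide_pos_pos)
    moreover have "(norm x)\<^sup>2 \<le> R\<^sup>2 - 1 / k" "l + 1 / (2 * k) \<le> e \<bullet> x" using x by (simp_all add: K_def)
    ultimately have "(norm x)\<^sup>2 < R\<^sup>2" "l < e \<bullet> x" by linarith+
    then show "x \<in> cap e l" using R by (auto simp: cap_def intro: power2_less_imp_less)
  qed
  have "closed K" unfolding K_def
    by (intro closed_Collect_conj closed_Collect_le continuous_intros)
  then have Kc: "compact K"
    using Ksub bounded_cap by (auto simp: compact_eq_bounded_closed intro: bounded_subset)
  have "\<exists>\<delta>>0. \<forall>x\<in>K. reflected_diff e l x \<ge> \<delta>"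
  proof (cases "K = {}")
    case True
    then show ?thesis by (intro exI[of _ 1]) auto
  next
    case False
    then obtain x0 where "x0 \<in> K" by blast
    then have "norm x0 < R" "l < e \<bullet> x0" using Ksub by (auto simp: cap_def)
    moreover have "e \<bullet> x0 \<le> norm x0" using norm_cauchy_schwarz[of e x0] e by simp
    ultimately have lR: "l < R" by linarith
    have "continuous_on K (reflected_diff e l)"
      using l Ksub by (intro continuous_on_subset[OF cont_reflected_diff[OF e]]) (auto simp: cap_def ccap_def)
    then obtain z where "z \<in> K" "\<And>x. x \<in> K \<Longrightarrow> reflected_diff e l z \<le> reflected_diff e l x"
      using continuous_attains_inf[OF Kc False] by blast
    then show ?thesis using good_interior_pos[OF e l(1) lR g[OF lR]] Ksub by blast
  qed
  then obtain \<delta> where \<delta>: "\<delta> > 0" "\<And>x. x \<in> K \<Longrightarrow> reflected_diff e l x \<ge> \<delta>" by blast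
  have "uniformly_continuous_on (cball 0 R) v"
    using cont compact_cball by (rule compact_uniformly_continuous)
  then obtain \<eta> where \<eta>: "\<eta> > 0" "\<And>x y. x \<in> cball 0 R \<Longrightarrow> y \<in> cball 0 R \<Longrightarrow> dist x y < \<eta> \<Longrightarrow> dist (v x) (v y) < \<delta>"
    using \<delta>(1) unfolding uniformly_continuous_on_def by metis
  define d where "d = min (\<eta> / 2) (1 / (2 * k))"
  have d: "d > 0" "2 * d \<le> \<eta>" "d \<le> 1 / (2 * k)" using \<eta> k by (auto simp: d_def)
  have "good e m" if m: "0 \<le> m" "l - d < m" "m \<le> l" for m
  proof (rule narrow[OF e m(1) k])
    fix x assume x: "norm x < R" "m + 1 / k \<le> e \<bullet> x" "(norm x)\<^sup>2 \<le> R\<^sup>2 - 1 / k"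
    have "1 / k = 1 / (2 * k) + 1 / (2 * k)" by simp
    then have "x \<in> K" using x m d unfolding K_def by auto
    then have xw: "reflected_diff e l x \<ge> \<delta>" and xc: "x \<in> ccap e l" using \<delta> Ksub by (auto simp: cap_def ccap_def)
    have xm: "x \<in> ccap e m" using xc m by (auto simp: ccap_def)
    have "dist (mirror e l x) (mirror e m x) < \<eta>" using dist_mirror[OF e, of l x m] m d by simp
    then have "dist (v (mirror e l x)) (v (mirror e m x)) < \<delta>"
      using \<eta>(2) mirror_ccap[OF e _ xc] mirror_ccap[OF e m(1) xm] l by simp
    then show "reflected_diff e m x \<ge> 0" using xw unfolding reflected_diff_def dist_real_def by linarith
  qed
  then show ?thesis using d by blast
qed

text \<open>A negative value at an interior point \<open>x\<close> would persist for planes slightly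
  further out, since the mirror point moves continuously with the plane; \<open>m\<close> is chosen
  at most \<open>e \<bullet> x\<close> so that \<open>x\<close> stays in the closed cap.\<close>

lemma good_closed:
  assumes e: "norm e = 1" and l: "0 \<le> l" and g: "\<And>m. l < m \<Longrightarrow> m < R \<Longrightarrow> good e m" and "l < R"
  shows "good e l"
proof -
  have int: "reflected_diff e l x \<ge> 0" if x: "x \<in> cap e l" for x
  proof (rule ccontr)
    assume "\<not> reflected_diff e l x \<ge> 0"
    then have neg: "reflected_diff e l x < 0" by simp
    have "uniformly_continuous_on (cball 0 R) v"
      using cont compact_cball by (rule compact_uniformly_continuous)
    then obtain \<eta> where \<eta>: "\<eta> > 0" "\<And>y z. y \<in> cball 0 R \<Longrightarrow> z \<in> cball 0 R \<Longrightarrow> dist y z < \<eta> \<Longrightarrow> dist (v y) (v z) < - reflected_diff e l x"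
      using neg unfolding uniformly_continuous_on_def by (metis neg_0_less_iff_less)
    define m where "m = min (l + \<eta> / 4) (min ((l + R) / 2) (e \<bullet> x))"
    have m: "l < m" "m < R" "m \<le> e \<bullet> x" "m - l < \<eta> / 2" using \<eta>(1) x \<open>l < R\<close> by (auto simp: m_def cap_def min_def)
    have xc: "x \<in> ccap e l" "x \<in> ccap e m" using x m by (auto simp: cap_def ccap_def)
    have "dist (mirror e m x) (mirror e l x) < \<eta>" using dist_mirror[OF e, of m x l] m by simp
    then have "dist (v (mirror e m x)) (v (mirror e l x)) < - reflected_diff e l x"
      using \<eta>(2) mirror_ccap[OF e _ xc(1)] mirror_ccap[OF e _ xc(2)] l m by simp
    moreover have "reflected_diff e m x \<ge> 0" using g[OF m(1,2)] xc by (auto simp: good_def)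
    ultimately show False unfolding reflected_diff_def dist_real_def by linarith
  qed
  then show ?thesis
    unfolding good_def using reflected_diff_frontier[OF e l] by (force simp: cap_def ccap_def)
qed

text \<open>Continuity method: \<open>R\<close> lies in \<open>A\<close> vacuously, an infimum below
  \<open>R\<close> is good by \<open>good_closed\<close>, and \<open>good_left_open\<close> pushes
  it lower unless it is 0.\<close>

lemma good_zero:
  assumes e: "norm e = 1"
  shows "good e 0"
proof -
  define A where "A = {l. 0 \<le> l \<and> l \<le> R \<and> (\<forall>m. l \<le> m \<and> m < R \<longrightarrow> good e m)}"
  have RA: "R \<in> A" using R by (auto simp: A_def)
  have bdd: "bdd_below A" by (auto simp: A_def bdd_below_def)
  define l where "l = Inf A"
  have l0: "0 \<le> l" unfolding l_def using RA by (intro cInf_greatest) (auto simp: A_def)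
  have lR: "l \<le> R" unfolding l_def using RA bdd by (rule cInf_lower)
  have above: "good e m" if "l < m" "m < R" for m
  proof -
    have "A \<noteq> {}" using RA by (metis empty_iff)
    moreover have "Inf A < m" using that(1) by (simp only: l_def)
    ultimately obtain a where "a \<in> A" "a < m" by (metis cInf_lessD)
    then show ?thesis using that unfolding A_def by simp
  qed
  have gl: "good e l" if "l < R" using good_closed[OF e l0 above that] .
  have "l = 0"
  proof (rule ccontr)
    assume "l \<noteq> 0"
    then have "l > 0" using l0 by simp
    from good_left_open[OF e this lR gl] obtain d where d: "d > 0"
      "\<And>m. 0 \<le> m \<Longrightarrow> l - d < m \<Longrightarrow> m \<le> l \<Longrightarrow> good e m" by blast
    define m where "m = max 0 (l - d / 2)"
    have m: "0 \<le> m" "l - d < m" "m < l" using d \<open>l > 0\<close> by (auto simp: m_def)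
    have "good e m'" if "m \<le> m'" "m' < R" for m'
      using d(2)[of m'] above[of m'] m that by fastforce
    then have "m \<in> A" using m lR by (auto simp: A_def)
    then have "l \<le> m" unfolding l_def using bdd by (rule cInf_lower)
    then show False using m by simp
  qed
  then show ?thesis using gl R by simp
qed

text \<open>Two distinct points of equal norm are mirror images in a plane through the centre;
  \<open>good_zero\<close> for its two normals gives the two inequalities.\<close>

lemma radial:
  assumes "norm x = norm y" "norm x \<le> R"
  shows "v x = v y"
proof (cases "x = y")
  case False
  have half: "v x \<le> v y" if "norm x = norm y" "norm x \<le> R" "x \<noteq> y" for x y
  proof -
    define e where "e = (1 / norm (x - y)) *\<^sub>R (x - y)"
    have n: "norm (x - y) > 0" using that by simp
    have e: "norm e = 1" using n by (simp add: e_def)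
    have "x \<bullet> x = y \<bullet> y" using that(1) by (metis dot_square_norm)
    then have s: "(norm (x - y))\<^sup>2 = 2 * ((x - y) \<bullet> x)"
      by (simp add: power2_norm_eq_inner inner_diff_left inner_diff_right inner_commute)
    have ex: "2 * (e \<bullet> x) = norm (x - y)"
      using s n unfolding e_def by (simp add: divide_simps power2_eq_square del: zero_less_norm_iff)
    have "mirror e 0 x = x - norm (x - y) *\<^sub>R e" by (simp add: mirror_def ex)
    also have "\<dots> = y" using n by (simp add: e_def)
    finally have "mirror e 0 x = y" .
    moreover have "e \<bullet> x \<ge> 0" using ex n by linarith
    then have "x \<in> ccap e 0" using that by (simp add: ccap_def)
    ultimately show ?thesis using good_zero[OF e] by (auto simp: good_def reflected_diff_def)
  qed
  show ?thesis using half[of x y] half[of y x] assms False by force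
qed simp

end

section \<open>Uniqueness of radial solutions\<close>

text \<open>A Gronwall argument in weighted supremum norm. Let \<open>z\<close> maximise |d| / exp(k
  |y|^2) for d = v - w. Radiality makes \<open>d\<close> constant on the sphere through
  \<open>z\<close>, so the maximum principle inside that sphere bounds \<open>d z - d 0\<close> by
  half of |d z|, which contradicts \<open>d 0 = 0\<close> unless \<open>d\<close> vanishes.\<close>

lemma radial_unique:
  fixes v w :: "real^'n::finite \<Rightarrow> real"
  assumes L: "L > 0"
    and cv: "continuous_on (cball 0 R) v" and cw: "continuous_on (cball 0 R) w"
    and Dv: "grad_hess (ball 0 R) v Gv Hv" and Dw: "grad_hess (ball 0 R) w Gw Hw"
    and lin_trace: "\<And>x. x \<in> ball 0 R \<Longrightarrow> \<bar>lin_trace (Hv x) - lin_trace (Hw x)\<bar> \<le> L * \<bar>v x - w x\<bar>"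
    and rv: "\<And>x y. norm x = norm y \<Longrightarrow> norm x \<le> R \<Longrightarrow> v x = v y"
    and rw: "\<And>x y. norm x = norm y \<Longrightarrow> norm x \<le> R \<Longrightarrow> w x = w y"
    and 0: "v 0 = w 0"
    and x: "x \<in> cball 0 R"
  shows "v x = w x"
proof -
  have "norm x \<le> R" using x by simp
  with norm_ge_zero have R0: "R \<ge> 0" by (rule order_trans)
  \<comment> \<open>With this \<open>k\<close> the Laplacian of M/2 exp(k |y|^2) is at least L M
    exp(k |y|^2), hence at least L |d y|.\<close>
  define k where "k = L / real CARD('n)"
  have k: "k > 0" "k * real CARD('n) = L" using L by (auto simp: k_def)
  define d where "d = (\<lambda>x. v x + (-1) * w x)"
  note Dd = grad_hess_add[OF Dv grad_hess_scale[OF Dw, of "-1"], folded d_def]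
  have cd: "continuous_on (cball 0 R) d" unfolding d_def by (intro continuous_intros cv cw)
  let ?E = "\<lambda>x::real^'n. exp (k * ((x - 0) \<bullet> (x - 0)))"
  have q: "?E x = exp (k * (norm x)\<^sup>2)" for x by (simp add: dot_square_norm)
  have "\<exists>z\<in>cball 0 R. \<forall>y\<in>cball 0 R. \<bar>d y\<bar> / ?E y \<le> \<bar>d z\<bar> / ?E z"
    by (intro continuous_attains_sup continuous_intros cd) (use R0 in auto)
  then obtain z where z: "z \<in> cball 0 R" and zmax: "\<And>y. y \<in> cball 0 R \<Longrightarrow> \<bar>d y\<bar> / ?E y \<le> \<bar>d z\<bar> / ?E z"
    by blast
  define M where "M = \<bar>d z\<bar> / ?E z"
  have dM: "\<bar>d y\<bar> \<le> M * ?E y" if "y \<in> cball 0 R" for y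
    using zmax[OF that] by (simp add: M_def field_simps)
  have dz: "\<bar>d z\<bar> = M * ?E z" by (simp add: M_def)
  have M0: "M \<ge> 0" by (simp add: M_def)
  have "M = 0"
  proof (rule ccontr)
    assume "M \<noteq> 0"
    then have M: "M > 0" using M0 by simp
    define \<rho> where "\<rho> = norm z"
    have \<rho>R: "\<rho> \<le> R" using z by (simp add: \<rho>_def)
    have sub: "ball 0 \<rho> \<subseteq> ball 0 R" "cball 0 \<rho> \<subseteq> cball 0 R" using \<rho>R by auto
    have cl: "closure (ball 0 \<rho>) \<subseteq> (cball 0 \<rho> :: (real^'n) set)" by (rule closure_minimal) auto
    text \<open>On the ball of radius \<open>norm z\<close> the Laplacian of \<open>d\<close> is dominated by that of the barrier
      \<open>M/2 (exp(k \<rho>\<^sup>2) - exp(k |y|\<^sup>2))\<close>, so \<open>d\<close> cannot vanish at the centre.\<close>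
    have bound: "M / 2 * exp (k * \<rho>\<^sup>2) + (- (M / 2)) * ?E 0 + s * (d 0 - d z) \<ge> 0"
      if s: "s = 1 \<or> s = -1" for s :: real
    proof -
      define u where "u = (\<lambda>y. M / 2 * exp (k * \<rho>\<^sup>2) - s * d z + ((- (M / 2)) * ?E y + s * d y))"
      note Du = grad_hess_add[OF grad_hess_const[of "ball 0 \<rho>" "M / 2 * exp (k * \<rho>\<^sup>2) - s * d z"]
          grad_hess_add[OF grad_hess_scale[OF grad_hess_exp_norm[of "ball 0 \<rho>" k 0], of "- (M/2)"] grad_hess_scale[OF grad_hess_subset[OF Dd sub(1)], of s]], folded u_def]
      have "u 0 \<ge> 0"
      proof (cases "\<rho> = 0")
        case True
        then have "z = 0" by (simp add: \<rho>_def)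
        then show ?thesis using True by (simp add: u_def)
      next
        case False
        then have \<rho>: "\<rho> > 0" by (simp add: \<rho>_def)
        show ?thesis
        proof (rule weak_max_principle[OF open_ball bounded_ball _ Du])
          show "continuous_on (closure (ball 0 \<rho>)) u" unfolding u_def
            by (intro continuous_intros continuous_on_subset[OF cd]) (use cl sub in auto)
          show "0 \<in> closure (ball (0::real^'n) \<rho>)" using \<rho> by simp
        next
          fix y :: "real^'n" assume y: "y \<in> ball 0 \<rho>"
          then have yR: "y \<in> ball 0 R" "y \<in> cball 0 R" using \<rho>R by auto
          define a where "a = M / 2 * (2 * k * ?E y) * (real CARD('n) + 2 * k * ((y - 0) \<bullet> (y - 0)))"
          have "a = M * (k * ?E y) * (real CARD('n) + 2 * k * ((y - 0) \<bullet> (y - 0)))" by (simp add: a_def)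
          moreover have "M * (k * ?E y) * real CARD('n) \<le> M * (k * ?E y) * (real CARD('n) + 2 * k * ((y - 0) \<bullet> (y - 0)))"
            using M k by (intro mult_left_mono) auto
          ultimately have "M * (k * ?E y) * real CARD('n) \<le> a" by simp
          moreover have "M * (k * ?E y) * real CARD('n) = L * (M * ?E y)" using k(2) by (simp add: mult_ac)
          ultimately have 1: "L * (M * ?E y) \<le> a" by (simp only:)
          have "\<bar>lin_trace (Hv y) - lin_trace (Hw y)\<bar> \<le> L * \<bar>d y\<bar>" using lin_trace[OF yR(1)] by (simp add: d_def)
          also have "\<dots> \<le> L * (M * ?E y)" using dM[OF yR(2)] L by simp
          finally have "s * (lin_trace (Hv y) - lin_trace (Hw y)) \<le> L * (M * ?E y)" using s by auto
          then have "s * (lin_trace (Hv y) + -1 * lin_trace (Hw y)) - a \<le> 0" using 1 by simp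
          then show "lin_trace (\<lambda>h. 0 + (- (M / 2) *\<^sub>R (2 * k * ?E y) *\<^sub>R (h + (2 * k) *\<^sub>R ((y - 0) \<bullet> h) *\<^sub>R (y - 0)) +
              s *\<^sub>R (Hv y h + - 1 *\<^sub>R Hw y h))) \<le> 0"
            by (simp only: lin_trace_add lin_trace_scale[of "-(M/2)"] lin_trace_scale[of s] lin_trace_scale[of "-1"] lin_trace_exp_norm)
              (simp add: lin_trace_def[of "\<lambda>h. 0"] a_def algebra_simps)
        next
          fix y :: "real^'n" assume "y \<in> frontier (ball 0 \<rho>)"
          then have ny: "norm y = norm z" using \<rho> by (simp add: \<rho>_def)
          then have "d y = d z" using rv[of y z] rw[of y z] \<rho>R by (simp add: d_def \<rho>_def)
          moreover have "?E y = exp (k * \<rho>\<^sup>2)" unfolding q ny \<rho>_def ..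
          ultimately show "0 \<le> u y" by (simp only: u_def)
        qed
      qed
      then show ?thesis by (simp add: u_def algebra_simps)
    qed
    have d0: "d 0 = 0" using 0 by (simp add: d_def)
    have "\<bar>d z\<bar> \<le> M / 2 * exp (k * \<rho>\<^sup>2)"
      using bound[of 1] bound[of "-1"] M by (simp add: d0)
    moreover have "\<bar>d z\<bar> = M * exp (k * \<rho>\<^sup>2)" using dz by (simp only: q \<rho>_def)
    moreover have "M * exp (k * \<rho>\<^sup>2) > 0" using M by simp
    ultimately show False by simp
  qed
  then have "\<bar>d x\<bar> \<le> 0" using dM[OF x] by simp
  then show ?thesis by (simp add: d_def)
qed

section \<open>The radial initial value problem\<close>

definition plus_powr :: "real \<Rightarrow> real \<Rightarrow> real" where
  "plus_powr p t = pos_part t powr p"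

lemma plus_powr_nonneg: "plus_powr p t \<ge> 0" by (simp add: plus_powr_def)

lemma plus_powr_nonpos: "t \<le> 0 \<Longrightarrow> plus_powr p t = 0" by (simp add: plus_powr_def pos_part_def)

lemma plus_powr_pos: "t > 0 \<Longrightarrow> plus_powr p t = t powr p" by (simp add: plus_powr_def pos_part_def max_def)

lemma plus_powr_mono: "p > 0 \<Longrightarrow> s \<le> t \<Longrightarrow> plus_powr p s \<le> plus_powr p t"
  by (simp add: plus_powr_def pos_part_def powr_mono2)

lemma plus_powr_scale: "b > 0 \<Longrightarrow> plus_powr p (b * t) = b powr p * plus_powr p t"
proof -
  assume "b > 0"
  then have "pos_part (b * t) = b * pos_part t"
    by (auto simp: pos_part_def max_def mult_le_0_iff not_le)
  then show ?thesis using \<open>b > 0\<close> by (simp add: plus_powr_def powr_mult pos_part_def)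
qed

text \<open>The mean value theorem handles positive arguments. Across zero, when
  \<open>s \<le> 0 < t\<close>, write t^p = t^(p-1) t and use \<open>t \<le> t - s\<close>.\<close>

lemma plus_powr_lipschitz:
  assumes p: "p \<ge> 1" and M: "s \<le> M" "t \<le> M" "M > 0"
  shows "\<bar>plus_powr p s - plus_powr p t\<bar> \<le> p * M powr (p - 1) * \<bar>s - t\<bar>"
proof -
  have main: "plus_powr p t - plus_powr p s \<le> p * M powr (p - 1) * (t - s)" if st: "s < t" "t \<le> M" for s t
  proof (cases "t \<le> 0")
    case True
    then show ?thesis using st M p by (simp add: plus_powr_nonpos)
  next
    case t: False
    have bound: "z powr (p - 1) \<le> M powr (p - 1)" if "0 \<le> z" "z \<le> M" for z
      using that p by (intro powr_mono2) auto
    show ?thesis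
    proof (cases "s \<le> 0")
      case True
      have "plus_powr p t = t powr (p - 1) * t" using t by (simp add: plus_powr_pos powr_diff)
      also have "\<dots> \<le> M powr (p - 1) * (t - s)"
        using bound[of t] t st True by (intro mult_mono) auto
      also have "\<dots> \<le> p * (M powr (p - 1) * (t - s))"
        using p st mult_right_mono[of 1 p "M powr (p - 1) * (t - s)"] by simp
      finally show ?thesis using True by (simp add: plus_powr_nonpos mult_ac)
    next
      case False
      have "\<exists>z. s < z \<and> z < t \<and> t powr p - s powr p = (t - s) * (p * z powr (p - 1))"
        using st False by (intro MVT2) (auto intro!: derivative_eq_intros)
      then obtain z where z: "s < z" "z < t" "t powr p - s powr p = (t - s) * (p * z powr (p - 1))" by blast
      have "(t - s) * (p * z powr (p - 1)) \<le> (t - s) * (p * M powr (p - 1))"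
        using z st False p bound[of z] by (intro mult_left_mono) auto
      then show ?thesis using z False t by (simp add: plus_powr_pos mult_ac)
    qed
  qed
  show ?thesis
    using main[of s t] main[of t s] plus_powr_mono[of p s t] plus_powr_mono[of p t s] p M
    by (cases s t rule: linorder_cases) auto
qed

lemma continuous_on_plus_powr: "p > 0 \<Longrightarrow> continuous_on S u \<Longrightarrow> continuous_on S (\<lambda>x. plus_powr p (u x))"
  unfolding plus_powr_def pos_part_def by (intro continuous_on_powr' continuous_intros) auto

text \<open>For a radial function \<open>u\<close> in dimension \<open>m + 2\<close> with \<open>-\<Delta>u = h\<close>, \<open>radQ m h s\<close> is the flux
  \<open>- s ^ (m + 1) * u' s\<close> and \<open>radW m h s\<close> is \<open>- u' s\<close>; at \<open>s = 0\<close> the division by zero gives the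
  correct value \<open>0\<close>.\<close>

definition radQ :: "nat \<Rightarrow> (real \<Rightarrow> real) \<Rightarrow> real \<Rightarrow> real" where
  "radQ m h s = integral {0..s} (\<lambda>\<tau>. \<tau> ^ (m + 1) * h \<tau>)"

definition radW :: "nat \<Rightarrow> (real \<Rightarrow> real) \<Rightarrow> real \<Rightarrow> real" where
  "radW m h s = radQ m h s / s ^ (m + 1)"

lemma radQ_deriv:
  assumes "continuous_on {0..} h" "r > 0"
  shows "(radQ m h has_real_derivative r ^ (m + 1) * h r) (at r)"
proof -
  have c: "continuous_on {0..r + 1} (\<lambda>\<tau>. \<tau> ^ (m + 1) * h \<tau>)"
    by (intro continuous_intros continuous_on_subset[OF assms(1)]) auto
  have "(radQ m h has_real_derivative r ^ (m + 1) * h r) (at r within {0..r + 1})"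
    unfolding radQ_def[abs_def] using assms(2) by (intro integral_has_real_derivative[OF c]) auto
  moreover have "at r within {0..r + 1} = at r"
    using assms(2) by (intro at_within_interior) auto
  ultimately show ?thesis by simp
qed

lemma radQ_cont:
  assumes "continuous_on {0..} h"
  shows "continuous_on {0..T} (radQ m h)"
  unfolding radQ_def[abs_def]
  by (intro indefinite_integral_continuous_1 integrable_continuous_real continuous_intros
      continuous_on_subset[OF assms]) auto

lemma radQ_0: "radQ m h 0 = 0" by (simp add: radQ_def)

text \<open>Under the integral the weight is at most s^(m+1), which cancels the denominator; the
  bound is therefore independent of \<open>m\<close>.\<close>

lemma radW_bound:
  assumes h: "continuous_on {0..} h" and g: "continuous_on {0..s} g"
    and le: "\<And>\<tau>. 0 \<le> \<tau> \<Longrightarrow> \<tau> \<le> s \<Longrightarrow> \<bar>h \<tau>\<bar> \<le> g \<tau>" and s: "s \<ge> 0"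
  shows "\<bar>radW m h s\<bar> \<le> integral {0..s} g"
proof -
  have "\<bar>radQ m h s\<bar> \<le> integral {0..s} (\<lambda>\<tau>. s ^ (m + 1) * g \<tau>)"
    unfolding radQ_def real_norm_def[symmetric]
  proof (rule integral_norm_bound_integral)
    show "(\<lambda>\<tau>. \<tau> ^ (m + 1) * h \<tau>) integrable_on {0..s}"
      by (intro integrable_continuous_real continuous_intros continuous_on_subset[OF h]) auto
    show "(\<lambda>\<tau>. s ^ (m + 1) * g \<tau>) integrable_on {0..s}"
      by (intro integrable_continuous_real continuous_intros g)
    fix \<tau> assume \<tau>: "\<tau> \<in> {0..s}"
    have "\<tau> ^ (m + 1) * \<bar>h \<tau>\<bar> \<le> s ^ (m + 1) * g \<tau>"
      using \<tau> le[of \<tau>] by (intro mult_mono power_mono) auto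
    then show "norm (\<tau> ^ (m + 1) * h \<tau>) \<le> s ^ (m + 1) * g \<tau>"
      using \<tau> by (simp add: abs_mult)
  qed
  then have b: "\<bar>radQ m h s\<bar> \<le> s ^ (m + 1) * integral {0..s} g" by simp
  show ?thesis
  proof (cases "s = 0")
    case True
    then show ?thesis by (simp add: radW_def)
  next
    case False
    then have "s ^ (m + 1) > 0" using s by simp
    then show ?thesis using b by (simp add: radW_def abs_divide divide_le_eq mult.commute del: power_Suc)
  qed
qed

lemma radW_cont:
  assumes h: "continuous_on {0..} h"
  shows "continuous_on {0..T} (radW m h)"
proof (cases "T \<ge> 0")
  case True
  have "compact (h ` {0..T})"
    by (intro compact_continuous_image continuous_on_subset[OF h]) auto
  then obtain C where C: "\<And>\<tau>. \<tau> \<in> {0..T} \<Longrightarrow> \<bar>h \<tau>\<bar> \<le> C"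
    using compact_imp_bounded[of "h ` {0..T}"] unfolding bounded_iff by (metis imageI real_norm_def)
  have small: "\<bar>radW m h s\<bar> \<le> s * C" if "0 \<le> s" "s \<le> T" for s
    using radW_bound[OF h, of s "\<lambda>_. C" m] C that by simp
  show ?thesis
    unfolding continuous_on_eq_continuous_within
  proof
    fix s assume s: "s \<in> {0..T}"
    show "continuous (at s within {0..T}) (radW m h)"
    proof (cases "s = 0")
      case False
      then show ?thesis unfolding radW_def[abs_def]
        using radQ_cont[OF h, of T m] s
        by (intro continuous_intros) (auto simp: continuous_on_eq_continuous_within)
    next
      case True
      have "((\<lambda>s. s * C) \<longlongrightarrow> 0) (at 0 within {0..T})"
        by (auto intro!: tendsto_eq_intros)
      then have "(radW m h \<longlongrightarrow> 0) (at 0 within {0..T})"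
        by (rule Lim_null_comparison[rotated]) (auto simp: eventually_at intro!: exI[of _ 1] small)
      then show ?thesis using True by (simp add: continuous_within radW_def)
    qed
  qed
qed simp

lemma exp_integral:
  assumes "k > 0" "s \<ge> (0::real)"
  shows "integral {0..s} (\<lambda>\<tau>. B * exp (k * \<tau>)) = B / k * (exp (k * s) - 1)"
proof -
  have "((\<lambda>\<tau>. B * exp (k * \<tau>)) has_integral B / k * exp (k * s) - B / k * exp (k * 0)) {0..s}"
    using assms by (intro fundamental_theorem_of_calculus)
      (auto intro!: derivative_eq_intros simp flip: has_real_derivative_iff_has_vector_derivative)
  moreover have "B / k * exp (k * s) - B / k * exp (k * 0) = B / k * (exp (k * s) - 1)"
    by (simp add: right_diff_distrib)
  ultimately show ?thesis by (metis integral_unique)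
qed

text \<open>Each of the two integrations of exp(k \<tau>) gains a factor 1/k; the resulting 1/k^2 is
  the source of the contraction constant.\<close>

lemma radW_exp_bound:
  assumes h: "continuous_on {0..} h" and k: "k > 0" and B: "B \<ge> 0" and r: "r \<ge> 0"
    and le: "\<And>\<tau>. 0 \<le> \<tau> \<Longrightarrow> \<bar>h \<tau>\<bar> \<le> B * exp (k * \<tau>)"
  shows "\<bar>integral {0..r} (radW m h)\<bar> \<le> B / k\<^sup>2 * exp (k * r)"
proof -
  have 1: "\<bar>radW m h s\<bar> \<le> B / k * exp (k * s)" if "s \<in> {0..r}" for s
  proof -
    have "\<bar>radW m h s\<bar> \<le> integral {0..s} (\<lambda>\<tau>. B * exp (k * \<tau>))"
      using that le by (intro radW_bound[OF h] continuous_intros) auto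
    also have "\<dots> = B / k * (exp (k * s) - 1)" using that k by (intro exp_integral) auto
    also have "\<dots> \<le> B / k * exp (k * s)" using B k by (intro mult_left_mono) auto
    finally show ?thesis .
  qed
  have "\<bar>integral {0..r} (radW m h)\<bar> \<le> integral {0..r} (\<lambda>\<tau>. B / k * exp (k * \<tau>))"
    unfolding real_norm_def[symmetric]
    by (intro integral_norm_bound_integral integrable_continuous_real radW_cont[OF h] continuous_intros)
      (use 1 in auto)
  also have "\<dots> = B / k / k * (exp (k * r) - 1)" using k r by (rule exp_integral)
  also have "\<dots> \<le> B / k / k * exp (k * r)" using B k by (intro mult_left_mono) auto
  finally show ?thesis by (simp add: power2_eq_square)
qed

lemma radW_diff:
  assumes "continuous_on {0..} h" "continuous_on {0..} h'" "s \<ge> 0"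
  shows "radW m (\<lambda>\<tau>. h \<tau> - h' \<tau>) s = radW m h s - radW m h' s"
proof -
  have "radQ m (\<lambda>\<tau>. h \<tau> - h' \<tau>) s = radQ m h s - radQ m h' s"
    unfolding radQ_def right_diff_distrib
    by (intro integral_diff integrable_continuous_real continuous_intros
        continuous_on_subset[OF assms(1)] continuous_on_subset[OF assms(2)]) auto
  then show ?thesis by (simp add: radW_def diff_divide_distrib)
qed

text \<open>Picard iteration on the whole half line: in the norm weighted by \<open>exp(k r)\<close> the integral operator
  is a contraction as soon as \<open>k\<^sup>2\<close> exceeds the Lipschitz constant.\<close>

lemma radial_ode_solution:
  fixes F :: "real \<Rightarrow> real"
  assumes K: "K > 0" and lip: "\<And>x y. \<bar>F x - F y\<bar> \<le> K * \<bar>x - y\<bar>"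
    and F: "\<And>x. \<bar>F x\<bar> \<le> 1"
  shows "\<exists>u. continuous_on {0..} u \<and> (\<forall>r\<ge>0. u r = 1 - integral {0..r} (radW m (\<lambda>\<tau>. F (u \<tau>))))"
proof -
  define k where "k = K + 1"
  have k: "k > 0" "K / k\<^sup>2 < 1"
  proof -
    show "k > 0" using K by (simp add: k_def)
    have "k\<^sup>2 = K\<^sup>2 + 2 * K + 1" by (simp add: k_def power2_eq_square algebra_simps)
    moreover have "K\<^sup>2 \<ge> 0" by simp
    ultimately have "K < k\<^sup>2" using K by linarith
    then show "K / k\<^sup>2 < 1" using \<open>k > 0\<close> by (simp add: divide_less_eq)
  qed
  \<comment> \<open>The fixed point is sought for \<open>w = u / E\<close> in the complete space of
    bounded continuous functions on the whole line; \<open>max 0 r\<close> extends the weight and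
    the operator constantly to negative arguments.\<close>
  define E where "E = (\<lambda>r::real. exp (k * max 0 r))"
  have E: "E r \<ge> 1" "E r > 0" for r using k by (simp_all add: E_def)
  have cF: "continuous_on S F" for S
    by (rule lipschitz_on_continuous_on[of K]) (use lip K in \<open>auto simp: lipschitz_on_def dist_real_def\<close>)
  define h where "h = (\<lambda>(w::real \<Rightarrow>\<^sub>C real) \<tau>. F (E \<tau> * apply_bcontfun w \<tau>))"
  have ch: "continuous_on S (h w)" for S w
    unfolding h_def E_def
    by (intro continuous_on_compose2[OF cF[of UNIV]] continuous_intros continuous_on_subset[OF continuous_on_apply_bcontfun]) auto
  define V where "V = (\<lambda>w r. 1 - integral {0..max 0 r} (radW m (h w)))"
  have cV: "continuous_on UNIV (V w)" for w
  proof -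
    have c: "continuous_on {0..T} (\<lambda>r. integral {0..r} (radW m (h w)))" for T
      by (intro indefinite_integral_continuous_1 integrable_continuous_real radW_cont ch)
    have c0: "continuous_on {0..} (\<lambda>r. integral {0..r} (radW m (h w)))"
      unfolding continuous_on_eq_continuous_within
    proof
      fix r :: real assume r: "r \<in> {0..}"
      have "continuous (at r within {0..r + 1}) (\<lambda>r. integral {0..r} (radW m (h w)))"
        using c[of "r + 1"] r by (simp add: continuous_on_eq_continuous_within)
      moreover have "at r within {0..r + 1} = at r within {0..}"
        by (rule at_within_nhd[of r "{..<r + 1}"]) auto
      ultimately show "continuous (at r within {0..}) (\<lambda>r. integral {0..r} (radW m (h w)))"
        by (metis continuous_within)
    qed
    show ?thesis unfolding V_def
      by (intro continuous_on_diff continuous_on_const continuous_on_compose2[OF c0] continuous_intros) auto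
  qed
  have hb: "\<bar>h w \<tau>\<bar> \<le> 1" for w \<tau> unfolding h_def by (rule F)
  have bV: "\<bar>V w r / E r\<bar> \<le> 1 + 1 / k\<^sup>2" for w r
  proof -
    have "\<bar>integral {0..max 0 r} (radW m (h w))\<bar> \<le> 1 / k\<^sup>2 * exp (k * max 0 r)"
    proof (rule radW_exp_bound[OF ch k(1)])
      fix \<tau> :: real assume "0 \<le> \<tau>"
      then have "1 \<le> exp (k * \<tau>)" using k by simp
      then show "\<bar>h w \<tau>\<bar> \<le> 1 * exp (k * \<tau>)" using hb[of w \<tau>] by linarith
    qed auto
    then have "\<bar>V w r\<bar> \<le> E r + 1 / k\<^sup>2 * E r" using E(1)[of r] unfolding V_def E_def by linarith
    then show ?thesis using E(2)[of r] by (simp add: abs_divide divide_le_eq algebra_simps)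
  qed
  define Tw where "Tw = (\<lambda>w. Bcontfun (\<lambda>r. V w r / E r))"
  have Tw: "apply_bcontfun (Tw w) r = V w r / E r" for w r
  proof -
    have "(\<lambda>r. V w r / E r) \<in> bcontfun"
    proof (rule bcontfun_normI)
      show "continuous_on UNIV (\<lambda>r. V w r / E r)"
        unfolding E_def by (intro continuous_intros cV) auto
      show "norm (V w r / E r) \<le> 1 + 1 / k\<^sup>2" for r using bV by simp
    qed
    then show ?thesis by (simp add: Tw_def Bcontfun_inverse)
  qed
  have "dist (Tw w) (Tw w') \<le> K / k\<^sup>2 * dist w w'" for w w'
  proof (rule dist_bound)
    fix r
    let ?D = "dist w w'"
    have "\<bar>integral {0..max 0 r} (radW m (\<lambda>\<tau>. h w \<tau> - h w' \<tau>))\<bar> \<le> (K * ?D) / k\<^sup>2 * exp (k * max 0 r)"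
    proof (rule radW_exp_bound[OF _ k(1)])
      show "continuous_on {0..} (\<lambda>\<tau>. h w \<tau> - h w' \<tau>)" by (intro continuous_intros ch)
      show "K * ?D \<ge> 0" using K by simp
      fix \<tau> :: real assume \<tau>: "0 \<le> \<tau>"
      have "\<bar>h w \<tau> - h w' \<tau>\<bar> \<le> K * \<bar>E \<tau> * apply_bcontfun w \<tau> - E \<tau> * apply_bcontfun w' \<tau>\<bar>"
        unfolding h_def by (rule lip)
      also have "\<dots> = K * (E \<tau> * dist (apply_bcontfun w \<tau>) (apply_bcontfun w' \<tau>))"
        using E(2)[of \<tau>] by (simp add: dist_real_def abs_mult flip: right_diff_distrib)
      also have "\<dots> \<le> K * (E \<tau> * ?D)"
        using K E(2)[of \<tau>] dist_bounded[of w \<tau> w'] by (intro mult_left_mono) auto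
      finally show "\<bar>h w \<tau> - h w' \<tau>\<bar> \<le> K * ?D * exp (k * \<tau>)" using \<tau> by (simp add: E_def mult_ac)
    qed auto
    moreover have "integral {0..max 0 r} (radW m (\<lambda>\<tau>. h w \<tau> - h w' \<tau>)) = V w' r - V w r"
    proof -
      have "integral {0..max 0 r} (radW m (\<lambda>\<tau>. h w \<tau> - h w' \<tau>)) =
          integral {0..max 0 r} (\<lambda>s. radW m (h w) s - radW m (h w') s)"
        by (intro integral_cong radW_diff ch) auto
      also have "\<dots> = integral {0..max 0 r} (radW m (h w)) - integral {0..max 0 r} (radW m (h w'))"
        by (intro integral_diff integrable_continuous_real radW_cont ch)
      finally show ?thesis by (simp add: V_def)
    qed
    ultimately have "\<bar>V w r - V w' r\<bar> \<le> (K * ?D) / k\<^sup>2 * E r" by (simp add: E_def abs_minus_commute)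
    then show "dist (apply_bcontfun (Tw w) r) (apply_bcontfun (Tw w') r) \<le> K / k\<^sup>2 * ?D"
      using E(2)[of r] by (simp add: Tw dist_real_def abs_divide divide_le_eq flip: diff_divide_distrib)
  qed
  then have "\<exists>!w. Tw w = w"
    by (intro banach_fix_type[where c="K / k\<^sup>2"] allI) (use k K in auto)
  then obtain w where w: "Tw w = w" by blast
  define u where "u = V w"
  have "E r * apply_bcontfun w r = u r" for r
    using Tw[of w r] E(2)[of r] by (simp add: w u_def)
  then have hw: "h w = (\<lambda>\<tau>. F (u \<tau>))" by (simp add: h_def)
  have "u r = 1 - integral {0..r} (radW m (\<lambda>\<tau>. F (u \<tau>)))" if "r \<ge> 0" for r
  proof -
    have "u r = 1 - integral {0..r} (radW m (h w))" using that by (simp add: u_def V_def)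
    then show ?thesis by (simp only: hw)
  qed
  moreover have "continuous_on {0..} u" using cV continuous_on_subset unfolding u_def by blast
  ultimately show ?thesis by blast
qed

lemma DERIV_exI: "(f has_real_derivative y) (at x) \<Longrightarrow> P y \<Longrightarrow> \<exists>y. (f has_real_derivative y) (at x) \<and> P y"
  by blast

text \<open>First-order form of U'' + (N-1)/r U' + [U]_+^p = 0 in dimension N = m + 2, with flux Q =
  - r^(m+1) U'. The inequality \<open>p * m < m + 2\<close> is p < N/(N-2). The equations are
  imposed for \<open>r > 0\<close>, the singular endpoint being covered by continuity.\<close>

locale emden =
  fixes m :: nat and p :: real and U Q :: "real \<Rightarrow> real"
  assumes m: "m \<ge> 1" and p: "1 < p" "p * m < m + 2"
    and U0: "U 0 = 1" and cU: "continuous_on {0..} U"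
    and Q0: "Q 0 = 0" and cQ: "continuous_on {0..} Q"
    and dU: "\<And>r. r > 0 \<Longrightarrow> (U has_real_derivative - (Q r / r ^ (m + 1))) (at r)"
    and dQ: "\<And>r. r > 0 \<Longrightarrow> (Q has_real_derivative r ^ (m + 1) * plus_powr p (U r)) (at r)"

text \<open>The nonlinearity is first replaced by the bounded, globally Lipschitz \<open>F\<close>.
  The flux is then nonnegative, so \<open>U\<close> never exceeds its initial value 1 and the
  truncation has no effect on it.\<close>

lemma emden_exists:
  fixes p :: real
  assumes m: "m \<ge> 1" and p: "1 < p" "p * m < m + 2"
  shows "\<exists>U Q. emden m p U Q"
proof -
  define F where "F = (\<lambda>t. plus_powr p (min t 1))"
  have "\<exists>u. continuous_on {0..} u \<and> (\<forall>r\<ge>0. u r = 1 - integral {0..r} (radW m (\<lambda>\<tau>. F (u \<tau>))))"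
  proof (rule radial_ode_solution[where K=p and F=F and m=m])
    show "p > 0" using p by simp
    fix x y :: real
    have "\<bar>F x - F y\<bar> \<le> p * 1 powr (p - 1) * \<bar>min x 1 - min y 1\<bar>"
      unfolding F_def using p by (intro plus_powr_lipschitz) auto
    also have "\<dots> \<le> p * \<bar>x - y\<bar>" using p by (simp add: min_def)
    finally show "\<bar>F x - F y\<bar> \<le> p * \<bar>x - y\<bar>" .
    have "plus_powr p (min x 1) \<le> plus_powr p 1" using p by (intro plus_powr_mono) auto
    then show "\<bar>F x\<bar> \<le> 1" using plus_powr_nonneg[of p "min x 1"] by (simp add: F_def plus_powr_pos)
  qed
  then obtain U where cU: "continuous_on {0..} U"
    and U: "\<And>r. r \<ge> 0 \<Longrightarrow> U r = 1 - integral {0..r} (radW m (\<lambda>\<tau>. F (U \<tau>)))" by blast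
  define h where "h = (\<lambda>\<tau>. F (U \<tau>))"
  have ch: "continuous_on {0..} h"
    unfolding h_def F_def using p by (intro continuous_on_plus_powr continuous_intros cU) auto
  define Q where "Q = radQ m h"
  have h0: "h \<tau> \<ge> 0" for \<tau> by (simp add: h_def F_def plus_powr_nonneg)
  have dU: "(U has_real_derivative - (Q r / r ^ (m + 1))) (at r)" if r: "r > 0" for r
  proof -
    have "((\<lambda>r. 1 - integral {0..r} (radW m h)) has_real_derivative 0 - radW m h r) (at r within {0..r + 1})"
      using r by (intro DERIV_diff DERIV_const integral_has_real_derivative[OF radW_cont[OF ch, of "r + 1"]]) auto
    moreover have "at r within {0..r + 1} = at r"
      using r by (intro at_within_interior) auto
    ultimately have "((\<lambda>r. 1 - integral {0..r} (radW m h)) has_real_derivative - (Q r / r ^ (m + 1))) (at r)"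
      by (simp add: radW_def Q_def)
    then show ?thesis
      by (rule DERIV_cong_ev[THEN iffD1, rotated -1])
        (use r in \<open>auto simp: U h_def eventually_nhds intro!: exI[of _ "{0<..}"]\<close>)
  qed
  have Qnn: "Q r \<ge> 0" if "r \<ge> 0" for r
    unfolding Q_def radQ_def using that h0
    by (intro integral_nonneg integrable_continuous_real continuous_intros continuous_on_subset[OF ch]) auto
  have U0: "U 0 = 1" using U[of 0] by simp
  have Ule: "U r \<le> 1" if "r \<ge> 0" for r
  proof -
    have "U r \<le> U 0"
    proof (rule DERIV_nonpos_imp_decreasing_open[of 0 r U])
      show "0 \<le> r" by fact
      show "\<exists>y. DERIV U x :> y \<and> y \<le> 0" if "0 < x" "x < r" for x
        by (rule DERIV_exI[OF dU]) (use Qnn[of x] that in auto)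
      show "continuous_on {0..r} U" by (rule continuous_on_subset[OF cU]) auto
    qed
    then show ?thesis using U0 by simp
  qed
  have hU: "h r = plus_powr p (U r)" if "r \<ge> 0" for r
    using Ule[OF that] by (simp add: h_def F_def min_def)
  have "emden m p U Q"
  proof
    show "continuous_on {0..} Q"
      unfolding continuous_on_eq_continuous_within
    proof
      fix r :: real assume r: "r \<in> {0..}"
      have "continuous (at r within {0..r + 1}) Q"
        using radQ_cont[OF ch, of "r + 1" m] r by (simp add: Q_def continuous_on_eq_continuous_within)
      moreover have "at r within {0..r + 1} = at r within {0..}"
        by (rule at_within_nhd[of r "{..<r + 1}"]) auto
      ultimately show "continuous (at r within {0..}) Q" by (metis continuous_within)
    qed
    show "(Q has_real_derivative r ^ (m + 1) * plus_powr p (U r)) (at r)" if "r > 0" for r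
      using radQ_deriv[OF ch that, of m] that by (simp add: Q_def hU)
  qed (use m p cU U0 dU in \<open>auto simp: Q_def radQ_0\<close>)
  then show ?thesis by blast
qed

section \<open>Monotonicity, first zero and exterior form of the Emden profile\<close>

context emden
begin

lemma cU': "0 \<le> a \<Longrightarrow> continuous_on {a..b} U"
  by (rule continuous_on_subset[OF cU]) auto

lemma cQ': "0 \<le> a \<Longrightarrow> continuous_on {a..b} Q"
  by (rule continuous_on_subset[OF cQ]) auto

lemma Q_mono:
  assumes "0 \<le> a" "a \<le> b"
  shows "Q a \<le> Q b"
proof (rule DERIV_nonneg_imp_increasing_open[of a b Q])
  show "\<exists>y. DERIV Q x :> y \<and> y \<ge> 0" if "a < x" "x < b" for x
    by (rule DERIV_exI[OF dQ]) (use that assms plus_powr_nonneg[of p "U x"] in auto)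
qed (use assms cQ' in auto)

lemma Q_nonneg: "r \<ge> 0 \<Longrightarrow> Q r \<ge> 0"
  using Q_mono[of 0 r] Q0 by simp

lemma Q_pos: "r > 0 \<Longrightarrow> Q r > 0"
proof -
  assume r: "r > 0"
  have "continuous (at 0 within {0..}) U" using cU by (simp add: continuous_on_eq_continuous_within)
  then have "\<exists>d>0. \<forall>s\<in>{0..}. dist s 0 < d \<longrightarrow> dist (U s) (U 0) < 1"
    unfolding continuous_within_eps_delta by (metis zero_less_one)
  then obtain d where d: "d > 0" and near: "\<And>s. s \<ge> 0 \<Longrightarrow> dist s 0 < d \<Longrightarrow> dist (U s) (U 0) < 1"
    by (metis atLeast_iff)
  have Upos: "U s > 0" if "s \<ge> 0" "s < d" for s
    using near[of s] that U0 unfolding dist_real_def by linarith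
  define a where "a = min (d / 2) r"
  have a: "0 < a" "a < d" "a \<le> r" using d r by (auto simp: a_def)
  have "Q 0 < Q a"
  proof (rule DERIV_pos_imp_increasing_open[OF a(1)])
    show "\<exists>y. DERIV Q x :> y \<and> y > 0" if "0 < x" "x < a" for x
      by (rule DERIV_exI[OF dQ]) (use that Upos[of x] a in \<open>auto simp: plus_powr_pos\<close>)
  qed (auto intro: cQ')
  also have "Q a \<le> Q r" using a by (intro Q_mono) auto
  finally show ?thesis using Q0 by simp
qed

lemma U_strict: "0 \<le> a \<Longrightarrow> a < b \<Longrightarrow> U b < U a"
proof -
  assume ab: "0 \<le> a" "a < b"
  show ?thesis
  proof (rule DERIV_neg_imp_decreasing_open[OF ab(2)])
    show "\<exists>y. DERIV U x :> y \<and> y < 0" if "a < x" "x < b" for x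
      by (rule DERIV_exI[OF dU]) (use that ab Q_pos[of x] in auto)
  qed (auto intro: cU' ab)
qed

lemma U_le_1: "r \<ge> 0 \<Longrightarrow> U r \<le> 1"
  using U_strict[of 0 r] U0 by (cases "r = 0") auto

lemma dpow: "r > 0 \<Longrightarrow> ((\<lambda>r. 1 / r ^ m) has_real_derivative - (m / r ^ (m + 1))) (at r)"
proof -
  assume r: "r > 0"
  obtain k where k: "m = Suc k" using m by (cases m) auto
  have d: "((\<lambda>r. r ^ m) has_real_derivative m * r ^ k) (at r)"
    using DERIV_pow[of m r] by (simp add: k)
  have "((\<lambda>r. inverse (r ^ m)) has_real_derivative - (inverse (r ^ m) * (m * r ^ k) * inverse (r ^ m))) (at r)"
    by (rule DERIV_inverse'[OF d]) (use r in simp)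
  moreover have "inverse (r ^ m) * (m * r ^ k) * inverse (r ^ m) = m / r ^ (m + 1)"
    using r by (simp add: k field_simps)
  ultimately show ?thesis by (simp add: inverse_eq_divide)
qed

text \<open>A positive solution on the half line would satisfy \<open>U \<ge> c r\<^sup>-\<^sup>m\<close>, as the flux \<open>Q\<close> does not decrease, and
  \<open>U powr (1 - p) \<ge> c r\<^sup>2\<close>; these are incompatible since \<open>m (p - 1) < 2\<close>.\<close>

lemma U_zero: "\<exists>r>0. U r = 0"
proof (rule ccontr)
  assume none: "\<not> (\<exists>r>0. U r = 0)"
  have pos: "U r > 0" if r: "r \<ge> 0" for r
  proof (rule ccontr)
    assume "\<not> U r > 0"
    then have "U r \<le> 0" by simp
    then obtain x where "0 \<le> x" "x \<le> r" "U x = 0"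
      using IVT2'[of U r 0 0] r U0 cU'[of 0 r] by auto
    then show False using none U0 by (cases "x = 0") auto
  qed
  \<comment> \<open>\<open>U\<close> decreases, so the source on (0, r) is at least
    \<open>U r powr p\<close>; integrate this against the weight.\<close>
  have flux: "Q r \<ge> U r powr p * (r ^ (m + 2) / (m + 2))" if r: "r > 0" for r
  proof -
    define D where "D = (\<lambda>s. Q s - U r powr p * (s ^ (m + 2) / (m + 2)))"
    have "D 0 \<le> D r"
    proof (rule DERIV_nonneg_imp_increasing_open[of 0 r D])
      fix x assume x: "0 < x" "x < r"
      have "(D has_real_derivative (x ^ (m + 1) * plus_powr p (U x) - U r powr p * x ^ (m + 1))) (at x)"
        unfolding D_def using x
        by (auto intro!: derivative_eq_intros dQ simp del: power_Suc)
      moreover have "U r powr p \<le> plus_powr p (U x)"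
        using U_strict[of x r] x pos[of x] pos[of r] p by (auto simp: plus_powr_pos intro!: powr_mono2)
      then have "x ^ (m + 1) * plus_powr p (U x) - U r powr p * x ^ (m + 1) \<ge> 0"
        using x by (simp add: mult.commute mult_right_mono)
      ultimately show "\<exists>y. DERIV D x :> y \<and> y \<ge> 0" by blast
    next
      show "continuous_on {0..r} D" unfolding D_def by (intro continuous_intros cQ') auto
    qed (use r in simp)
    then show ?thesis by (simp add: D_def Q0)
  qed
  \<comment> \<open>The derivative of U^(1-p) is (p-1) U^(-p) Q / r^(m+1), and \<open>flux\<close>
    bounds it below by (p-1) r / (m+2).\<close>
  have upper: "U r powr (1 - p) \<ge> (p - 1) / (2 * (m + 2)) * r\<^sup>2" if r: "r > 0" for r
  proof -
    define Y where "Y = (\<lambda>s. U s powr (1 - p) - (p - 1) / (2 * (m + 2)) * s\<^sup>2)"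
    have "Y 0 \<le> Y r"
    proof (rule DERIV_nonneg_imp_increasing_open[of 0 r Y])
      fix x assume x: "0 < x" "x < r"
      let ?d = "(1 - p) * U x powr (1 - p - 1) * (- (Q x / x ^ (m + 1))) - (p - 1) / (2 * (m + 2)) * (2 * x)"
      have "(Y has_real_derivative ?d) (at x)"
        unfolding Y_def using x pos[of x]
        by (auto intro!: derivative_eq_intros dU)
      moreover have "?d \<ge> 0"
      proof -
        have "U x powr p * (x ^ (m + 2) / (m + 2)) / x ^ (m + 1) \<le> Q x / x ^ (m + 1)"
          using flux[of x] x by (intro divide_right_mono) auto
        moreover have "U x powr p * (x ^ (m + 2) / (m + 2)) / x ^ (m + 1) = U x powr p * (x / (m + 2))"
        proof -
          have "x ^ (m + 2) = x ^ (m + 1) * x" by simp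
          moreover have "x ^ (m + 1) \<noteq> 0" using x by simp
          moreover have "a * (b * x / c) / b = a * (x / c)" if "b \<noteq> 0" for a b c :: real using that by simp
          ultimately show ?thesis by (simp only:) simp
        qed
        ultimately have "U x powr (- p) * (U x powr p * (x / (m + 2))) \<le> U x powr (- p) * (Q x / x ^ (m + 1))"
          by (intro mult_left_mono) auto
        moreover have "U x powr (- p) * U x powr p = 1"
          using pos[of x] x by (simp flip: powr_add)
        ultimately have "x / (m + 2) \<le> U x powr (- p) * (Q x / x ^ (m + 1))"
          by (metis mult.assoc mult_1)
        then have "(p - 1) * (x / (m + 2)) \<le> (p - 1) * (U x powr (- p) * (Q x / x ^ (m + 1)))"
          using p by (intro mult_left_mono) auto
        moreover have "?d = (p - 1) * (U x powr (- p) * (Q x / x ^ (m + 1))) - (p - 1) * (x / (m + 2))"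
        proof -
          have "(1 - p) * A * (- B) - (p - 1) / (2 * c) * (2 * x) = (p - 1) * (A * B) - (p - 1) * (x / c)" for A B c
          proof -
            have "(p - 1) / (2 * c) * (2 * x) = (p - 1) * (x / c)" by simp
            then show ?thesis by (simp only:) (simp add: algebra_simps)
          qed
          moreover have "1 - p - 1 = - p" "real (2 * (m + 2)) = 2 * real (m + 2)" by simp_all
          ultimately show ?thesis by (simp only:)
        qed
        ultimately show ?thesis by linarith
      qed
      ultimately show "\<exists>y. DERIV Y x :> y \<and> y \<ge> 0" by blast
    next
      show "continuous_on {0..r} Y" unfolding Y_def using pos
        by (intro continuous_intros cU') force+
    qed (use r in simp)
    then show ?thesis by (simp add: Y_def U0)
  qed
  define q where "q = Q 1 / m"
  have q: "q > 0" using Q_pos[of 1] m by (simp add: q_def)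
  \<comment> \<open>From radius 1 on the flux is at least \<open>Q 1\<close>, so \<open>U\<close>
    minus q r^(-m) does not increase. Were it negative at \<open>a\<close>, it would stay below that
    value while q r^(-m) tends to 0, making \<open>U\<close> negative at the point
    \<open>b\<close>.\<close>
  have lower: "U a \<ge> q * (1 / a ^ m)" if a: "a \<ge> 1" for a
  proof (rule ccontr)
    assume neg: "\<not> U a \<ge> q * (1 / a ^ m)"
    define Z where "Z = (\<lambda>s. U s - q * (1 / s ^ m))"
    have Za: "Z a < 0" using neg by (simp add: Z_def)
    define b where "b = max a (2 * q / (- Z a))"
    have b: "b \<ge> a" "b \<ge> 1" "b \<ge> 2 * q / (- Z a)" using a by (auto simp: b_def)
    have "Z b \<le> Z a"
    proof (rule DERIV_nonpos_imp_decreasing_open[OF b(1)])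
      fix x assume x: "a < x" "x < b"
      have x0: "x > 0" using x a by simp
      have "(Z has_real_derivative - (Q x / x ^ (m + 1)) - q * (- (m / x ^ (m + 1)))) (at x)"
        unfolding Z_def by (intro DERIV_diff dU DERIV_cmult dpow x0)
      moreover have "- (Q x / x ^ (m + 1)) - q * (- (m / x ^ (m + 1))) = (Q 1 - Q x) / x ^ (m + 1)"
        using m by (simp add: q_def diff_divide_distrib)
      moreover have "(Q 1 - Q x) / x ^ (m + 1) \<le> 0"
        using Q_mono[of 1 x] a x x0 by (intro divide_nonpos_pos) auto
      ultimately show "\<exists>y. DERIV Z x :> y \<and> y \<le> 0" by metis
    next
      show "continuous_on {a..b} Z" unfolding Z_def using a
        by (intro continuous_intros cU') auto
    qed
    moreover have "q * (1 / b ^ m) \<le> - Z a / 2"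
    proof -
      have "b ^ 1 \<le> b ^ m" using b m by (intro power_increasing) auto
      then have "q * (1 / b ^ m) \<le> q * (1 / b)" using b q by (intro mult_left_mono divide_left_mono) auto
      also have "\<dots> \<le> - Z a / 2" using b(2,3) Za by (simp add: field_simps)
      finally show ?thesis .
    qed
    moreover have "U b = Z b + q * (1 / b ^ m)" by (simp add: Z_def)
    ultimately have "U b < 0" using Za by linarith
    then show False using pos[of b] b by simp
  qed
  define \<theta> where "\<theta> = m * (p - 1)"
  have \<theta>: "\<theta> < 2" using p(2) by (simp add: \<theta>_def algebra_simps)
  define c1 where "c1 = (p - 1) / (2 * (m + 2))"
  define c2 where "c2 = q powr (1 - p)"
  have c: "c1 > 0" "c2 > 0" using p q by (simp_all add: c1_def c2_def)
  have ineq: "c1 * r powr (2 - \<theta>) \<le> c2" if r: "r \<ge> 1" for r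
  proof -
    have "c1 * r powr 2 \<le> U r powr (1 - p)"
      using upper[of r] r by (simp add: c1_def)
    also have "\<dots> \<le> (q * (1 / r ^ m)) powr (1 - p)"
      using lower[OF r] q r p by (intro powr_mono2') auto
    also have "q * (1 / r ^ m) = q * r powr (- m)"
      using r by (simp add: powr_minus powr_realpow field_simps)
    also have "\<dots> powr (1 - p) = c2 * r powr \<theta>"
      using q by (simp add: powr_mult powr_powr c2_def \<theta>_def algebra_simps)
    finally have "c1 * r powr 2 * r powr (- \<theta>) \<le> c2 * r powr \<theta> * r powr (- \<theta>)"
      by (intro mult_right_mono) auto
    moreover have "r powr (2 - \<theta>) = r powr 2 * r powr (- \<theta>)" using powr_add[of r 2 "- \<theta>"] by simp
    moreover have "r powr \<theta> * r powr (- \<theta>) = 1" using powr_add[of r \<theta> "- \<theta>"] r by simp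
    ultimately show ?thesis by (simp only: mult.assoc mult_1_right)
  qed
  \<comment> \<open>At this radius the left side of \<open>ineq\<close> equals
    \<open>c1 + c2\<close>.\<close>
  define r where "r = (1 + c2 / c1) powr (1 / (2 - \<theta>))"
  have "1 + c2 / c1 \<ge> 1" using c by simp
  then have "r \<ge> 1" unfolding r_def using \<theta> by (intro ge_one_powr_ge_zero) auto
  moreover have "r powr (2 - \<theta>) = 1 + c2 / c1"
    unfolding r_def using \<theta> \<open>1 + c2 / c1 \<ge> 1\<close> by (simp add: powr_powr)
  ultimately have "c1 * (1 + c2 / c1) \<le> c2" using ineq by metis
  moreover have "c1 * (1 + c2 / c1) = c1 + c2" using c by (simp add: distrib_left)
  ultimately show False using c by linarith
qed

definition r0 :: real where "r0 = (SOME r. r > 0 \<and> U r = 0)"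

lemma r0: "r0 > 0" "U r0 = 0"
  using someI_ex[OF U_zero[unfolded Bex_def]] unfolding r0_def by auto

lemma U_sign: "r \<ge> 0 \<Longrightarrow> U r > 0 \<longleftrightarrow> r < r0" "r \<ge> 0 \<Longrightarrow> U r < 0 \<longleftrightarrow> r0 < r"
  using U_strict[of r r0] U_strict[of r0 r] r0 by (cases r r0 rule: linorder_cases; simp)+

lemma Q_after: "r \<ge> r0 \<Longrightarrow> Q r = Q r0"
proof -
  assume r: "r \<ge> r0"
  have "Q r \<le> Q r0"
  proof (rule DERIV_nonpos_imp_decreasing_open[OF r])
    show "\<exists>y. DERIV Q x :> y \<and> y \<le> 0" if "r0 < x" "x < r" for x
      by (rule DERIV_exI[OF dQ]) (use that r0 U_sign[of x] in \<open>auto simp: plus_powr_nonpos\<close>)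
  qed (use r0 in \<open>auto intro: cQ'\<close>)
  then show ?thesis using Q_mono[of r0 r] r r0 by simp
qed

text \<open>Past \<open>r0\<close> the source vanishes and the flux is constant, so \<open>U\<close>
  differs from a multiple of the fundamental solution r^(-m) by a constant, which
  \<open>U r0 = 0\<close> determines.\<close>

lemma U_after:
  assumes r: "r \<ge> r0"
  shows "U r = Q r0 / m * (1 / r ^ m - 1 / r0 ^ m)"
proof -
  define Z where "Z = (\<lambda>s. U s - Q r0 / m * (1 / s ^ m))"
  have "\<exists>y. DERIV Z x :> y \<and> y = 0" if x: "r0 < x" for x
  proof -
    have x0: "x > 0" using x r0 by simp
    have "(Z has_real_derivative - (Q x / x ^ (m + 1)) - Q r0 / m * (- (m / x ^ (m + 1)))) (at x)"
      unfolding Z_def by (intro DERIV_diff dU DERIV_cmult dpow x0)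
    moreover have "- (Q x / x ^ (m + 1)) - Q r0 / m * (- (m / x ^ (m + 1))) = 0"
      using m Q_after[of x] x by simp
    ultimately show ?thesis by metis
  qed
  moreover have "continuous_on {r0..r} Z" unfolding Z_def using r0
    by (intro continuous_intros cU') auto
  ultimately have "Z r = Z r0"
    using DERIV_nonpos_imp_decreasing_open[OF r, of Z] DERIV_nonneg_imp_increasing_open[OF r, of Z]
    by (metis order_antisym order_refl)
  then show ?thesis using r0 by (simp add: Z_def algebra_simps)
qed

end

section \<open>Regularity of radial functions\<close>

lemma deriv_bound_imp_diff_bound:
  fixes f :: "real \<Rightarrow> real"
  assumes "a \<le> b" "continuous_on {a..b} f"
    and d: "\<And>z. a < z \<Longrightarrow> z < b \<Longrightarrow> (f has_real_derivative f' z) (at z)"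
    and le: "\<And>z. a < z \<Longrightarrow> z < b \<Longrightarrow> \<bar>f' z\<bar> \<le> M"
  shows "\<bar>f b - f a\<bar> \<le> M * (b - a)"
proof (cases "a = b")
  case False
  then have ab: "a < b" using assms by simp
  obtain z where z: "a < z" "z < b" "f b - f a = f' z * (b - a)"
    by (rule mvt[OF ab assms(2), of "\<lambda>z t. f' z * t"]) (use d in \<open>auto simp: has_field_derivative_def\<close>)
  have "\<bar>f b - f a\<bar> = \<bar>f' z\<bar> * (b - a)" using ab by (simp only: z(3) abs_mult abs_of_nonneg)
  also have "\<dots> \<le> M * (b - a)" using le[OF z(1,2)] ab by (intro mult_right_mono) auto
  finally show ?thesis .
qed simp

definition loc_lip :: "(real \<Rightarrow> real) \<Rightarrow> bool" where
  "loc_lip g \<longleftrightarrow> (\<forall>T\<ge>0. \<exists>L\<ge>0. \<forall>x\<in>{0..T}. \<forall>y\<in>{0..T}. \<bar>g x - g y\<bar> \<le> L * \<bar>x - y\<bar>)"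

lemma loc_lipD:
  assumes "loc_lip g" "T \<ge> 0"
  obtains L where "L \<ge> 0" "\<And>x y. 0 \<le> x \<Longrightarrow> x \<le> T \<Longrightarrow> 0 \<le> y \<Longrightarrow> y \<le> T \<Longrightarrow> \<bar>g x - g y\<bar> \<le> L * \<bar>x - y\<bar>"
  using assms unfolding loc_lip_def by (metis atLeastAtMost_iff)

lemma loc_lip_scale:
  assumes g: "loc_lip g" and s: "s \<ge> 0"
  shows "loc_lip (\<lambda>r. b * g (s * r))"
  unfolding loc_lip_def
proof (intro allI impI)
  fix T :: real assume T: "T \<ge> 0"
  obtain L where L: "L \<ge> 0" "\<And>x y. 0 \<le> x \<Longrightarrow> x \<le> s * T \<Longrightarrow> 0 \<le> y \<Longrightarrow> y \<le> s * T \<Longrightarrow> \<bar>g x - g y\<bar> \<le> L * \<bar>x - y\<bar>"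
    using loc_lipD[OF g, of "s * T"] s T by (metis mult_nonneg_nonneg)
  show "\<exists>L\<ge>0. \<forall>x\<in>{0..T}. \<forall>y\<in>{0..T}. \<bar>b * g (s * x) - b * g (s * y)\<bar> \<le> L * \<bar>x - y\<bar>"
  proof (intro exI[of _ "\<bar>b\<bar> * L * s"] conjI ballI)
    show "0 \<le> \<bar>b\<bar> * L * s" using L s by simp
    fix x y assume "x \<in> {0..T}" "y \<in> {0..T}"
    then have "\<bar>g (s * x) - g (s * y)\<bar> \<le> L * \<bar>s * x - s * y\<bar>"
      using s by (intro L) (auto intro: mult_left_mono)
    also have "\<bar>s * x - s * y\<bar> = s * \<bar>x - y\<bar>" using s by (simp add: abs_mult flip: right_diff_distrib)
    finally have "\<bar>b\<bar> * \<bar>g (s * x) - g (s * y)\<bar> \<le> \<bar>b\<bar> * (L * (s * \<bar>x - y\<bar>))"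
      by (intro mult_left_mono) auto
    then show "\<bar>b * g (s * x) - b * g (s * y)\<bar> \<le> \<bar>b\<bar> * L * s * \<bar>x - y\<bar>"
      by (simp add: abs_mult mult.assoc flip: right_diff_distrib)
  qed
qed

lemma loc_lip_continuous:
  assumes "loc_lip g"
  shows "continuous_on {0..T} g"
proof (cases "T \<ge> 0")
  case True
  then obtain L where L: "L \<ge> 0" "\<And>x y. 0 \<le> x \<Longrightarrow> x \<le> T \<Longrightarrow> 0 \<le> y \<Longrightarrow> y \<le> T \<Longrightarrow> \<bar>g x - g y\<bar> \<le> L * \<bar>x - y\<bar>"
    using loc_lipD[OF assms] by blast
  then show ?thesis
    by (intro lipschitz_on_continuous_on[of L] lipschitz_onI) (auto simp: dist_real_def)
qed simp

text \<open>The function \<open>x \<mapsto> \<phi> (norm x)\<close> in dimension \<open>n\<close> has gradient \<open>- G (norm x) *\<^sub>R x\<close> and Laplacian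
  \<open>- h (norm x)\<close>; working with \<open>G = - \<phi>' / r\<close> instead of \<open>\<phi>'\<close> removes the singularity at the origin.\<close>

locale radial_profile =
  fixes n :: real and \<phi> G h :: "real \<Rightarrow> real"
  assumes d\<phi>: "\<And>r. r > 0 \<Longrightarrow> (\<phi> has_real_derivative - (r * G r)) (at r)"
    and dG: "\<And>r. r > 0 \<Longrightarrow> (G has_real_derivative (h r - n * G r) / r) (at r)"
    and h0: "h 0 = n * G 0"
    and lipG: "loc_lip G" and liph: "loc_lip h"
    and c\<phi>: "continuous_on {0..} \<phi>"

lemma radial_profile_scale:
  assumes "radial_profile n \<phi> G h" and s: "s > 0"
  shows "radial_profile n (\<lambda>r. b * \<phi> (s * r)) (\<lambda>r. b * s\<^sup>2 * G (s * r)) (\<lambda>r. b * s\<^sup>2 * h (s * r))"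
proof -
  interpret radial_profile n \<phi> G h by fact
  show ?thesis
  proof
    fix r :: real assume r: "r > 0"
    have sr: "s * r > 0" using r s by simp
    have ds: "((\<lambda>r. s * r) has_real_derivative s) (at r)" by (auto intro!: derivative_eq_intros)
    have "((\<lambda>r. \<phi> (s * r)) has_real_derivative - (s * r * G (s * r)) * s) (at r)"
      by (rule DERIV_chain2[OF d\<phi>[OF sr] ds])
    from DERIV_cmult[OF this, of b]
    show "((\<lambda>r. b * \<phi> (s * r)) has_real_derivative - (r * (b * s\<^sup>2 * G (s * r)))) (at r)"
      by (simp add: power2_eq_square mult_ac)
    have "((\<lambda>r. G (s * r)) has_real_derivative (h (s * r) - n * G (s * r)) / (s * r) * s) (at r)"
      by (rule DERIV_chain2[OF dG[OF sr] ds])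
    moreover have "(h (s * r) - n * G (s * r)) / (s * r) * s = (h (s * r) - n * G (s * r)) / r"
      using s by simp
    ultimately have "((\<lambda>r. G (s * r)) has_real_derivative (h (s * r) - n * G (s * r)) / r) (at r)"
      by simp
    from DERIV_cmult[OF this, of "b * s\<^sup>2"]
    show "((\<lambda>r. b * s\<^sup>2 * G (s * r)) has_real_derivative (b * s\<^sup>2 * h (s * r) - n * (b * s\<^sup>2 * G (s * r))) / r) (at r)"
      by (simp add: right_diff_distrib mult_ac)
  next
    show "b * s\<^sup>2 * h (s * 0) = n * (b * s\<^sup>2 * G (s * 0))" using h0 by simp
    show "loc_lip (\<lambda>r. b * s\<^sup>2 * G (s * r))" "loc_lip (\<lambda>r. b * s\<^sup>2 * h (s * r))"
      using s by (intro loc_lip_scale lipG liph; simp)+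
    show "continuous_on {0..} (\<lambda>r. b * \<phi> (s * r))"
      using s by (intro continuous_intros continuous_on_compose2[OF c\<phi>]) auto
  qed
qed

context radial_profile
begin

text \<open>By \<open>dG\<close> this is r G'(r). It is the coefficient of the discontinuous term
  \<open>sgn x\<close> in the Hessian, and its vanishing at 0 is what keeps that term
  continuous.\<close>

definition E :: "real \<Rightarrow> real" where "E r = h r - n * G r"

lemma E0: "E 0 = 0" by (simp add: E_def h0)

lemma lipE: "loc_lip E"
  unfolding loc_lip_def
proof (intro allI impI)
  fix T :: real assume T: "T \<ge> 0"
  obtain K where K: "K \<ge> 0" "\<And>x y. 0 \<le> x \<Longrightarrow> x \<le> T \<Longrightarrow> 0 \<le> y \<Longrightarrow> y \<le> T \<Longrightarrow> \<bar>h x - h y\<bar> \<le> K * \<bar>x - y\<bar>"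
    using loc_lipD[OF liph T] by blast
  obtain L where L: "L \<ge> 0" "\<And>x y. 0 \<le> x \<Longrightarrow> x \<le> T \<Longrightarrow> 0 \<le> y \<Longrightarrow> y \<le> T \<Longrightarrow> \<bar>G x - G y\<bar> \<le> L * \<bar>x - y\<bar>"
    using loc_lipD[OF lipG T] by blast
  show "\<exists>L\<ge>0. \<forall>x\<in>{0..T}. \<forall>y\<in>{0..T}. \<bar>E x - E y\<bar> \<le> L * \<bar>x - y\<bar>"
  proof (intro exI[of _ "K + \<bar>n\<bar> * L"] conjI ballI)
    show "0 \<le> K + \<bar>n\<bar> * L" using K L by simp
    fix x y assume xy: "x \<in> {0..T}" "y \<in> {0..T}"
    have "\<bar>E x - E y\<bar> \<le> \<bar>h x - h y\<bar> + \<bar>n * (G x - G y)\<bar>"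
      unfolding E_def by (simp add: right_diff_distrib)
    also have "\<dots> \<le> K * \<bar>x - y\<bar> + \<bar>n\<bar> * (L * \<bar>x - y\<bar>)"
      using K(2)[of x y] L(2)[of x y] xy by (intro add_mono) (auto simp: abs_mult intro: mult_left_mono)
    finally show "\<bar>E x - E y\<bar> \<le> (K + \<bar>n\<bar> * L) * \<bar>x - y\<bar>" by (simp add: algebra_simps)
  qed
qed

lemma \<phi>_near_0: "\<exists>C. \<forall>r. 0 \<le> r \<and> r \<le> 1 \<longrightarrow> \<bar>\<phi> r - \<phi> 0\<bar> \<le> C * r\<^sup>2"
proof -
  have "compact (G ` {0..1})"
    by (intro compact_continuous_image loc_lip_continuous lipG) auto
  then obtain C where C: "\<And>r. 0 \<le> r \<Longrightarrow> r \<le> 1 \<Longrightarrow> \<bar>G r\<bar> \<le> C"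
    using compact_imp_bounded[of "G ` {0..1}"] unfolding bounded_iff by (metis imageI real_norm_def atLeastAtMost_iff)
  have C0: "C \<ge> 0" using C[of 0] by simp
  have "\<bar>\<phi> r - \<phi> 0\<bar> \<le> C * r\<^sup>2" if r: "0 \<le> r" "r \<le> 1" for r
  proof -
    have "\<bar>\<phi> r - \<phi> 0\<bar> \<le> (r * C) * (r - 0)"
    proof (rule deriv_bound_imp_diff_bound[OF r(1)])
      show "continuous_on {0..r} \<phi>" by (rule continuous_on_subset[OF c\<phi>]) auto
      fix z assume z: "0 < z" "z < r"
      show "(\<phi> has_real_derivative - (z * G z)) (at z)" using z by (intro d\<phi>)
      have "z * \<bar>G z\<bar> \<le> r * C" using C[of z] z r by (intro mult_mono) auto
      then show "\<bar>- (z * G z)\<bar> \<le> r * C" using z by (simp add: abs_mult)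
    qed
    then show ?thesis by (simp add: power2_eq_square mult_ac)
  qed
  then show ?thesis by blast
qed

definition grad :: "real^'n::finite \<Rightarrow> real^'n" where
  "grad x = - G (norm x) *\<^sub>R x"

text \<open>The second derivative is - G - E in the radial direction and - G in the tangential ones.
  At the origin \<open>sgn 0 = 0\<close>, so a single formula covers all points.\<close>

definition hess :: "real^'n::finite \<Rightarrow> real^'n \<Rightarrow> real^'n" where
  "hess x v = (- G (norm x)) *\<^sub>R v + (- E (norm x)) *\<^sub>R ((sgn x \<bullet> v) *\<^sub>R sgn x)"

text \<open>Off the origin this is the chain rule. At the origin, where the norm is not
  differentiable, the difference quotients are estimated directly:
  \<open>\<phi> r - \<phi> 0\<close> is quadratically small and \<open>G\<close> is
  Lipschitz.\<close>

lemma grad_hess_radial: "grad_hess UNIV (\<lambda>x::real^'n::finite. \<phi> (norm x)) grad hess"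
  unfolding grad_hess_def
proof (intro ballI conjI)
  fix x :: "real^'n"
  obtain C where C: "\<And>r. 0 \<le> r \<Longrightarrow> r \<le> 1 \<Longrightarrow> \<bar>\<phi> r - \<phi> 0\<bar> \<le> C * r\<^sup>2" using \<phi>_near_0 by blast
  obtain L where L: "L \<ge> 0" "\<And>x y. 0 \<le> x \<Longrightarrow> x \<le> 1 \<Longrightarrow> 0 \<le> y \<Longrightarrow> y \<le> 1 \<Longrightarrow> \<bar>G x - G y\<bar> \<le> L * \<bar>x - y\<bar>"
    using loc_lipD[OF lipG, of 1] by auto
  have nl: "((\<lambda>v::real^'n. K * norm v) \<longlongrightarrow> 0) (at 0)" for K
    by (auto intro!: tendsto_eq_intros)
  have ev: "\<forall>\<^sub>F v in at (0::real^'n). norm v < 1"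
    unfolding eventually_at by (intro exI[of _ 1]) (auto simp: dist_norm)
  show "((\<lambda>x. \<phi> (norm x)) has_derivative (\<lambda>h. grad x \<bullet> h)) (at x)"
  proof (cases "x = 0")
    case True
    have "((\<lambda>v. norm (\<phi> (norm v) - \<phi> 0) / norm v) \<longlongrightarrow> 0) (at (0::real^'n))"
    proof (rule Lim_null_comparison[OF _ nl[of C]])
      show "\<forall>\<^sub>F v in at (0::real^'n). norm (norm (\<phi> (norm v) - \<phi> 0) / norm v) \<le> C * norm v"
        using ev
      proof eventually_elim
        case (elim v)
        then show ?case using C[of "norm v"]
          by (cases "v = 0") (auto simp: divide_le_eq power2_eq_square mult_ac)
      qed
    qed
    then show ?thesis using True by (simp add: has_derivative_at grad_def)
  next
    case False
    have "(\<phi> has_derivative (\<lambda>t. - (norm x * G (norm x)) * t)) (at (norm x))"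
      using False by (intro d\<phi>[unfolded has_field_derivative_def]) simp
    from has_derivative_compose[OF has_derivative_norm[OF False] this]
    have "((\<lambda>x. \<phi> (norm x)) has_derivative (\<lambda>v. - (norm x * G (norm x)) * (v \<bullet> sgn x))) (at x)" .
    moreover have "- (norm x * G (norm x)) * (v \<bullet> sgn x) = grad x \<bullet> v" for v
      using False by (simp add: grad_def sgn_div_norm inner_commute)
    ultimately show ?thesis by simp
  qed
  show "(grad has_derivative hess x) (at x)"
  proof (cases "x = 0")
    case True
    have "((\<lambda>v. norm (- G (norm v) *\<^sub>R v - (- G 0) *\<^sub>R v) / norm v) \<longlongrightarrow> 0) (at (0::real^'n))"
    proof (rule Lim_null_comparison[OF _ nl[of L]])
      show "\<forall>\<^sub>F v in at (0::real^'n). norm (norm (- G (norm v) *\<^sub>R v - (- G 0) *\<^sub>R v) / norm v) \<le> L * norm v"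
        using ev
      proof eventually_elim
        case (elim v)
        have "- G (norm v) *\<^sub>R v - (- G 0) *\<^sub>R v = (G 0 - G (norm v)) *\<^sub>R v"
          by (simp add: scaleR_left_diff_distrib)
        then show ?case using L(2)[of 0 "norm v"] elim
          by (cases "v = 0") (auto simp: divide_le_eq)
      qed
    qed
    moreover have "bounded_linear (\<lambda>v::real^'n. (- G 0) *\<^sub>R v)" by (rule bounded_linear_scaleR_right)
    ultimately show ?thesis using True by (simp add: has_derivative_at grad_def[abs_def] hess_def[abs_def] E0)
  next
    case False
    have "(G has_derivative (\<lambda>t. E (norm x) / norm x * t)) (at (norm x))"
      unfolding E_def using False by (intro dG[unfolded has_field_derivative_def]) simp
    from has_derivative_compose[OF has_derivative_norm[OF False] this]
    have d: "((\<lambda>x. G (norm x)) has_derivative (\<lambda>v. E (norm x) / norm x * (v \<bullet> sgn x))) (at x)" .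
    have "((\<lambda>x. - G (norm x) *\<^sub>R x) has_derivative
        (\<lambda>v. - G (norm x) *\<^sub>R v + (- (E (norm x) / norm x * (v \<bullet> sgn x))) *\<^sub>R x)) (at x)"
      by (intro has_derivative_scaleR has_derivative_minus d has_derivative_ident)
    moreover have "- G (norm x) *\<^sub>R v + (- (E (norm x) / norm x * (v \<bullet> sgn x))) *\<^sub>R x = hess x v" for v
      using False by (simp add: hess_def sgn_div_norm inner_commute divide_inverse mult_ac)
    ultimately show ?thesis by (simp add: grad_def[abs_def])
  qed
qed

lemma lin_trace_hess:
  fixes x :: "real^'n::finite"
  assumes "n = real CARD('n)"
  shows "lin_trace (hess x) = - h (norm x)"
proof -
  have "lin_trace (hess x) = - G (norm x) * n - E (norm x) * (sgn x \<bullet> sgn x)"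
    unfolding hess_def[abs_def] by (simp only: lin_trace_add lin_trace_scale lin_trace_id lin_trace_rank_one assms)
  moreover have "sgn x \<bullet> sgn x = (if x = 0 then 0 else 1)"
    by (simp add: dot_square_norm norm_sgn)
  ultimately show ?thesis using E0 by (auto simp: E_def)
qed

text \<open>\<open>sgn\<close> is not Lipschitz near 0, but the weight \<open>norm x\<close> repairs
  this; in \<open>hess_lipschitz\<close> the weight is supplied by
  \<open>\<bar>E (norm x)\<bar> \<le> M * norm x\<close>.\<close>

lemma norm_sgn_diff:
  fixes x y :: "real^'n::finite"
  shows "norm x * norm (sgn x - sgn y) \<le> 2 * norm (x - y)"
proof -
  have sx: "norm z *\<^sub>R sgn z = z" for z :: "real^'n"
    by (cases "z = 0") (simp_all add: sgn_div_norm)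
  have "norm x *\<^sub>R (sgn x - sgn y) = (x - y) + (norm y - norm x) *\<^sub>R sgn y"
    using sx[of x] sx[of y] by (simp add: algebra_simps)
  then have "norm x * norm (sgn x - sgn y) = norm ((x - y) + (norm y - norm x) *\<^sub>R sgn y)"
    by (metis norm_scaleR abs_norm_cancel)
  also have "\<dots> \<le> norm (x - y) + \<bar>norm y - norm x\<bar> * norm (sgn y)"
    by (metis norm_triangle_ineq norm_scaleR)
  also have "\<bar>norm y - norm x\<bar> * norm (sgn y) \<le> \<bar>norm y - norm x\<bar> * 1"
    by (intro mult_left_mono) (auto simp: norm_sgn)
  also have "\<bar>norm y - norm x\<bar> \<le> norm (x - y)"
    by (metis norm_minus_commute norm_triangle_ineq3)
  finally show ?thesis by simp
qed

text \<open>The constant is \<open>L + 5 * M\<close>: \<open>L\<close> from the variation of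
  \<open>G\<close>, \<open>4 * M\<close> from that of the rank-one matrix weighted by
  \<open>E\<close>, and \<open>M\<close> from that of \<open>E\<close>.\<close>

lemma hess_lipschitz:
  "\<exists>K\<ge>0. \<forall>x\<in>cball 0 R. \<forall>y\<in>cball 0 R. \<bar>hess x (axis j 1) $ i - hess y (axis j 1) $ i\<bar> \<le> K * norm (x - y :: real^'n::finite)"
proof (cases "R \<ge> 0")
  case True
  obtain L where L: "L \<ge> 0" "\<And>x y. 0 \<le> x \<Longrightarrow> x \<le> R \<Longrightarrow> 0 \<le> y \<Longrightarrow> y \<le> R \<Longrightarrow> \<bar>G x - G y\<bar> \<le> L * \<bar>x - y\<bar>"
    using loc_lipD[OF lipG True] by blast
  obtain M where M: "M \<ge> 0" "\<And>x y. 0 \<le> x \<Longrightarrow> x \<le> R \<Longrightarrow> 0 \<le> y \<Longrightarrow> y \<le> R \<Longrightarrow> \<bar>E x - E y\<bar> \<le> M * \<bar>x - y\<bar>"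
    using loc_lipD[OF lipE True] by blast
  have "\<bar>hess x (axis j 1) $ i - hess y (axis j 1) $ i\<bar> \<le> (L + 5 * M) * norm (x - y)"
    if xy: "x \<in> cball 0 R" "y \<in> cball 0 R" for x y :: "real^'n"
  proof -
    define a where "a = sgn x"
    define b where "b = sgn y"
    define \<delta> where "\<delta> = (axis j 1 :: real^'n) $ i"
    have comp: "\<bar>sgn z $ l\<bar> \<le> 1" for z :: "real^'n" and l
      using component_le_norm_cart[of "sgn z" l] by (auto simp: norm_sgn split: if_splits)
    have H: "hess z (axis j 1) $ i = - G (norm z) * \<delta> - E (norm z) * (sgn z $ j * sgn z $ i)" for z :: "real^'n"
      by (simp add: hess_def \<delta>_def inner_axis)
    have nn: "\<bar>norm x - norm y\<bar> \<le> norm (x - y)" by (rule norm_triangle_ineq3)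
    have d: "\<bar>\<delta>\<bar> \<le> 1" by (simp add: \<delta>_def axis_def)
    have "\<bar>G (norm x) - G (norm y)\<bar> \<le> L * \<bar>norm x - norm y\<bar>" using xy by (intro L) auto
    also have "\<dots> \<le> L * norm (x - y)" using L nn by (intro mult_left_mono)
    finally have 1: "\<bar>G (norm x) - G (norm y)\<bar> \<le> L * norm (x - y)" .
    have "\<bar>E (norm x) - E (norm y)\<bar> \<le> M * \<bar>norm x - norm y\<bar>" using xy by (intro M) auto
    also have "\<dots> \<le> M * norm (x - y)" using M nn by (intro mult_left_mono)
    finally have 2: "\<bar>E (norm x) - E (norm y)\<bar> \<le> M * norm (x - y)" .
    have "\<bar>E (norm x) - E 0\<bar> \<le> M * \<bar>norm x - 0\<bar>" using xy True by (intro M) auto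
    then have 3: "\<bar>E (norm x)\<bar> \<le> M * norm x" by (simp add: E0)
    have ab: "\<bar>a $ l - b $ l\<bar> \<le> norm (a - b)" for l
      using component_le_norm_cart[of "a - b" l] by simp
    have "\<bar>a $ j * a $ i - b $ j * b $ i\<bar> = \<bar>a $ j * (a $ i - b $ i) + (a $ j - b $ j) * b $ i\<bar>"
      by (simp add: algebra_simps)
    also have "\<dots> \<le> \<bar>a $ j\<bar> * \<bar>a $ i - b $ i\<bar> + \<bar>a $ j - b $ j\<bar> * \<bar>b $ i\<bar>"
      by (metis abs_triangle_ineq abs_mult)
    also have "\<dots> \<le> 1 * norm (a - b) + norm (a - b) * 1"
      unfolding a_def b_def by (intro add_mono mult_mono comp ab[unfolded a_def b_def]) auto
    finally have 4: "\<bar>a $ j * a $ i - b $ j * b $ i\<bar> \<le> 2 * norm (a - b)" by simp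
    have "\<bar>E (norm x)\<bar> * \<bar>a $ j * a $ i - b $ j * b $ i\<bar> \<le> (M * norm x) * (2 * norm (a - b))"
      using 3 4 M by (intro mult_mono) auto
    also have "\<dots> = 2 * M * (norm x * norm (a - b))" by simp
    also have "\<dots> \<le> 2 * M * (2 * norm (x - y))"
      unfolding a_def b_def using M by (intro mult_left_mono norm_sgn_diff) auto
    finally have 5: "\<bar>E (norm x)\<bar> * \<bar>a $ j * a $ i - b $ j * b $ i\<bar> \<le> 4 * M * norm (x - y)" by simp
    have "\<bar>b $ j * b $ i\<bar> \<le> 1 * 1"
      unfolding abs_mult b_def by (intro mult_mono comp) auto
    then have 6: "\<bar>E (norm x) - E (norm y)\<bar> * \<bar>b $ j * b $ i\<bar> \<le> M * norm (x - y) * 1"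
      using 2 M by (intro mult_mono) auto
    have 7: "\<bar>G (norm x) - G (norm y)\<bar> * \<bar>\<delta>\<bar> \<le> L * norm (x - y) * 1"
      using 1 d L by (intro mult_mono) auto
    have "hess x (axis j 1) $ i - hess y (axis j 1) $ i = - ((G (norm x) - G (norm y)) * \<delta>)
       - E (norm x) * (a $ j * a $ i - b $ j * b $ i) - (E (norm x) - E (norm y)) * (b $ j * b $ i)"
      unfolding H a_def b_def by (simp add: algebra_simps)
    also have "\<bar>\<dots>\<bar> \<le> \<bar>(G (norm x) - G (norm y)) * \<delta>\<bar> + \<bar>E (norm x) * (a $ j * a $ i - b $ j * b $ i)\<bar>
       + \<bar>(E (norm x) - E (norm y)) * (b $ j * b $ i)\<bar>" by linarith
    also have "\<dots> \<le> L * norm (x - y) * 1 + 4 * M * norm (x - y) + M * norm (x - y) * 1"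
      using 5 6 7 by (intro add_mono) (simp_all only: abs_mult)
    finally show ?thesis by (simp add: algebra_simps)
  qed
  then show ?thesis using L M by (intro exI[of _ "L + 5 * M"]) auto
qed (auto intro!: exI[of _ 0])

end

section \<open>Translations and Hoelder classes on balls\<close>

lemma grad_hess_shift:
  assumes "grad_hess S f G H" "\<And>x. x \<in> T \<Longrightarrow> x + c \<in> S"
  shows "grad_hess T (\<lambda>x. f (x + c)) (\<lambda>x. G (x + c)) (\<lambda>x. H (x + c))"
  unfolding grad_hess_def
proof (intro ballI conjI)
  fix x assume "x \<in> T"
  then have x: "x + c \<in> S" by (rule assms(2))
  have d: "((\<lambda>x. x + c) has_derivative (\<lambda>h. h)) (at x)" by (auto intro!: derivative_eq_intros)
  show "((\<lambda>x. f (x + c)) has_derivative (\<lambda>h. G (x + c) \<bullet> h)) (at x)"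
    using assms(1) x by (intro has_derivative_compose[OF d]) (simp add: grad_hess_def)
  show "((\<lambda>x. G (x + c)) has_derivative H (x + c)) (at x)"
    using assms(1) x has_derivative_compose[OF d, of G "H (x + c)"] by (simp add: grad_hess_def)
qed

text \<open>The derivatives exist on the whole space, so uniform continuity comes from compactness
  of the closed ball. A Lipschitz bound becomes a Hoelder bound since |x - y| <= (2R)^(1-\<beta>) |x
  - y|^\<beta> on a ball of diameter 2R.\<close>

lemma C2beta_closure_grad_hess:
  fixes f :: "real^'n::finite \<Rightarrow> real"
  assumes D: "grad_hess UNIV f G H" and beta: "0 < \<beta>" "\<beta> < 1"
    and lip: "\<And>i j. \<exists>K\<ge>0. \<forall>x\<in>ball c R. \<forall>y\<in>ball c R. \<bar>H x (axis j 1) $ i - H y (axis j 1) $ i\<bar> \<le> K * norm (x - y)"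
  shows "C2beta_closure \<beta> (ball c R) f"
proof -
  have df: "f differentiable (at x)" for x
    using D unfolding grad_hess_def differentiable_def by blast
  have dpd: "pd i f differentiable (at x)" for i x
    using grad_hess_has_derivative_pd[OF D] unfolding differentiable_def by blast
  have cont: "continuous_on S f" "continuous_on S (pd i f)" for S i
    using df dpd by (auto intro!: continuous_at_imp_continuous_on differentiable_imp_continuous_within)
  have uc: "uniformly_continuous_on (ball c R) g" if "continuous_on UNIV g" for g :: "real^'n \<Rightarrow> real"
  proof -
    have "uniformly_continuous_on (cball c R) g"
      by (intro compact_uniformly_continuous continuous_on_subset[OF that]) auto
    then show ?thesis unfolding uniformly_continuous_on_def by (meson ball_subset_cball subsetD)
  qed
  have pp: "pd j (pd i f) x = H x (axis j 1) $ i" for i j x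
    using grad_hess_pd_pd[OF D] by simp
  have cpp: "continuous_on (ball c R) (pd j (pd i f))" for i j
  proof -
    obtain K where K: "K \<ge> 0" "\<And>x y. x \<in> ball c R \<Longrightarrow> y \<in> ball c R \<Longrightarrow> \<bar>H x (axis j 1) $ i - H y (axis j 1) $ i\<bar> \<le> K * norm (x - y)"
      using lip by blast
    then show ?thesis
      by (intro lipschitz_on_continuous_on[of K] lipschitz_onI) (simp_all only: pp dist_real_def dist_norm)
  qed
  have hp: "holder_on \<beta> (ball c R) (pd j (pd i f))" for i j
  proof -
    obtain K where K: "K \<ge> 0" "\<And>x y. x \<in> ball c R \<Longrightarrow> y \<in> ball c R \<Longrightarrow> \<bar>H x (axis j 1) $ i - H y (axis j 1) $ i\<bar> \<le> K * norm (x - y)"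
      using lip by blast
    have "\<bar>pd j (pd i f) x - pd j (pd i f) y\<bar> \<le> K * (2 * R) powr (1 - \<beta>) * norm (x - y) powr \<beta>"
      if xy: "x \<in> ball c R" "y \<in> ball c R" for x y
    proof -
      have "norm (x - y) \<le> 2 * R"
        using xy dist_triangle[of x y c] by (simp add: dist_norm norm_minus_commute)
      then have "norm (x - y) powr (1 - \<beta>) * norm (x - y) powr \<beta> \<le> (2 * R) powr (1 - \<beta>) * norm (x - y) powr \<beta>"
        using beta by (intro mult_right_mono powr_mono2) auto
      moreover have "norm (x - y) powr (1 - \<beta>) * norm (x - y) powr \<beta> = norm (x - y)"
        by (simp flip: powr_add)
      ultimately have "K * norm (x - y) \<le> K * ((2 * R) powr (1 - \<beta>) * norm (x - y) powr \<beta>)"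
        using K by (intro mult_left_mono) auto
      then show ?thesis using K(2)[OF xy] unfolding pp by linarith
    qed
    then show ?thesis unfolding holder_on_def by blast
  qed
  show ?thesis
    unfolding C2beta_closure_def C2_on_def using df dpd cont cpp hp uc by auto
qed

section \<open>Regularity of the Emden profile at the origin\<close>

context emden
begin

text \<open>This is - U'(r) / r; the value at 0 is its limit, because \<open>U 0 = 1\<close> makes
  Q(r) behave like r^(m+2) / (m+2).\<close>

definition flux_density :: "real \<Rightarrow> real" where
  "flux_density r = (if r = 0 then 1 / (m + 2) else Q r / r ^ (m + 2))"

lemma plus_powr_U_le_1: "r \<ge> 0 \<Longrightarrow> plus_powr p (U r) \<le> 1"
  using plus_powr_mono[of p "U r" 1] U_le_1[of r] p by (simp add: plus_powr_pos)

lemma Q_le: "r \<ge> 0 \<Longrightarrow> Q r \<le> r ^ (m + 2)"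
proof -
  assume r: "r \<ge> 0"
  have "\<bar>Q r - Q 0\<bar> \<le> r ^ (m + 1) * (r - 0)"
  proof (rule deriv_bound_imp_diff_bound[OF r])
    show "continuous_on {0..r} Q" by (rule cQ') simp
    fix z assume z: "0 < z" "z < r"
    show "(Q has_real_derivative z ^ (m + 1) * plus_powr p (U z)) (at z)" using z by (intro dQ)
    have "z ^ (m + 1) * plus_powr p (U z) \<le> r ^ (m + 1) * 1"
      using z plus_powr_U_le_1[of z] plus_powr_nonneg by (intro mult_mono power_mono) auto
    then show "\<bar>z ^ (m + 1) * plus_powr p (U z)\<bar> \<le> r ^ (m + 1)"
      using z plus_powr_nonneg[of p "U z"] by (simp add: abs_mult)
  qed
  then show ?thesis by (simp add: Q0 mult_ac)
qed

lemma loc_lip_plus_powr_U: "loc_lip (\<lambda>r. plus_powr p (U r))"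
  unfolding loc_lip_def
proof (intro allI impI)
  fix T :: real assume T: "T \<ge> 0"
  have half: "\<bar>U b - U a\<bar> \<le> T * (b - a)" if ab: "0 \<le> a" "a \<le> b" "b \<le> T" for a b
  proof (rule deriv_bound_imp_diff_bound[OF ab(2) cU'[OF ab(1)]])
    fix z assume z: "a < z" "z < b"
    then have z0: "z > 0" using ab by simp
    show "(U has_real_derivative - (Q z / z ^ (m + 1))) (at z)" using z0 by (rule dU)
    have "Q z / z ^ (m + 1) \<le> z ^ (m + 2) / z ^ (m + 1)" using Q_le[of z] z0 by (intro divide_right_mono) auto
    also have "\<dots> = z" using z0 by simp
    finally have "Q z / z ^ (m + 1) \<le> T" using z ab by linarith
    moreover have "Q z / z ^ (m + 1) \<ge> 0" using Q_nonneg[of z] z0 by simp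
    ultimately show "\<bar>- (Q z / z ^ (m + 1))\<bar> \<le> T" by linarith
  qed
  have UL: "\<bar>U a - U b\<bar> \<le> T * \<bar>a - b\<bar>" if "a \<in> {0..T}" "b \<in> {0..T}" for a b
    using half[of a b] half[of b a] that by (cases "a \<le> b") (auto simp: abs_minus_commute)
  show "\<exists>L\<ge>0. \<forall>x\<in>{0..T}. \<forall>y\<in>{0..T}. \<bar>plus_powr p (U x) - plus_powr p (U y)\<bar> \<le> L * \<bar>x - y\<bar>"
  proof (intro exI[of _ "p * T"] conjI ballI)
    show "0 \<le> p * T" using p T by simp
    fix x y assume xy: "x \<in> {0..T}" "y \<in> {0..T}"
    have "\<bar>plus_powr p (U x) - plus_powr p (U y)\<bar> \<le> p * 1 powr (p - 1) * \<bar>U x - U y\<bar>"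
      using p xy by (intro plus_powr_lipschitz U_le_1) auto
    also have "\<dots> \<le> p * (T * \<bar>x - y\<bar>)" using UL[OF xy] p by simp
    finally show "\<bar>plus_powr p (U x) - plus_powr p (U y)\<bar> \<le> p * T * \<bar>x - y\<bar>" by simp
  qed
qed

lemma deriv_flux_density:
  assumes r: "r > 0"
  shows "(flux_density has_real_derivative (plus_powr p (U r) - real (m + 2) * flux_density r) / r) (at r)"
proof -
  have "((\<lambda>r. Q r / r ^ (m + 2)) has_real_derivative
      (r ^ (m + 1) * plus_powr p (U r) * r ^ (m + 2) - Q r * (real (m + 2) * r ^ (m + 1))) / (r ^ (m + 2) * r ^ (m + 2))) (at r)"
    using DERIV_pow[of "m + 2" r] r by (intro DERIV_divide dQ) auto
  moreover have "(r ^ (m + 1) * plus_powr p (U r) * r ^ (m + 2) - Q r * (real (m + 2) * r ^ (m + 1))) / (r ^ (m + 2) * r ^ (m + 2))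
      = (plus_powr p (U r) - real (m + 2) * (Q r / r ^ (m + 2))) / r"
  proof -
    have "(a * f * (a * r) - q * (k * a)) / ((a * r) * (a * r)) = (f - k * (q / (a * r))) / r"
      if "a > 0" for a f q k :: real
      using that r by (simp add: field_simps)
    moreover have "r ^ (m + 2) = r ^ (m + 1) * r" "r ^ (m + 1) > 0" using r by simp_all
    ultimately show ?thesis by (simp only:)
  qed
  ultimately have d: "((\<lambda>r. Q r / r ^ (m + 2)) has_real_derivative (plus_powr p (U r) - real (m + 2) * flux_density r) / r) (at r)"
    using r by (simp add: flux_density_def)
  show ?thesis
    by (rule DERIV_cong_ev[THEN iffD1, rotated -1, OF d])
      (use r in \<open>auto simp: flux_density_def eventually_nhds intro!: exI[of _ "{0<..}"]\<close>)
qed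

text \<open>Comparing \<open>Q\<close> with r^(m+2) / (m+2) shows that the deviation from the value
  at 0 is at most L r, where \<open>L\<close> is a Lipschitz constant of the source. Inserted into
  \<open>deriv_flux_density\<close>, this absorbs the factor 1/r and bounds the derivative by
  \<open>M\<close>.\<close>

lemma loc_lip_flux_density: "loc_lip flux_density"
  unfolding loc_lip_def
proof (intro allI impI)
  fix T :: real assume T: "T \<ge> 0"
  let ?n = "real (m + 2)"
  obtain L where L: "L \<ge> 0" "\<And>x y. 0 \<le> x \<Longrightarrow> x \<le> T \<Longrightarrow> 0 \<le> y \<Longrightarrow> y \<le> T \<Longrightarrow> \<bar>plus_powr p (U x) - plus_powr p (U y)\<bar> \<le> L * \<bar>x - y\<bar>"
    using loc_lipD[OF loc_lip_plus_powr_U T] by blast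
  have h0: "plus_powr p (U 0) = 1" by (simp add: U0 plus_powr_pos)
  have hb: "\<bar>plus_powr p (U x) - 1\<bar> \<le> L * x" if "0 \<le> x" "x \<le> T" for x
    using L(2)[of x 0] that by (simp add: h0)
  have at0: "\<bar>flux_density r - flux_density 0\<bar> \<le> L * r" if r: "0 < r" "r \<le> T" for r
  proof -
    define D where "D = (\<lambda>s. Q s - s ^ (m + 2) / ?n)"
    have "\<bar>D r - D 0\<bar> \<le> (r ^ (m + 1) * (L * r)) * (r - 0)"
    proof (rule deriv_bound_imp_diff_bound)
      show "0 \<le> r" using r by simp
      show "continuous_on {0..r} D" unfolding D_def by (intro continuous_intros cQ') auto
      fix z assume z: "0 < z" "z < r"
      have "(D has_real_derivative z ^ (m + 1) * plus_powr p (U z) - ?n * z ^ (m + 1) / ?n) (at z)"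
        unfolding D_def using DERIV_pow[of "m + 2" z] z by (intro DERIV_diff dQ DERIV_cdivide) auto
      moreover have "z ^ (m + 1) * plus_powr p (U z) - ?n * z ^ (m + 1) / ?n = z ^ (m + 1) * (plus_powr p (U z) - 1)"
        by (simp add: right_diff_distrib)
      ultimately show "(D has_real_derivative z ^ (m + 1) * (plus_powr p (U z) - 1)) (at z)" by simp
      have "z ^ (m + 1) * \<bar>plus_powr p (U z) - 1\<bar> \<le> r ^ (m + 1) * (L * r)"
      proof (intro mult_mono power_mono)
        have "\<bar>plus_powr p (U z) - 1\<bar> \<le> L * z" using hb[of z] z r by simp
        also have "\<dots> \<le> L * r" using L z by (intro mult_left_mono) auto
        finally show "\<bar>plus_powr p (U z) - 1\<bar> \<le> L * r" .
      qed (use z r in auto)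
      then show "\<bar>z ^ (m + 1) * (plus_powr p (U z) - 1)\<bar> \<le> r ^ (m + 1) * (L * r)"
        using z by (simp add: abs_mult)
    qed
    then have "\<bar>Q r - r ^ (m + 2) / ?n\<bar> \<le> r ^ (m + 2) * (L * r)"
      by (simp add: D_def Q0 mult_ac)
    moreover have rp: "r ^ (m + 2) > 0" using r by simp
    ultimately have "\<bar>Q r - r ^ (m + 2) / ?n\<bar> / r ^ (m + 2) \<le> L * r"
      by (simp add: divide_le_eq mult.commute del: power_Suc)
    moreover have "flux_density r - flux_density 0 = (Q r - r ^ (m + 2) / ?n) / r ^ (m + 2)"
      using r rp by (simp add: flux_density_def diff_divide_distrib)
    ultimately show ?thesis using rp by (simp only: abs_divide abs_of_pos)
  qed
  define M where "M = L + ?n * L"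
  have M: "M \<ge> L" "M \<ge> 0" using L by (auto simp: M_def)
  have half: "\<bar>flux_density b - flux_density a\<bar> \<le> M * (b - a)" if ab: "0 \<le> a" "a < b" "b \<le> T" for a b
  proof (cases "a = 0")
    case True
    have "L * b \<le> M * b" using M ab by (intro mult_right_mono) auto
    moreover have "\<bar>flux_density b - flux_density 0\<bar> \<le> L * b" using at0[of b] ab True by simp
    ultimately have "\<bar>flux_density b - flux_density 0\<bar> \<le> M * b" by linarith
    then show ?thesis by (simp add: True)
  next
    case False
    then have a: "a > 0" using ab by simp
    show ?thesis
    proof (rule deriv_bound_imp_diff_bound)
      show "a \<le> b" using ab by simp
      show "continuous_on {a..b} flux_density"
      proof (intro continuous_at_imp_continuous_on ballI)
        fix x assume "x \<in> {a..b}"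
        then have "x > 0" using a by simp
        then show "isCont flux_density x" by (rule DERIV_isCont[OF deriv_flux_density])
      qed
      fix z assume z: "a < z" "z < b"
      then have z0: "z > 0" "z \<le> T" using a ab by auto
      show "(flux_density has_real_derivative (plus_powr p (U z) - ?n * flux_density z) / z) (at z)"
        by (rule deriv_flux_density[OF z0(1)])
      have "?n * flux_density 0 = 1" by (simp add: flux_density_def)
      then have "plus_powr p (U z) - ?n * flux_density z = (plus_powr p (U z) - 1) - ?n * (flux_density z - flux_density 0)"
        by (simp add: right_diff_distrib)
      also have "\<bar>\<dots>\<bar> \<le> \<bar>plus_powr p (U z) - 1\<bar> + \<bar>?n * (flux_density z - flux_density 0)\<bar>"
        by (rule abs_triangle_ineq4)
      also have "\<dots> \<le> L * z + ?n * (L * z)"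
        using hb[of z] at0[of z] z0 by (intro add_mono) (simp_all add: abs_mult mult_left_mono)
      also have "\<dots> = M * z" by (simp add: M_def algebra_simps)
      finally show "\<bar>(plus_powr p (U z) - ?n * flux_density z) / z\<bar> \<le> M"
        using z0 by (simp add: abs_divide divide_le_eq)
    qed
  qed
  show "\<exists>L\<ge>0. \<forall>x\<in>{0..T}. \<forall>y\<in>{0..T}. \<bar>flux_density x - flux_density y\<bar> \<le> L * \<bar>x - y\<bar>"
  proof (intro exI[of _ M] conjI ballI)
    fix x y assume "x \<in> {0..T}" "y \<in> {0..T}"
    then show "\<bar>flux_density x - flux_density y\<bar> \<le> M * \<bar>x - y\<bar>"
      using half[of x y] half[of y x]
      by (cases x y rule: linorder_cases) (auto simp: abs_minus_commute)
  qed (rule M(2))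
qed

lemma emden_profile: "radial_profile (real (m + 2)) U flux_density (\<lambda>r. plus_powr p (U r))"
proof
  fix r :: real assume r: "r > 0"
  have "r * flux_density r = Q r / r ^ (m + 1)" using r by (simp add: flux_density_def)
  then show "(U has_real_derivative - (r * flux_density r)) (at r)" using dU[OF r] by simp
  show "(flux_density has_real_derivative (plus_powr p (U r) - real (m + 2) * flux_density r) / r) (at r)"
    using r by (rule deriv_flux_density)
qed (auto simp: U0 plus_powr_pos flux_density_def cU loc_lip_plus_powr_U loc_lip_flux_density)

end

section \<open>Integration of radial functions over balls\<close>

lemma integrable_on_cball:
  fixes g :: "'a::euclidean_space \<Rightarrow> real"
  assumes "continuous_on (cball c t) g"
  shows "g integrable_on cball c t"
proof -
  have "set_integrable lborel (cball c t) g"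
    using borel_integrable_compact[OF compact_cball assms] by (simp add: set_integrable_def)
  then show ?thesis by (rule set_borel_integral_eq_integral(1))
qed

text \<open>Polar coordinates by thin shells. On a shell where \<open>h\<close> deviates from
  \<open>h a\<close> by at most \<open>\<epsilon>\<close>, both the integral of \<open>g\<close> and
  n \<omega> (F b - F a) are \<open>h a\<close> times the shell volume, up to
  \<open>\<epsilon>\<close> times that volume. Over a fine partition the errors telescope to 2
  \<epsilon> times the volume of the ball.\<close>

lemma has_integral_radial:
  fixes c :: "'a::euclidean_space"
  assumes R: "R \<ge> 0" and h: "continuous_on {0..R} h" and F: "continuous_on {0..R} F" "F 0 = 0"
    and d: "\<And>r. 0 < r \<Longrightarrow> r < R \<Longrightarrow> (F has_real_derivative r ^ k * h r) (at r)"
    and k: "DIM('a) = Suc k"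
  shows "((\<lambda>x. h (norm (x - c))) has_integral DIM('a) * measure lebesgue (ball (0::'a) 1) * F R) (ball c R)"
proof -
  define n where "n = Suc k"
  define \<omega> where "\<omega> = measure lebesgue (ball (0::'a) 1)"
  define g where "g = (\<lambda>x. h (norm (x - c)))"
  have \<omega>0: "\<omega> \<ge> 0" by (simp add: \<omega>_def)
  have cg: "continuous_on (cball c R) g"
    unfolding g_def by (rule continuous_on_compose2[OF h]) (auto intro!: continuous_intros simp: dist_norm norm_minus_commute)
  have ig: "g integrable_on cball c t" if "t \<le> R" for t
    by (rule integrable_on_cball, rule continuous_on_subset[OF cg]) (use that in auto)
  have vol: "((\<lambda>x. 1) has_integral \<omega> * t ^ n) (cball c t)" if "t \<ge> 0" for t
  proof -
    have "cball c t \<in> lmeasurable" by simp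
    then have "((\<lambda>x. 1::real) has_integral measure lebesgue (cball c t)) (cball c t)"
      by (metis has_integral_integral lmeasurable_iff_integrable_on lmeasure_integral)
    moreover have "measure lebesgue (cball c t) = \<omega> * t ^ n"
    proof (cases "t = 0")
      case False
      then have "measure lborel (ball c t) = measure lborel (ball (0::'a) 1) * t ^ n"
        using content_ball_conv_unit_ball[of t c] that k by (simp add: n_def mult.commute)
      then show ?thesis by (simp add: \<omega>_def content_cball_conv_ball)
    qed (simp add: n_def)
    ultimately show ?thesis by simp
  qed
  define J where "J = (\<lambda>t. integral (cball c t) g)"
  define D where "D = (\<lambda>t. J t - n * \<omega> * F t)"
  have step: "\<bar>D b - D a\<bar> \<le> 2 * \<epsilon> * \<omega> * (b ^ n - a ^ n)"
    if ab: "0 \<le> a" "a \<le> b" "b \<le> R" and osc: "\<And>s. a \<le> s \<Longrightarrow> s \<le> b \<Longrightarrow> \<bar>h s - h a\<bar> \<le> \<epsilon>" for a b \<epsilon>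
  proof -
    let ?A = "cball c b - cball c a"
    have neg: "negligible (cball c a - cball c b)" using ab by (metis Diff_eq_empty_iff negligible_empty subset_cball)
    have "(g has_integral J b - J a) ?A"
      unfolding J_def using ab by (intro has_integral_setdiff neg integrable_integral ig) auto
    moreover have one: "((\<lambda>x. 1) has_integral \<omega> * b ^ n - \<omega> * a ^ n) ?A"
      using ab by (intro has_integral_setdiff neg vol) auto
    have m: "((\<lambda>x. q * 1) has_integral q * (\<omega> * b ^ n - \<omega> * a ^ n)) ?A" for q :: real
      by (rule has_integral_mult_right[OF one])
    have gs: "\<bar>g x - h a\<bar> \<le> \<epsilon>" if "x \<in> ?A" for x
      using that osc[of "norm (x - c)"] by (auto simp: g_def dist_norm norm_minus_commute)
    have up: "J b - J a \<le> (h a + \<epsilon>) * (\<omega> * b ^ n - \<omega> * a ^ n)"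
      by (rule has_integral_le[OF \<open>(g has_integral J b - J a) ?A\<close> m]) (use gs in \<open>force simp: abs_le_iff\<close>)
    have lo: "(h a - \<epsilon>) * (\<omega> * b ^ n - \<omega> * a ^ n) \<le> J b - J a"
      by (rule has_integral_le[OF m \<open>(g has_integral J b - J a) ?A\<close>]) (use gs in \<open>force simp: abs_le_iff\<close>)
    have "\<bar>J b - J a - h a * (\<omega> * b ^ n - \<omega> * a ^ n)\<bar> \<le> \<epsilon> * (\<omega> * b ^ n - \<omega> * a ^ n)"
      using up lo by (simp add: abs_le_iff algebra_simps)
    \<comment> \<open>\<open>n * F s\<close> is compared with \<open>q * s ^ n\<close> for
      \<open>q = h a + \<epsilon>\<close> and \<open>q = h a - \<epsilon>\<close>; the difference
      has derivative \<open>n * s ^ k * (h s - q)\<close>, whose sign is known.\<close>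
    moreover have "\<bar>n * F b - n * F a - h a * (b ^ n - a ^ n)\<bar> \<le> \<epsilon> * (b ^ n - a ^ n)"
    proof -
      have dP: "((\<lambda>s. n * F s - q * s ^ n) has_real_derivative n * s ^ k * (h s - q)) (at s)"
        if "a < s" "s < b" for s q :: real
      proof -
        have pw: "((\<lambda>s. s ^ n) has_real_derivative n * s ^ k) (at s)"
          using DERIV_pow[of n s] by (simp add: n_def)
        have "((\<lambda>s. n * F s - q * s ^ n) has_real_derivative n * (s ^ k * h s) - q * (n * s ^ k)) (at s)"
          using that ab by (intro DERIV_diff DERIV_cmult d pw) auto
        then show ?thesis by (simp add: algebra_simps)
      qed
      have cP: "continuous_on {a..b} (\<lambda>s. n * F s - q * s ^ n)" for q
        using ab by (intro continuous_intros continuous_on_subset[OF F(1)]) auto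
      have "n * F b - (h a + \<epsilon>) * b ^ n \<le> n * F a - (h a + \<epsilon>) * a ^ n"
      proof (rule DERIV_nonpos_imp_decreasing_open[of a b "\<lambda>s. n * F s - (h a + \<epsilon>) * s ^ n", OF ab(2) _ cP])
        fix s assume s: "a < s" "s < b"
        then have "h s - (h a + \<epsilon>) \<le> 0" using osc[of s] by (simp add: abs_le_iff)
        then have "real n * s ^ k * (h s - (h a + \<epsilon>)) \<le> 0"
          using s ab by (intro mult_nonneg_nonpos) auto
        with dP[OF s] show "\<exists>y. ((\<lambda>s. n * F s - (h a + \<epsilon>) * s ^ n) has_real_derivative y) (at s) \<and> y \<le> 0"
          by (rule DERIV_exI)
      qed
      moreover have "n * F b - (h a - \<epsilon>) * b ^ n \<ge> n * F a - (h a - \<epsilon>) * a ^ n"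
      proof (rule DERIV_nonneg_imp_increasing_open[of a b "\<lambda>s. n * F s - (h a - \<epsilon>) * s ^ n", OF ab(2) _ cP])
        fix s assume s: "a < s" "s < b"
        then have "h s - (h a - \<epsilon>) \<ge> 0" using osc[of s] by (simp add: abs_le_iff)
        then have "real n * s ^ k * (h s - (h a - \<epsilon>)) \<ge> 0"
          using s ab by (intro mult_nonneg_nonneg) auto
        with dP[OF s] show "\<exists>y. ((\<lambda>s. n * F s - (h a - \<epsilon>) * s ^ n) has_real_derivative y) (at s) \<and> y \<ge> 0"
          by (rule DERIV_exI)
      qed
      ultimately show ?thesis by (simp add: abs_le_iff algebra_simps)
    qed
    then have "\<omega> * \<bar>n * F b - n * F a - h a * (b ^ n - a ^ n)\<bar> \<le> \<omega> * (\<epsilon> * (b ^ n - a ^ n))"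
      using \<omega>0 by (rule mult_left_mono)
    then have "\<bar>\<omega> * (n * F b - n * F a - h a * (b ^ n - a ^ n))\<bar> \<le> \<omega> * (\<epsilon> * (b ^ n - a ^ n))"
      using \<omega>0 by (simp add: abs_mult)
    moreover have "D b - D a = (J b - J a - h a * (\<omega> * b ^ n - \<omega> * a ^ n)) - \<omega> * (n * F b - n * F a - h a * (b ^ n - a ^ n))"
      by (simp add: D_def algebra_simps)
    ultimately have "\<bar>D b - D a\<bar> \<le> \<epsilon> * (\<omega> * b ^ n - \<omega> * a ^ n) + \<omega> * (\<epsilon> * (b ^ n - a ^ n))"
      by linarith
    then show ?thesis by (simp add: algebra_simps)
  qed
  have small: "\<bar>D R - D 0\<bar> \<le> \<epsilon> * (2 * \<omega> * R ^ n)" if \<epsilon>: "\<epsilon> > 0" for \<epsilon>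
  proof (cases "R = 0")
    case False
    then have R0: "R > 0" using R by simp
    have "uniformly_continuous_on {0..R} h" by (intro compact_uniformly_continuous h) auto
    then obtain \<delta> where \<delta>: "\<delta> > 0" "\<And>x y. x \<in> {0..R} \<Longrightarrow> y \<in> {0..R} \<Longrightarrow> dist x y < \<delta> \<Longrightarrow> dist (h x) (h y) < \<epsilon>"
      using \<epsilon> unfolding uniformly_continuous_on_def by metis
    obtain N where N: "R / \<delta> < real N" using reals_Archimedean2 by blast
    have N0: "real N > 0" using N R0 \<delta>(1) by (meson divide_pos_pos less_trans)
    have RN: "R / N < \<delta>" using N N0 \<delta>(1) by (simp add: field_simps)
    define t where "t = (\<lambda>i. real i * (R / N))"
    have tN: "t N = R" "t 0 = 0" using N0 by (simp_all add: t_def)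
    have "\<bar>D (t (Suc i)) - D (t i)\<bar> \<le> 2 * \<epsilon> * \<omega> * (t (Suc i) ^ n - t i ^ n)" if i: "i < N" for i
    proof (rule step)
      show t0: "0 \<le> t i" using R0 by (simp add: t_def)
      have ts: "t (Suc i) = t i + R / N" by (simp add: t_def distrib_right add_divide_distrib)
      have RNp: "R / N > 0" using R0 N0 by simp
      show "t i \<le> t (Suc i)" using ts RNp by linarith
      have "real (Suc i) * (R / N) \<le> real N * (R / N)"
        using i RNp by (intro mult_right_mono) auto
      then show tR: "t (Suc i) \<le> R" using N0 by (simp add: t_def)
      fix s assume s: "t i \<le> s" "s \<le> t (Suc i)"
      have "dist (h s) (h (t i)) < \<epsilon>"
        by (rule \<delta>(2)) (use s t0 tR ts RN in \<open>auto simp: dist_real_def\<close>)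
      then show "\<bar>h s - h (t i)\<bar> \<le> \<epsilon>" by (simp add: dist_real_def)
    qed
    then have "(\<Sum>i<N. \<bar>D (t (Suc i)) - D (t i)\<bar>) \<le> (\<Sum>i<N. 2 * \<epsilon> * \<omega> * (t (Suc i) ^ n - t i ^ n))"
      by (intro sum_mono) auto
    also have "\<dots> = 2 * \<epsilon> * \<omega> * (t N ^ n - t 0 ^ n)"
      using sum_lessThan_telescope[of "\<lambda>i. t i ^ n" N] by (simp flip: sum_distrib_left)
    finally have "\<bar>\<Sum>i<N. D (t (Suc i)) - D (t i)\<bar> \<le> 2 * \<epsilon> * \<omega> * (t N ^ n - t 0 ^ n)"
      using sum_abs[of "\<lambda>i. D (t (Suc i)) - D (t i)" "{..<N}"] by linarith
    then have "\<bar>D (t N) - D (t 0)\<bar> \<le> 2 * \<epsilon> * \<omega> * (t N ^ n - t 0 ^ n)"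
      using sum_lessThan_telescope[of "\<lambda>i. D (t i)" N] by simp
    then show ?thesis by (simp add: tN n_def mult_ac)
  qed (simp add: n_def)
  have "\<bar>D R - D 0\<bar> \<le> 0"
  proof (rule field_le_epsilon)
    fix e :: real assume e: "e > 0"
    define C where "C = 2 * \<omega> * R ^ n"
    have C: "C \<ge> 0" using \<omega>0 R by (simp add: C_def)
    have "\<bar>D R - D 0\<bar> \<le> e / (C + 1) * C" unfolding C_def by (rule small[unfolded C_def]) (use e C in \<open>simp add: C_def\<close>)
    also have "\<dots> \<le> e" using C e by (simp add: field_simps)
    finally show "\<bar>D R - D 0\<bar> \<le> 0 + e" by simp
  qed
  moreover have "D 0 = 0" by (simp add: D_def J_def F)
  ultimately have "J R = n * \<omega> * F R" by (simp add: D_def)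
  then have "(g has_integral n * \<omega> * F R) (cball c R)"
    using ig[of R] unfolding J_def by (metis integrable_integral order_refl)
  moreover have "(g has_integral y) (cball c R) \<longleftrightarrow> (g has_integral y) (ball c R)" for y
  proof (rule has_integral_spike_set_eq)
    show "negligible {x \<in> cball c R - ball c R. g x \<noteq> 0}"
      by (rule negligible_subset[OF negligible_sphere[of c R]]) auto
    show "negligible {x \<in> ball c R - cball c R. g x \<noteq> 0}"
      by (rule negligible_subset[OF negligible_empty]) auto
  qed
  ultimately show ?thesis unfolding g_def \<omega>_def n_def k[symmetric] by simp
qed

section \<open>Classification of the solutions on a ball\<close>

context emden
begin

text \<open>The exponent comes from scaling: b U(s r) solves the equation again when b^p = b
  s^2.\<close>

definition amplitude :: "real \<Rightarrow> real" where "amplitude s = s powr (2 / (p - 1))"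

definition sol :: "real \<Rightarrow> real \<Rightarrow> real" where "sol s r = amplitude s * U (s * r)"

definition \<kappa> :: real where "\<kappa> = 2 / (p - 1) - m"

text \<open>The flux - R^(m+1) u'(R) of u = \<open>sol s\<close>: \<open>amplitude s\<close>, a
  factor s from differentiation and s^(-m-1) from the weight combine to
  \<open>s powr \<kappa>\<close>.\<close>

definition mass :: "real \<Rightarrow> real \<Rightarrow> real" where "mass s R = s powr \<kappa> * Q (s * R)"

lemma \<kappa>_pos: "\<kappa> > 0"
  using p by (simp add: \<kappa>_def field_simps)

lemma amplitude_pos: "s > 0 \<Longrightarrow> amplitude s > 0"
  by (simp add: amplitude_def)

lemma amplitude_powr_p: "s > 0 \<Longrightarrow> amplitude s powr p = amplitude s * s\<^sup>2"
proof -
  assume s: "s > 0"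
  have "2 / (p - 1) * p = 2 / (p - 1) + 2" using p by (simp add: field_simps)
  then show ?thesis using s by (simp add: amplitude_def powr_powr powr_add)
qed

lemma sol_profile:
  assumes s: "s > 0"
  shows "radial_profile (real (m + 2)) (sol s) (\<lambda>r. amplitude s * s\<^sup>2 * flux_density (s * r)) (\<lambda>r. plus_powr p (sol s r))"
proof -
  have "plus_powr p (sol s r) = amplitude s * s\<^sup>2 * plus_powr p (U (s * r))" for r
    unfolding sol_def by (simp only: plus_powr_scale[OF amplitude_pos[OF s]] amplitude_powr_p[OF s])
  then show ?thesis
    using radial_profile_scale[OF emden_profile s, of "amplitude s"] by (simp add: sol_def[abs_def])
qed

lemma sol_grad_hess:
  assumes s: "s > 0" and N: "CARD('n::finite) = m + 2"
  shows "\<exists>G H. grad_hess UNIV (\<lambda>x::real^'n. sol s (norm x)) G H \<and> (\<forall>x. lin_trace (H x) = - plus_powr p (sol s (norm x)))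
    \<and> (\<forall>R i j. \<exists>K\<ge>0. \<forall>x\<in>cball 0 R. \<forall>y\<in>cball 0 R. \<bar>H x (axis j 1) $ i - H y (axis j 1) $ i\<bar> \<le> K * norm (x - y))"
proof -
  interpret R: radial_profile "real (m + 2)" "sol s" "\<lambda>r. amplitude s * s\<^sup>2 * flux_density (s * r)" "\<lambda>r. plus_powr p (sol s r)"
    by (rule sol_profile[OF s])
  have "lin_trace (R.hess x) = - plus_powr p (sol s (norm x))" for x :: "real^'n"
    using R.lin_trace_hess[of x] N by simp
  then show ?thesis
    using R.grad_hess_radial R.hess_lipschitz by (intro exI[of _ R.grad] exI[of _ R.hess]) blast
qed

lemma sol_C2beta:
  fixes c :: "real^'n::finite"
  assumes s: "s > 0" and N: "CARD('n) = m + 2" and beta: "0 < \<beta>" "\<beta> < 1"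
  shows "C2beta_closure \<beta> (ball c R) (\<lambda>x. sol s (norm (x - c)))"
    and "lap (\<lambda>x. sol s (norm (x - c))) x = - plus_powr p (sol s (norm (x - c)))"
proof -
  obtain G H where D: "grad_hess UNIV (\<lambda>x::real^'n. sol s (norm x)) G H"
    and trH: "\<And>x. lin_trace (H x) = - plus_powr p (sol s (norm x))"
    and lip: "\<And>R i j. \<exists>K\<ge>0. \<forall>x\<in>cball 0 R. \<forall>y\<in>cball 0 R. \<bar>H x (axis j 1) $ i - H y (axis j 1) $ i\<bar> \<le> K * norm (x - y)"
    using sol_grad_hess[OF s N] by blast
  have D': "grad_hess UNIV (\<lambda>x. sol s (norm (x - c))) (\<lambda>x. G (x - c)) (\<lambda>x. H (x - c))"
    using grad_hess_shift[OF D, of UNIV "- c"] by simp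
  show "lap (\<lambda>x. sol s (norm (x - c))) x = - plus_powr p (sol s (norm (x - c)))"
    using grad_hess_lap[OF D'] trH by simp
  show "C2beta_closure \<beta> (ball c R) (\<lambda>x. sol s (norm (x - c)))"
  proof (rule C2beta_closure_grad_hess[OF D' beta])
    fix i j
    obtain K where K: "K \<ge> 0" "\<And>x y. x \<in> cball 0 R \<Longrightarrow> y \<in> cball 0 R \<Longrightarrow> \<bar>H x (axis j 1) $ i - H y (axis j 1) $ i\<bar> \<le> K * norm (x - y)"
      using lip by meson
    show "\<exists>K\<ge>0. \<forall>x\<in>ball c R. \<forall>y\<in>ball c R. \<bar>H (x - c) (axis j 1) $ i - H (y - c) (axis j 1) $ i\<bar> \<le> K * norm (x - y)"
    proof (intro exI[of _ K] conjI ballI K(1))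
      fix x y assume "x \<in> ball c R" "y \<in> ball c R"
      then have "x - c \<in> cball 0 R" "y - c \<in> cball 0 R" by (auto simp: dist_norm norm_minus_commute)
      from K(2)[OF this] show "\<bar>H (x - c) (axis j 1) $ i - H (y - c) (axis j 1) $ i\<bar> \<le> K * norm (x - y)" by simp
    qed
  qed
qed

lemma sol_continuous: "s > 0 \<Longrightarrow> continuous_on {0..R} (sol s)"
  unfolding sol_def by (intro continuous_intros continuous_on_compose2[OF cU]) auto

text \<open>As a flux, \<open>mass s\<close> is itself the primitive that
  \<open>has_integral_radial\<close> asks for.\<close>

lemma sol_integral:
  fixes c :: "real^'n::finite"
  assumes s: "s > 0" and N: "CARD('n) = m + 2" and R: "R > 0"
  shows "((\<lambda>x. plus_powr p (sol s (norm (x - c)))) has_integral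
     real CARD('n) * measure lebesgue (ball (0::real^'n) 1) * mass s R) (ball c R)"
proof -
  have "((\<lambda>x. plus_powr p (sol s (norm (x - c)))) has_integral
     DIM(real^'n) * measure lebesgue (ball (0::real^'n) 1) * mass s R) (ball c R)"
  proof (rule has_integral_radial)
    show "R \<ge> 0" using R by simp
    show "continuous_on {0..R} (\<lambda>r. plus_powr p (sol s r))"
      using p by (intro continuous_on_plus_powr sol_continuous s) auto
    show "continuous_on {0..R} (mass s)" unfolding mass_def
      using s by (intro continuous_intros continuous_on_compose2[OF cQ]) auto
    show "mass s 0 = 0" by (simp add: mass_def Q0)
    show "DIM(real^'n) = Suc (m + 1)" using N by simp
    fix r :: real assume r: "0 < r" "r < R"
    have sr: "s * r > 0" using s r by simp
    have ds: "((\<lambda>r. s * r) has_real_derivative s) (at r)" by (auto intro!: derivative_eq_intros)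
    have "((\<lambda>r. Q (s * r)) has_real_derivative (s * r) ^ (m + 1) * plus_powr p (U (s * r)) * s) (at r)"
      by (rule DERIV_chain2[OF dQ[OF sr] ds])
    from DERIV_cmult[OF this, of "s powr \<kappa>"]
    have "(mass s has_real_derivative s powr \<kappa> * ((s * r) ^ (m + 1) * plus_powr p (U (s * r)) * s)) (at r)"
      by (simp add: mass_def[abs_def])
    moreover have "s powr \<kappa> * ((s * r) ^ (m + 1) * plus_powr p (U (s * r)) * s) = r ^ (m + 1) * plus_powr p (sol s r)"
    proof -
      have "s powr \<kappa> * s ^ (m + 2) = amplitude s * s\<^sup>2"
      proof -
        have "s ^ m = s powr m" "s\<^sup>2 = s powr 2" using s by (simp_all add: powr_realpow)
        then have "s powr \<kappa> * s ^ m = amplitude s"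
          using s by (simp add: amplitude_def \<kappa>_def flip: powr_add)
        moreover have "s ^ (m + 2) = s ^ m * s\<^sup>2" by (rule power_add)
        ultimately show ?thesis by (metis mult.assoc)
      qed
      moreover have "(s * r) ^ (m + 1) * s = r ^ (m + 1) * s ^ (m + 2)"
        by (simp add: power_mult_distrib mult_ac)
      ultimately have "s powr \<kappa> * ((s * r) ^ (m + 1) * s) = r ^ (m + 1) * (amplitude s * s\<^sup>2)"
        by (metis mult.left_commute)
      moreover have "plus_powr p (sol s r) = amplitude s * s\<^sup>2 * plus_powr p (U (s * r))"
        unfolding sol_def by (simp only: plus_powr_scale[OF amplitude_pos[OF s]] amplitude_powr_p[OF s])
      ultimately show ?thesis by (metis mult.assoc mult.commute)
    qed
    ultimately show "(mass s has_real_derivative r ^ (m + 1) * plus_powr p (sol s r)) (at r)" by (simp only:)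
  qed
  then show ?thesis by simp
qed

lemma mass_strict: "0 < s \<Longrightarrow> s < t \<Longrightarrow> R > 0 \<Longrightarrow> mass s R < mass t R"
proof -
  assume st: "0 < s" "s < t" and R: "R > 0"
  have "s powr \<kappa> < t powr \<kappa>" using st \<kappa>_pos by (intro powr_less_mono2) auto
  moreover have "Q (s * R) \<le> Q (t * R)" using st R by (intro Q_mono) auto
  moreover have "Q (s * R) > 0" using st R by (intro Q_pos) auto
  ultimately show ?thesis unfolding mass_def by (intro mult_less_le_imp_less) auto
qed

lemma mass_less_iff: "0 < s \<Longrightarrow> 0 < t \<Longrightarrow> R > 0 \<Longrightarrow> mass s R < mass t R \<longleftrightarrow> s < t"
  using mass_strict[of s t R] mass_strict[of t s R] by (cases s t rule: linorder_cases) auto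

lemma mass_pos: "s > 0 \<Longrightarrow> R > 0 \<Longrightarrow> mass s R > 0"
  by (simp add: mass_def Q_pos)

text \<open>\<open>Q (s * R)\<close> is at most \<open>q\<close> for \<open>s \<le> 1\<close> and at
  least \<open>q\<close> for \<open>s \<ge> 1\<close>. Cutting the root of q s^\<kappa> = I off at 1
  from above and from below therefore gives masses on either side of \<open>I\<close>.\<close>

lemma mass_surj:
  assumes I: "I > 0" and R: "R > 0"
  shows "\<exists>s>0. mass s R = I"
proof -
  define q where "q = Q R"
  have q: "q > 0" using Q_pos[OF R] by (simp add: q_def)
  define s1 where "s1 = min 1 ((I / q) powr (1 / \<kappa>))"
  define s2 where "s2 = max 1 ((I / q) powr (1 / \<kappa>))"
  have Iq: "((I / q) powr (1 / \<kappa>)) powr \<kappa> = I / q" using \<kappa>_pos I q by (simp add: powr_powr)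
  have s1: "0 < s1" "s1 \<le> 1" using I q by (auto simp: s1_def)
  have s2: "1 \<le> s2" "s1 \<le> s2" by (auto simp: s1_def s2_def)
  have "mass s1 R \<le> (I / q) * q"
    unfolding mass_def
  proof (rule mult_mono)
    show "s1 powr \<kappa> \<le> I / q"
      using Iq powr_mono2[of \<kappa> s1 "(I / q) powr (1 / \<kappa>)"] s1 \<kappa>_pos by (simp add: s1_def)
    show "Q (s1 * R) \<le> q" unfolding q_def using s1 R by (intro Q_mono) auto
    show "0 \<le> Q (s1 * R)" using s1 R by (intro Q_nonneg) auto
  qed (use I q in auto)
  then have 1: "mass s1 R \<le> I" using q by simp
  have "mass s2 R \<ge> (I / q) * q"
    unfolding mass_def
  proof (rule mult_mono)
    show "I / q \<le> s2 powr \<kappa>"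
      using Iq powr_mono2[of \<kappa> "(I / q) powr (1 / \<kappa>)" s2] s2 \<kappa>_pos by (simp add: s2_def)
    show "q \<le> Q (s2 * R)" unfolding q_def using s2 R by (intro Q_mono) auto
  qed (use q in auto)
  then have 2: "I \<le> mass s2 R" using q by simp
  have "continuous_on {s1..s2} (\<lambda>s. mass s R)" unfolding mass_def
    using s1 R by (intro continuous_intros continuous_on_compose2[OF cQ]) auto
  then obtain s where "s1 \<le> s" "s \<le> s2" "mass s R = I"
    using IVT'[of "\<lambda>s. mass s R" s1 I s2] 1 2 s2 by auto
  then show ?thesis using s1 by (intro exI[of _ s]) auto
qed

lemma sol_at_0: "a > 0 \<Longrightarrow> sol (a powr ((p - 1) / 2)) 0 = a"
proof -
  assume a: "a > 0"
  have e: "(p - 1) / 2 * (2 / (p - 1)) = 1" using p by simp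
  show ?thesis using a by (simp only: sol_def amplitude_def powr_powr e) (simp add: U0)
qed

lemma sol_le: "s > 0 \<Longrightarrow> r \<ge> 0 \<Longrightarrow> sol s r \<le> sol s 0"
  using U_le_1[of "s * r"] amplitude_pos[of s] by (simp add: sol_def U0)

text \<open>\<open>nontriv\<close> excludes the nonpositive constants, which also solve the
  equation. It yields the strict inequality v > \<gamma> inside, and the positivity of the central
  value, without which no rescaled profile could match.\<close>

lemma ball_solution_is_sol:
  fixes v :: "real^'n::finite \<Rightarrow> real"
  assumes N: "CARD('n) = m + 2" and R: "R > 0"
    and cont: "continuous_on (cball 0 R) v" and D: "grad_hess (ball 0 R) v G H"
    and eq: "\<And>x. x \<in> ball 0 R \<Longrightarrow> lin_trace (H x) = - plus_powr p (v x)"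
    and bd: "\<And>x. norm x = R \<Longrightarrow> v x = \<gamma>"
    and nontriv: "\<exists>x\<in>ball 0 R. plus_powr p (v x) \<noteq> 0"
  shows "\<exists>s>0. \<forall>x\<in>cball 0 R. v x = sol s (norm x)"
proof -
  have cl: "closure (ball 0 R) = cball (0::real^'n) R" using R by simp
  define w where "w = (\<lambda>x. v x + - \<gamma>)"
  have Dw: "grad_hess (ball 0 R) w G H"
    using grad_hess_add[OF D grad_hess_const[of _ "- \<gamma>"]] by (simp add: w_def)
  have cw: "continuous_on (cball 0 R) w" unfolding w_def by (intro continuous_intros cont)
  have sup: "lin_trace (H x) \<le> 0" if "x \<in> ball 0 R" for x using eq[OF that] plus_powr_nonneg by simp
  have ge: "w x \<ge> 0" if "x \<in> cball 0 R" for x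
    by (rule weak_max_principle[OF open_ball bounded_ball _ Dw sup]) (use cw cl that bd R in \<open>auto simp: w_def\<close>)
  have "\<exists>y\<in>ball 0 R. w y > 0"
  proof (rule ccontr)
    assume "\<not> (\<exists>y\<in>ball 0 R. w y > 0)"
    then have const: "v x = \<gamma>" if "x \<in> ball 0 R" for x
      using ge[of x] that by (force simp: w_def)
    have "0 \<le> lin_trace (H x)" if "x \<in> ball 0 R" for x
      by (rule grad_hess_local_min[OF D open_ball that]) (simp add: const const[OF that])
    then have "plus_powr p (v x) = 0" if "x \<in> ball 0 R" for x
      using eq[OF that] plus_powr_nonneg[of p "v x"] that by force
    then show False using nontriv by blast
  qed
  then obtain y where y: "y \<in> ball 0 R" "w y > 0" by blast
  have int: "v x > \<gamma>" if "x \<in> ball 0 R" for x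
  proof -
    have "w x > 0"
      by (rule strong_max_principle[OF open_ball connected_ball Dw sup _ y that]) (use ge in auto)
    then show ?thesis by (simp add: w_def)
  qed
  have "compact (v ` cball 0 R)" by (intro compact_continuous_image cont) auto
  then obtain M0 where M0: "\<And>x. x \<in> cball 0 R \<Longrightarrow> \<bar>v x\<bar> \<le> M0"
    using compact_imp_bounded[of "v ` cball 0 R"] unfolding bounded_iff by (metis imageI real_norm_def)
  define M where "M = max 1 M0"
  have M: "M > 0" "\<And>x. x \<in> cball 0 R \<Longrightarrow> v x \<le> M" using M0 by (force simp: M_def)+
  define L where "L = p * M powr (p - 1)"
  have L: "L > 0" using p M by (simp add: L_def)
  interpret ball_problem v G H "plus_powr p" R \<gamma> L
  proof
    show "mono (plus_powr p)" using p by (intro monoI plus_powr_mono) auto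
    show "\<bar>plus_powr p (v x) - plus_powr p (v y)\<bar> \<le> L * \<bar>v x - v y\<bar>" if "x \<in> cball 0 R" "y \<in> cball 0 R" for x y
      unfolding L_def using p M that by (intro plus_powr_lipschitz) auto
  qed (use R L cont D eq bd int in auto)
  define a where "a = v 0"
  have a: "a \<le> M" using M(2)[of 0] R by (simp add: a_def)
  have "a > 0"
  proof (rule ccontr)
    assume "\<not> a > 0"
    then have a0: "plus_powr p a = 0" by (simp add: plus_powr_nonpos)
    \<comment> \<open>For \<open>a \<le> 0\<close> the constant \<open>a\<close> is a radial
      solution with the same central value.\<close>
    have "v x = a" if "x \<in> cball 0 R" for x
    proof (rule radial_unique[OF L cont _ D grad_hess_const _ radial _ _ that])
      show "\<bar>lin_trace (H x) - lin_trace (\<lambda>h::real^'n. 0)\<bar> \<le> L * \<bar>v x - a\<bar>" if "x \<in> ball 0 R" for x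
      proof -
        have "\<bar>plus_powr p (v x) - plus_powr p a\<bar> \<le> L * \<bar>v x - a\<bar>"
          unfolding L_def using p M that a by (intro plus_powr_lipschitz) auto
        then show ?thesis using eq[OF that] by (simp add: a0 lin_trace_def[of "\<lambda>h. 0"])
      qed
    qed (auto simp: a_def)
    then show False using nontriv a0 by auto
  qed
  define s where "s = a powr ((p - 1) / 2)"
  have s: "s > 0" using \<open>a > 0\<close> by (simp add: s_def)
  have s0: "sol s 0 = a" unfolding s_def by (rule sol_at_0[OF \<open>a > 0\<close>])
  obtain G' H' where D': "grad_hess UNIV (\<lambda>x::real^'n. sol s (norm x)) G' H'"
    and tr': "\<And>x. lin_trace (H' x) = - plus_powr p (sol s (norm x))"
    using sol_grad_hess[OF s N] by blast
  have "v x = sol s (norm x)" if "x \<in> cball 0 R" for x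
  proof (rule radial_unique[OF L cont _ D grad_hess_subset[OF D'] _ radial _ _ that])
    show "continuous_on (cball 0 R) (\<lambda>x::real^'n. sol s (norm x))"
      by (rule continuous_on_compose2[OF sol_continuous[OF s, of R]]) (auto intro: continuous_intros)
    show "\<bar>lin_trace (H x) - lin_trace (H' x)\<bar> \<le> L * \<bar>v x - sol s (norm x)\<bar>" if "x \<in> ball 0 R" for x
    proof -
      have "\<bar>plus_powr p (v x) - plus_powr p (sol s (norm x))\<bar> \<le> L * \<bar>v x - sol s (norm x)\<bar>"
        unfolding L_def using p M that a sol_le[OF s, of "norm x"] s0 by (intro plus_powr_lipschitz) auto
      then show ?thesis using eq[OF that] tr'[of x] by simp
    qed
  qed (auto simp: a_def[symmetric] s0)
  then show ?thesis using s by blast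
qed

lemma F_sol_sol:
  fixes c :: "real^'n::finite"
  assumes N: "CARD('n) = m + 2" and R: "R > 0" and s: "s > 0" and beta: "0 < \<beta>" "\<beta> < 1"
  shows "F_sol \<beta> p (ball c R) (real CARD('n) * measure lebesgue (ball (0::real^'n) 1) * mass s R)
    (sol s R) (\<lambda>x. sol s (norm (x - c)))"
  unfolding F_sol_def
  using sol_C2beta[OF s N beta, of c] sol_integral[OF s N R, of c] R
  by (auto simp: plus_powr_def dist_norm norm_minus_commute)

text \<open>After translation to the origin, \<open>I > 0\<close> supplies the nontriviality;
  boundary value and mass are then read off from the profile.\<close>

lemma F_sol_classification:
  fixes c :: "real^'n::finite"
  assumes N: "CARD('n) = m + 2" and R: "R > 0" and I: "I > 0"
    and F: "F_sol \<beta> p (ball c R) I \<gamma> v"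
  shows "\<exists>s>0. (\<forall>x\<in>cball c R. v x = sol s (norm (x - c))) \<and> \<gamma> = sol s R \<and>
    I = real CARD('n) * measure lebesgue (ball (0::real^'n) 1) * mass s R"
proof -
  have C2: "C2_on (ball c R) v" and cv: "continuous_on (cball c R) v"
    and eq: "\<And>x. x \<in> ball c R \<Longrightarrow> - lap v x = plus_powr p (v x)"
    and bd: "\<And>x. x \<in> sphere c R \<Longrightarrow> v x = \<gamma>"
    and int: "((\<lambda>x. plus_powr p (v x)) has_integral I) (ball c R)"
    using F R by (auto simp: F_sol_def C2beta_closure_def plus_powr_def)
  obtain G H where D: "grad_hess (ball c R) v G H" using C2_on_grad_hess[OF C2] by blast
  have D': "grad_hess (ball 0 R) (\<lambda>x. v (x + c)) (\<lambda>x. G (x + c)) (\<lambda>x. H (x + c))"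
    by (rule grad_hess_shift[OF D]) (simp add: dist_norm)
  have "\<exists>s>0. \<forall>x\<in>cball 0 R. v (x + c) = sol s (norm x)"
  proof (rule ball_solution_is_sol[OF N R _ D'])
    show "continuous_on (cball 0 R) (\<lambda>x. v (x + c))"
      by (rule continuous_on_compose2[OF cv]) (auto intro!: continuous_intros simp: dist_norm)
    show "lin_trace (H (x + c)) = - plus_powr p (v (x + c))" if "x \<in> ball 0 R" for x
    proof -
      have "x + c \<in> ball c R" using that by (simp add: dist_norm)
      then show ?thesis using grad_hess_lap[OF D open_ball] eq by force
    qed
    show "v (x + c) = \<gamma>" if "norm x = R" for x using bd[of "x + c"] that by (simp add: dist_norm)
    show "\<exists>x\<in>ball 0 R. plus_powr p (v (x + c)) \<noteq> 0"
    proof (rule ccontr)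
      assume *: "\<not> (\<exists>x\<in>ball 0 R. plus_powr p (v (x + c)) \<noteq> 0)"
      have "plus_powr p (v x) = 0" if "x \<in> ball c R" for x
        using *[unfolded bex_simps, rule_format, of "x - c"] that by (simp add: dist_norm norm_minus_commute)
      then have "((\<lambda>x. plus_powr p (v x)) has_integral 0) (ball c R)" by (rule has_integral_is_0)
      then show False using has_integral_unique[OF int] I by simp
    qed
  qed
  then obtain s where s: "s > 0" and vs: "\<And>x. x \<in> cball 0 R \<Longrightarrow> v (x + c) = sol s (norm x)" by blast
  have v: "v x = sol s (norm (x - c))" if "x \<in> cball c R" for x
    using vs[of "x - c"] that by (simp add: dist_norm norm_minus_commute)
  have "\<gamma> = sol s R"
  proof -
    have "c + R *\<^sub>R axis undefined 1 \<in> sphere c R" using R by (simp add: dist_norm)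
    then show ?thesis using bd[of "c + R *\<^sub>R axis undefined 1"] v[of "c + R *\<^sub>R axis undefined 1"] R by simp
  qed
  moreover have "((\<lambda>x. plus_powr p (v x)) has_integral real CARD('n) * measure lebesgue (ball (0::real^'n) 1) * mass s R) (ball c R)"
    by (rule has_integral_eq[OF _ sol_integral[OF s N R, of c]]) (simp add: v)
  ultimately show ?thesis using s v has_integral_unique[OF int] by blast
qed

lemma unit_ball_measure_pos: "measure lebesgue (ball (0::'a::euclidean_space) 1) > 0"
  using content_ball_pos[of 1 "0::'a"] by simp

text \<open>The equivalence evaluates the definite description in \<open>Ip\<close> directly. For a
  profile of scale \<open>s\<close>, a zero boundary value on the unit sphere means
  \<open>U s = 0\<close>, hence \<open>s = r0\<close>.\<close>

lemma LE_sol_iff: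
  assumes N: "CARD('n::finite) = m + 2"
  shows "(\<exists>u::real^'n \<Rightarrow> real. LE_sol p u \<and> integral (ball 0 1) (\<lambda>x. u x powr p) = I) \<longleftrightarrow>
    I = real CARD('n) * measure lebesgue (ball (0::real^'n) 1) * mass r0 1"
proof -
  let ?u = "\<lambda>x::real^'n. sol r0 (norm x)"
  have powr: "sol r0 (norm x) powr p = plus_powr p (sol r0 (norm x))" "sol r0 (norm x) > 0" if "norm x < 1" for x :: "real^'n"
  proof -
    have "r0 * norm x < r0 * 1" using r0 that by (intro mult_strict_left_mono) auto
    then have "U (r0 * norm x) > 0" using U_sign(1)[of "r0 * norm x"] r0 by simp
    then show "sol r0 (norm x) > 0" using amplitude_pos[OF r0(1)] by (simp add: sol_def)
    then show "sol r0 (norm x) powr p = plus_powr p (sol r0 (norm x))" by (simp add: plus_powr_pos)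
  qed
  have int: "integral (ball 0 1) (\<lambda>x. ?u x powr p) = real CARD('n) * measure lebesgue (ball (0::real^'n) 1) * mass r0 1"
  proof -
    have "((\<lambda>x. ?u x powr p) has_integral real CARD('n) * measure lebesgue (ball (0::real^'n) 1) * mass r0 1) (ball 0 1)"
      by (rule has_integral_eq[OF _ sol_integral[OF r0(1) N, of 1 0]]) (auto simp: powr)
    then show ?thesis by (rule integral_unique)
  qed
  have "LE_sol p ?u"
  proof -
    \<comment> \<open>An arbitrary Hoelder exponent; what is extracted is C^2 regularity and
      continuity on the closed ball.\<close>
    have "C2beta_closure (1/2) (ball 0 1) ?u" using sol_C2beta(1)[OF r0(1) N, of "1/2" 0 1] by simp
    moreover have "lap ?u x = - plus_powr p (?u x)" for x using sol_C2beta(2)[OF r0(1) N, of "1/2" 0] by simp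
    moreover have "sol r0 1 = 0" by (simp add: sol_def r0)
    ultimately show ?thesis by (auto simp: LE_sol_def C2beta_closure_def powr)
  qed
  moreover have "integral (ball 0 1) (\<lambda>x. u x powr p) = real CARD('n) * measure lebesgue (ball (0::real^'n) 1) * mass r0 1"
    if u: "LE_sol p u" for u :: "real^'n \<Rightarrow> real"
  proof -
    obtain G H where D: "grad_hess (ball 0 1) u G H" using C2_on_grad_hess u unfolding LE_sol_def by blast
    have pos: "u x > 0" if "x \<in> ball 0 1" for x using u that by (simp add: LE_sol_def)
    have lapu: "- lap u x = u x powr p" if "x \<in> ball 0 1" for x using u that by (simp add: LE_sol_def)
    have "\<exists>s>0. \<forall>x\<in>cball 0 1. u x = sol s (norm x)"
    proof (rule ball_solution_is_sol[OF N _ _ D])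
      show "continuous_on (cball 0 1) u" using u by (simp add: LE_sol_def)
      show "lin_trace (H x) = - plus_powr p (u x)" if "x \<in> ball 0 1" for x
        using grad_hess_lap[OF D open_ball that] lapu[OF that] pos[OF that] by (simp add: plus_powr_pos)
      show "u x = 0" if "norm x = 1" for x using u that by (simp add: LE_sol_def)
      show "\<exists>x\<in>ball 0 1. plus_powr p (u x) \<noteq> 0" using pos[of 0] by (intro bexI[of _ 0]) (auto simp: plus_powr_pos)
    qed simp
    then obtain s where s: "s > 0" and us: "\<And>x. x \<in> cball 0 1 \<Longrightarrow> u x = sol s (norm x)" by blast
    have "u (axis undefined 1) = 0" using u by (simp add: LE_sol_def)
    then have "sol s 1 = 0" using us[of "axis undefined 1"] by simp
    then have "U s = 0" using amplitude_pos[OF s] by (simp add: sol_def)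
    then have "s = r0" using U_sign[of s] s by force
    then have "integral (ball 0 1) (\<lambda>x. u x powr p) = integral (ball 0 1) (\<lambda>x. ?u x powr p)"
      using us by (intro integral_cong) auto
    then show ?thesis using int by simp
  qed
  ultimately show ?thesis using int by metis
qed

lemma Ip_eq:
  assumes "CARD('n::finite) = m + 2"
  shows "Ip TYPE('n) p = real CARD('n) * measure lebesgue (ball (0::real^'n) 1) * mass r0 1"
  unfolding Ip_def LE_sol_iff[OF assms] by simp

end

section \<open>The change of variables between (P_lambda) and (F_I)\<close>

lemma affine_C2beta:
  assumes S: "open S" and f: "C2beta_closure \<beta> S f"
  shows "C2beta_closure \<beta> S (\<lambda>x. a + b * f x)"
    and "x \<in> S \<Longrightarrow> lap (\<lambda>x. a + b * f x) x = b * lap f x"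
proof -
  let ?g = "\<lambda>x. a + b * f x"
  have C2: "C2_on S f" using f by (simp add: C2beta_closure_def)
  obtain G H where D: "grad_hess S f G H" using C2_on_grad_hess[OF C2] by blast
  have D': "grad_hess S ?g (\<lambda>x. b *\<^sub>R G x) (\<lambda>x h. b *\<^sub>R H x h)"
    using grad_hess_add[OF grad_hess_const[of S a] grad_hess_scale[OF D, of b]] by simp
  show "x \<in> S \<Longrightarrow> lap ?g x = b * lap f x"
    by (simp add: grad_hess_lap[OF D S] grad_hess_lap[OF D' S] lin_trace_scale)
  have pd1: "pd i ?g x = b * pd i f x" if "x \<in> S" for i x
    by (simp add: grad_hess_pd[OF D that] grad_hess_pd[OF D' that])
  \<comment> \<open>The first partial derivatives are known to agree on \<open>S\<close> only, so
    the second ones are read off the Hessians rather than rewritten under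
    \<open>pd j\<close>.\<close>
  have pd2: "pd j (pd i ?g) x = b * pd j (pd i f) x" if "x \<in> S" for i j x
    by (simp add: grad_hess_pd_pd[OF D S that] grad_hess_pd_pd[OF D' S that])
  have uc: "uniformly_continuous_on S (\<lambda>x. b * g x)" if "uniformly_continuous_on S g" for g :: "_ \<Rightarrow> real"
    using that by (rule bounded_linear.uniformly_continuous_on[OF bounded_linear_mult_right])
  have "C2_on S ?g"
    unfolding C2_on_def
  proof (intro conjI ballI allI)
    show "?g differentiable (at x)" if "x \<in> S" for x
      using D' that unfolding grad_hess_def differentiable_def by blast
    show "pd i ?g differentiable (at x)" if "x \<in> S" for i x
      using grad_hess_has_derivative_pd[OF D' S that] unfolding differentiable_def by blast
    show "continuous_on S (pd j (pd i ?g))" for i j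
    proof -
      have "continuous_on S (\<lambda>x. b * pd j (pd i f) x)"
        using C2 by (intro continuous_intros) (simp add: C2_on_def)
      then show ?thesis by (rule continuous_on_eq) (simp add: pd2)
    qed
  qed
  moreover have "continuous_on (closure S) ?g"
    using f by (intro continuous_intros) (simp add: C2beta_closure_def)
  moreover have "uniformly_continuous_on S ?g"
    using f by (intro uniformly_continuous_on_add uniformly_continuous_on_const uc) (simp add: C2beta_closure_def)
  moreover have "uniformly_continuous_on S (pd i ?g)" for i
  proof -
    have "uniformly_continuous_on S (\<lambda>x. b * pd i f x)" using f by (intro uc) (simp add: C2beta_closure_def)
    then show ?thesis unfolding uniformly_continuous_on_def by (simp add: pd1)
  qed
  moreover have "holder_on \<beta> S (pd j (pd i ?g))" for i j
  proof -
    obtain C where C: "\<And>x y. x \<in> S \<Longrightarrow> y \<in> S \<Longrightarrow> \<bar>pd j (pd i f) x - pd j (pd i f) y\<bar> \<le> C * norm (x - y) powr \<beta>"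
      using f unfolding C2beta_closure_def holder_on_def by meson
    have "\<bar>pd j (pd i ?g) x - pd j (pd i ?g) y\<bar> \<le> \<bar>b\<bar> * C * norm (x - y) powr \<beta>" if "x \<in> S" "y \<in> S" for x y
      using mult_left_mono[OF C[OF that], of "\<bar>b\<bar>"] that
      by (simp add: pd2 mult.assoc flip: right_diff_distrib abs_mult)
    then show ?thesis unfolding holder_on_def by blast
  qed
  ultimately show "C2beta_closure \<beta> S ?g" by (simp add: C2beta_closure_def)
qed

text \<open>For v = \<mu> (\<alpha> + lam \<psi>) the Laplacian gains the factor \<mu> lam and the
  nonlinearity \<mu>^p; these agree because \<mu>^(p-1) = lam, and \<mu>^p is the new mass.\<close>

lemma P_sol_imp_F_sol:
  fixes lam p :: real
  assumes p: "p > 1" and lam: "lam > 0" and P: "P_sol \<beta> p (ball c R) lam \<alpha> \<psi>"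
  defines "\<mu> \<equiv> lam powr (1 / (p - 1))"
  shows "F_sol \<beta> p (ball c R) (lam powr (p / (p - 1))) (\<mu> * \<alpha>) (\<lambda>x. \<mu> * \<alpha> + \<mu> * lam * \<psi> x)"
proof -
  have \<mu>: "\<mu> > 0" using lam by (simp add: \<mu>_def)
  have \<mu>p: "\<mu> powr p = lam powr (p / (p - 1))" by (simp add: \<mu>_def powr_powr)
  have "1 / (p - 1) + 1 = p / (p - 1)" using p by (simp add: field_simps)
  then have \<mu>l: "\<mu> * lam = \<mu> powr p" unfolding \<mu>p using lam powr_add[of lam "1 / (p - 1)" 1] by (simp add: \<mu>_def)
  have scale: "plus_powr p (\<mu> * \<alpha> + \<mu> * lam * t) = \<mu> powr p * plus_powr p (\<alpha> + lam * t)" for t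
    using plus_powr_scale[OF \<mu>, of p "\<alpha> + lam * t"] by (simp add: algebra_simps)
  have C: "C2beta_closure \<beta> (ball c R) \<psi>" using P by (simp add: P_sol_def)
  note aff = affine_C2beta[OF open_ball C, where a="\<mu> * \<alpha>" and b="\<mu> * lam"]
  have "((\<lambda>x. \<mu> powr p * plus_powr p (\<alpha> + lam * \<psi> x)) has_integral \<mu> powr p * 1) (ball c R)"
    using P by (intro has_integral_mult_right) (simp add: P_sol_def plus_powr_def)
  then have "((\<lambda>x. plus_powr p (\<mu> * \<alpha> + \<mu> * lam * \<psi> x)) has_integral lam powr (p / (p - 1))) (ball c R)"
    by (simp add: scale \<mu>p)
  moreover have "- lap (\<lambda>x. \<mu> * \<alpha> + \<mu> * lam * \<psi> x) x = plus_powr p (\<mu> * \<alpha> + \<mu> * lam * \<psi> x)" if "x \<in> ball c R" for x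
  proof -
    have eq: "plus_powr p (\<alpha> + lam * \<psi> x) = - lap \<psi> x" using P that by (simp add: P_sol_def plus_powr_def)
    have "- lap (\<lambda>x. \<mu> * \<alpha> + \<mu> * lam * \<psi> x) x = (\<mu> * lam) * (- lap \<psi> x)"
      by (subst aff(2)[OF that]) simp
    also have "\<dots> = \<mu> powr p * plus_powr p (\<alpha> + lam * \<psi> x)" by (simp only: \<mu>l eq)
    finally show ?thesis by (simp only: scale)
  qed
  ultimately show ?thesis
    using P aff(1) unfolding F_sol_def P_sol_def by (simp add: plus_powr_def)
qed

text \<open>The inverse substitution \<alpha> = \<gamma> / \<mu>, \<psi> = (v / \<mu> - \<alpha>) /
  lam, written in the affine shape of \<open>affine_C2beta\<close>.\<close>

lemma F_sol_imp_P_sol: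
  fixes lam p :: real
  assumes p: "p > 1" and lam: "lam > 0" and F: "F_sol \<beta> p (ball c R) (lam powr (p / (p - 1))) \<gamma> v"
  defines "\<mu> \<equiv> lam powr (1 / (p - 1))"
  shows "P_sol \<beta> p (ball c R) lam (\<gamma> / \<mu>) (\<lambda>x. - (\<gamma> / (\<mu> * lam)) + 1 / (\<mu> * lam) * v x)"
proof -
  have \<mu>: "\<mu> > 0" using lam by (simp add: \<mu>_def)
  have \<mu>p: "\<mu> powr p = lam powr (p / (p - 1))" by (simp add: \<mu>_def powr_powr)
  have "1 / (p - 1) + 1 = p / (p - 1)" using p by (simp add: field_simps)
  then have \<mu>l: "\<mu> * lam = \<mu> powr p" unfolding \<mu>p using lam powr_add[of lam "1 / (p - 1)" 1] by (simp add: \<mu>_def)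
  have arg: "\<gamma> / \<mu> + lam * (- (\<gamma> / (\<mu> * lam)) + 1 / (\<mu> * lam) * t) = t / \<mu>" for t
    using \<mu> lam by (simp add: field_simps)
  have scale: "plus_powr p (t / \<mu>) = 1 / (\<mu> * lam) * plus_powr p t" for t
    using plus_powr_scale[of "1 / \<mu>" p t] \<mu> lam by (simp add: \<mu>l powr_divide)
  have C: "C2beta_closure \<beta> (ball c R) v" using F by (simp add: F_sol_def)
  note aff = affine_C2beta[OF open_ball C, where a="- (\<gamma> / (\<mu> * lam))" and b="1 / (\<mu> * lam)"]
  have "((\<lambda>x. 1 / (\<mu> * lam) * plus_powr p (v x)) has_integral 1 / (\<mu> * lam) * (lam powr (p / (p - 1)))) (ball c R)"
    using F by (intro has_integral_mult_right) (simp add: F_sol_def plus_powr_def)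
  then have "((\<lambda>x. plus_powr p (v x / \<mu>)) has_integral 1) (ball c R)"
    unfolding scale using \<mu> by (simp add: \<mu>l flip: \<mu>p)
  moreover have "- lap (\<lambda>x. - (\<gamma> / (\<mu> * lam)) + 1 / (\<mu> * lam) * v x) x = plus_powr p (v x / \<mu>)" if "x \<in> ball c R" for x
  proof -
    have eq: "plus_powr p (v x) = - lap v x" using F that by (simp add: F_sol_def plus_powr_def)
    show ?thesis unfolding aff(2)[OF that] scale eq by simp
  qed
  ultimately show ?thesis
    using F aff(1) unfolding F_sol_def P_sol_def arg by (simp add: plus_powr_def)
qed

theorem theorem9p1:
  fixes p \<beta> R :: real and c :: "real^'n::finite"
  defines "N \<equiv> real CARD('n)"
  defines "\<Omega> \<equiv> ball c R"
  defines "Istar \<equiv> Ip TYPE('n) p / R powr (2 / (p - 1) - N + 2)"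
  defines "lstar \<equiv> Istar powr ((p - 1) / p)"
  defines "cN \<equiv> 1 / (N * (N - 2) * measure lebesgue (ball (0::real^'n) 1) * R powr (N - 2))"
  assumes N3: "CARD('n) \<ge> 3"
    and p: "1 < p" "p < N / (N - 2)"
    and R: "R > 0" "measure lebesgue (ball c R) = 1"
    and beta: "0 < \<beta>" "\<beta> < 1"
  shows
    "(\<forall>I>0. \<exists>\<gamma> v. F_sol \<beta> p \<Omega> I \<gamma> v \<and>
        (\<forall>\<gamma>' v'. F_sol \<beta> p \<Omega> I \<gamma>' v' \<longrightarrow> \<gamma>' = \<gamma> \<and> (\<forall>x\<in>closure \<Omega>. v' x = v x))) \<and>
     (\<forall>lam>0. \<exists>\<alpha> \<psi>. P_sol \<beta> p \<Omega> lam \<alpha> \<psi> \<and>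
        (\<forall>\<alpha>' \<psi>'. P_sol \<beta> p \<Omega> lam \<alpha>' \<psi>' \<longrightarrow> \<alpha>' = \<alpha> \<and> (\<forall>x\<in>closure \<Omega>. \<psi>' x = \<psi> x))) \<and>
     (\<forall>lam>0. \<forall>\<alpha> \<psi> \<gamma> v. P_sol \<beta> p \<Omega> lam \<alpha> \<psi> \<and> F_sol \<beta> p \<Omega> (lam powr (p / (p - 1))) \<gamma> v \<longrightarrow>
        (let I = lam powr (p / (p - 1)) in
          ((\<alpha> > 0 \<longleftrightarrow> \<gamma> > 0) \<and> (\<gamma> > 0 \<longleftrightarrow> I < Istar) \<and> (I < Istar \<longleftrightarrow> lam < lstar)) \<and>
          (({x\<in>\<Omega>. v x > 0} \<noteq> \<Omega> \<longleftrightarrow> \<gamma> < 0) \<and> (\<gamma> < 0 \<longleftrightarrow> I > Istar) \<and> (I > Istar \<longleftrightarrow> lam > lstar)) \<and>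
          (lam > lstar \<longrightarrow>
             \<alpha> = cN * lam * (1 - (lam / lstar) powr (p / (N / (N - 2) - p))))))"
proof -
  define m where "m = CARD('n) - 2"
  have N: "CARD('n) = m + 2" and m: "m \<ge> 1" using N3 by (auto simp: m_def)
  have Nm: "N = real m + 2" by (simp add: N_def N)
  have pm: "p * m < m + 2" using p(2) m by (simp add: Nm field_simps)
  obtain U Q where "emden m p U Q" using emden_exists[OF m p(1)] pm by auto
  then interpret emden m p U Q .
  define K where "K = real CARD('n) * measure lebesgue (ball (0::real^'n) 1)"
  have K: "K > 0" using unit_ball_measure_pos[where 'a="real^'n"] by (simp add: K_def)
  have cl: "closure \<Omega> = cball c R" using R by (simp add: \<Omega>_def)
  have sR: "r0 / R > 0" using r0 R by simp
  have kap: "2 / (p - 1) - N + 2 = \<kappa>" by (simp add: \<kappa>_def Nm)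
  \<comment> \<open>\<open>s = r0 / R\<close> is the scale whose profile vanishes on the sphere of
    radius \<open>R\<close>; I_p is the case R = 1. In both, \<open>Q\<close> is evaluated at
    \<open>r0\<close>, so the masses differ by the factor \<open>R powr \<kappa>\<close>
    only.\<close>
  have Istar: "Istar = K * mass (r0 / R) R"
    using r0 R unfolding Istar_def Ip_eq[OF N] kap
    by (simp add: K_def mass_def powr_divide)
  have Istar_pos: "Istar > 0" unfolding Istar using K mass_pos[OF sR R(1)] by simp
  have Fsol: "F_sol \<beta> p \<Omega> (K * mass s R) (sol s R) (\<lambda>x. sol s (norm (x - c)))" if "s > 0" for s
    unfolding \<Omega>_def K_def by (rule F_sol_sol[OF N R(1) that beta])
  have Funique: "\<gamma> = sol s R \<and> (\<forall>x\<in>cball c R. v x = sol s (norm (x - c)))"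
    if s: "s > 0" and F: "F_sol \<beta> p \<Omega> (K * mass s R) \<gamma> v" for s \<gamma> v
  proof -
    have "K * mass s R > 0" using K mass_pos[OF s R(1)] by simp
    from F_sol_classification[OF N R(1) this F[unfolded \<Omega>_def]]
    obtain t where t: "t > 0" "\<forall>x\<in>cball c R. v x = sol t (norm (x - c))" "\<gamma> = sol t R"
      "K * mass s R = K * mass t R" unfolding K_def by blast
    have "t = s" using t(4) K mass_less_iff[OF t(1) s R(1)] mass_less_iff[OF s t(1) R(1)] by force
    then show ?thesis using t by simp
  qed
  have Iex: "\<exists>s>0. I = K * mass s R" if I: "I > 0" for I
  proof -
    have "I / K > 0" using I K by simp
    then obtain s where "s > 0" "mass s R = I / K" using mass_surj[OF _ R(1)] by blast
    then show ?thesis using K by (intro exI[of _ s]) simp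
  qed
  have part1: "\<exists>\<gamma> v. F_sol \<beta> p \<Omega> I \<gamma> v \<and>
        (\<forall>\<gamma>' v'. F_sol \<beta> p \<Omega> I \<gamma>' v' \<longrightarrow> \<gamma>' = \<gamma> \<and> (\<forall>x\<in>closure \<Omega>. v' x = v x))" if I: "I > 0" for I
  proof -
    obtain s where s: "s > 0" "I = K * mass s R" using Iex[OF I] by blast
    show ?thesis unfolding s(2) cl using Fsol[OF s(1)] Funique[OF s(1)] by blast
  qed
  define \<mu> where "\<mu> = (\<lambda>lam::real. lam powr (1 / (p - 1)))"
  have PF: "F_sol \<beta> p \<Omega> (lam powr (p / (p - 1))) (\<mu> lam * \<alpha>) (\<lambda>x. \<mu> lam * \<alpha> + \<mu> lam * lam * \<psi> x)"
    if "lam > 0" "P_sol \<beta> p \<Omega> lam \<alpha> \<psi>" for lam \<alpha> \<psi>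
    unfolding \<mu>_def \<Omega>_def by (rule P_sol_imp_F_sol[OF p(1) that(1) that(2)[unfolded \<Omega>_def]])
  have part2: "\<exists>\<alpha> \<psi>. P_sol \<beta> p \<Omega> lam \<alpha> \<psi> \<and>
        (\<forall>\<alpha>' \<psi>'. P_sol \<beta> p \<Omega> lam \<alpha>' \<psi>' \<longrightarrow> \<alpha>' = \<alpha> \<and> (\<forall>x\<in>closure \<Omega>. \<psi>' x = \<psi> x))"
    if lam: "lam > 0" for lam
  proof -
    have \<mu>: "\<mu> lam > 0" using lam by (simp add: \<mu>_def)
    have "lam powr (p / (p - 1)) > 0" using lam by simp
    from Iex[OF this] obtain s where s: "s > 0" "lam powr (p / (p - 1)) = K * mass s R" by blast
    have "\<exists>\<alpha> \<psi>. P_sol \<beta> p \<Omega> lam \<alpha> \<psi>"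
      using F_sol_imp_P_sol[OF p(1) lam Fsol[OF s(1), unfolded \<Omega>_def, folded s(2)]] unfolding \<Omega>_def by blast
    then obtain \<alpha> \<psi> where P: "P_sol \<beta> p \<Omega> lam \<alpha> \<psi>" by blast
    note u = Funique[OF s(1) PF[OF lam P, unfolded s(2)]]
    \<comment> \<open>Uniqueness is inherited from (F_I): both solutions are sent to the profile of
      the same scale \<open>s\<close>, and the substitution is injective since
      \<open>\<mu> lam\<close> and \<open>lam\<close> are positive.\<close>
    have "\<alpha>' = \<alpha> \<and> (\<forall>x\<in>closure \<Omega>. \<psi>' x = \<psi> x)" if P': "P_sol \<beta> p \<Omega> lam \<alpha>' \<psi>'" for \<alpha>' \<psi>'
    proof -
      note u' = Funique[OF s(1) PF[OF lam P', unfolded s(2)]]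
      have "\<mu> lam * \<alpha>' = \<mu> lam * \<alpha>" using u u' by simp
      then have \<alpha>: "\<alpha>' = \<alpha>" using \<mu> by simp
      have "\<psi>' x = \<psi> x" if "x \<in> cball c R" for x
      proof -
        have "\<mu> lam * \<alpha>' + \<mu> lam * lam * \<psi>' x = \<mu> lam * \<alpha> + \<mu> lam * lam * \<psi> x"
            using u u' that by metis
        then show ?thesis using \<alpha> \<mu> lam by simp
      qed
      then show ?thesis using \<alpha> cl by simp
    qed
    then show ?thesis using P by blast
  qed
  have part3: "(let I = lam powr (p / (p - 1)) in
          ((\<alpha> > 0 \<longleftrightarrow> \<gamma> > 0) \<and> (\<gamma> > 0 \<longleftrightarrow> I < Istar) \<and> (I < Istar \<longleftrightarrow> lam < lstar)) \<and>
          (({x\<in>\<Omega>. v x > 0} \<noteq> \<Omega> \<longleftrightarrow> \<gamma> < 0) \<and> (\<gamma> < 0 \<longleftrightarrow> I > Istar) \<and> (I > Istar \<longleftrightarrow> lam > lstar)) \<and>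
          (lam > lstar \<longrightarrow>
             \<alpha> = cN * lam * (1 - (lam / lstar) powr (p / (N / (N - 2) - p)))))"
    if lam: "lam > 0" and P: "P_sol \<beta> p \<Omega> lam \<alpha> \<psi>" and F: "F_sol \<beta> p \<Omega> (lam powr (p / (p - 1))) \<gamma> v"
    for lam \<alpha> \<psi> \<gamma> v
  proof -
    define I where "I = lam powr (p / (p - 1))"
    have \<mu>: "\<mu> lam > 0" using lam by (simp add: \<mu>_def)
    have "I > 0" using lam by (simp add: I_def)
    from Iex[OF this] obtain s where s: "s > 0" and Is: "I = K * mass s R" by blast
    note u = Funique[OF s F[folded I_def, unfolded Is]]
    have \<gamma>: "\<gamma> = amplitude s * U (s * R)" using u by (simp add: sol_def)
    have v: "v x = amplitude s * U (s * norm (x - c))" if "x \<in> \<Omega>" for x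
      using u that by (simp add: sol_def \<Omega>_def)
    have \<alpha>: "\<gamma> = \<mu> lam * \<alpha>" using Funique[OF s PF[OF lam P, folded I_def, unfolded Is]] u by simp
    have b: "amplitude s > 0" by (rule amplitude_pos[OF s])
    have sR0: "s * R \<ge> 0" using s R by simp
    have lt: "s * R < r0 \<longleftrightarrow> s < r0 / R" "s * R > r0 \<longleftrightarrow> s > r0 / R" using R by (simp_all add: field_simps)
    have 1: "\<gamma> > 0 \<longleftrightarrow> I < Istar"
      using U_sign(1)[OF sR0] b K mass_less_iff[OF s sR R(1)]
      by (simp add: \<gamma> zero_less_mult_iff Is Istar lt)
    have 2: "\<gamma> < 0 \<longleftrightarrow> I > Istar"
      using U_sign(2)[OF sR0] b K mass_less_iff[OF sR s R(1)]
      by (simp add: \<gamma> mult_less_0_iff Is Istar lt)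
    have lamI: "lam = I powr ((p - 1) / p)" using lam p by (simp add: I_def powr_powr)
    have cmp: "a < b \<longleftrightarrow> a powr ((p - 1) / p) < b powr ((p - 1) / p)" if "a > 0" "b > 0" for a b
      using powr_less_mono2[of "(p - 1) / p" a b] powr_less_mono2[of "(p - 1) / p" b a] that p
      by (cases a b rule: linorder_cases) auto
    have 3: "I < Istar \<longleftrightarrow> lam < lstar" "I > Istar \<longleftrightarrow> lam > lstar"
      using cmp[OF \<open>I > 0\<close> Istar_pos] cmp[OF Istar_pos \<open>I > 0\<close>] by (simp_all only: lstar_def lamI[symmetric])
    \<comment> \<open>Strict decrease along radii turns a nonpositive interior value into a negative
      boundary value; conversely, for \<gamma> < 0 the profile vanishes at radius r0 / s <
      R.\<close>
    have 4: "{x\<in>\<Omega>. v x > 0} \<noteq> \<Omega> \<longleftrightarrow> \<gamma> < 0"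
    proof
      assume "{x\<in>\<Omega>. v x > 0} \<noteq> \<Omega>"
      then obtain x where x: "x \<in> \<Omega>" "\<not> v x > 0" by blast
      have "s * norm (x - c) < s * R" using x s by (intro mult_strict_left_mono) (auto simp: \<Omega>_def dist_norm norm_minus_commute)
      then have "U (s * R) < U (s * norm (x - c))" using s by (intro U_strict) auto
      also have "U (s * norm (x - c)) \<le> 0" using x b by (simp add: v not_less mult_le_0_iff)
      finally show "\<gamma> < 0" using b by (simp add: \<gamma> mult_pos_neg)
    next
      assume "\<gamma> < 0"
      then have "r0 < s * R" using U_sign(2)[OF sR0] b by (simp add: \<gamma> mult_less_0_iff)
      then have "r0 / s < R" using s by (simp add: field_simps)
      moreover define x where "x = c + (r0 / s) *\<^sub>R axis undefined 1"
      moreover have "r0 / s > 0" using r0 s by simp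
      ultimately have x: "x \<in> \<Omega>" "norm (x - c) = r0 / s" using r0 s by (simp_all add: \<Omega>_def dist_norm)
      have "v x = 0" using s r0 by (simp add: v x)
      then show "{x\<in>\<Omega>. v x > 0} \<noteq> \<Omega>" using x by force
    qed
    have 5: "\<alpha> = cN * lam * (1 - (lam / lstar) powr (p / (N / (N - 2) - p)))" if "lam > lstar"
    proof -
      have "I > Istar" using that 3 by simp
      then have "r0 < s * R" using mass_less_iff[OF sR s R(1)] K by (simp add: Is Istar lt)
      then have after: "Q (s * R) = Q r0" "U (s * R) = Q r0 / m * (1 / (s * R) ^ m - 1 / r0 ^ m)"
        by (intro Q_after U_after; simp)+
      \<comment> \<open>The zero of the profile now lies inside the ball, so
        \<open>Q (s * R) = Q r0\<close> no longer depends on \<open>s\<close> and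
        \<open>I / Istar\<close> is the pure power \<open>z powr \<kappa>\<close>.\<close>
      define z where "z = s * R / r0"
      have z: "z > 0" using s R r0 by (simp add: z_def)
      have "I / Istar = (s / (r0 / R)) powr \<kappa>"
        using K s sR r0 Q_pos[OF r0(1)] R by (simp add: Is Istar mass_def after powr_divide powr_mult)
      also have "s / (r0 / R) = z" using R by (simp add: z_def)
      finally have "lam / lstar = (z powr \<kappa>) powr ((p - 1) / p)"
        unfolding lstar_def lamI using \<open>I > 0\<close> Istar_pos by (simp flip: powr_divide)
      then have "(lam / lstar) powr (p / (N / (N - 2) - p)) = z powr (\<kappa> * ((p - 1) / p) * (p / (N / (N - 2) - p)))"
        by (simp add: powr_powr)
      \<comment> \<open>With d = m + 2 - p m one has \<kappa> (p - 1) = d and p_N - p = d / m, so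
        the exponents collapse to N - 2.\<close>
      also have "\<kappa> * ((p - 1) / p) * (p / (N / (N - 2) - p)) = m"
      proof -
        have "\<kappa> * (p - 1) = m + 2 - p * m" using p by (simp add: \<kappa>_def field_simps)
        moreover have "N / (N - 2) - p = (m + 2 - p * m) / m" using m by (simp add: Nm field_simps)
        moreover have "d / p * (p / (d / m)) = m" if "d > 0" for d using that p m by simp
        from this[of "m + 2 - p * m"] have "(m + 2 - p * m) / p * (p / ((m + 2 - p * m) / m)) = m"
          using pm by simp
        ultimately show ?thesis by (simp only: times_divide_eq_right)
      qed
      also have "z powr m = z ^ m" using z by (simp add: powr_realpow)
      finally have pw: "(lam / lstar) powr (p / (N / (N - 2) - p)) = z ^ m" .
      \<comment> \<open>The powers of \<open>s\<close> recombine into the mass: amplitude s / s^m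
        times Q r0 is I / K, and 1 / (K m R^m) is \<open>cN\<close>. Dividing by
        \<open>\<mu> lam\<close> leaves one factor \<open>lam\<close>, because I = \<mu> lam times
        lam.\<close>
      have "\<gamma> = amplitude s * (Q r0 / m * (1 / (s * R) ^ m - 1 / r0 ^ m))" by (simp add: \<gamma> after)
      also have "1 / (s * R) ^ m - 1 / r0 ^ m = 1 / (s ^ m * R ^ m) * (1 - z ^ m)"
        using s R r0 by (simp add: z_def power_mult_distrib power_divide field_simps)
      also have "amplitude s * (Q r0 / m * (1 / (s ^ m * R ^ m) * (1 - z ^ m))) = (amplitude s / s ^ m) * Q r0 / (m * R ^ m) * (1 - z ^ m)"
        by (simp add: mult_ac)
      also have "amplitude s / s ^ m = s powr \<kappa>"
        using s by (simp add: amplitude_def \<kappa>_def powr_diff powr_realpow)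
      also have "s powr \<kappa> * Q r0 = I / K" using K by (simp add: Is mass_def after)
      also have "I / K / (m * R ^ m) = I * cN"
      proof -
        have "R powr (N - 2) = R ^ m" using R by (simp add: Nm powr_realpow)
        then show ?thesis by (simp add: cN_def K_def Nm N mult_ac)
      qed
      finally have "\<mu> lam * \<alpha> = I * cN * (1 - z ^ m)" by (simp add: \<alpha>)
      moreover have "I = \<mu> lam * lam"
      proof -
        have "p / (p - 1) = 1 / (p - 1) + 1" using p by (simp add: field_simps)
        then show ?thesis using lam by (simp add: I_def \<mu>_def powr_add)
      qed
      ultimately have "\<mu> lam * \<alpha> = \<mu> lam * (cN * lam * (1 - z ^ m))" by (simp add: mult_ac)
      then show ?thesis using \<mu> pw by simp
    qed
    have 6: "\<alpha> > 0 \<longleftrightarrow> \<gamma> > 0" using \<mu> by (simp add: \<alpha> zero_less_mult_iff)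
    show ?thesis
      unfolding Let_def I_def[symmetric] using 1 2 3 4 5 6 by blast
  qed
  show ?thesis using part1 part2 part3 by blast
qed

end
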